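(* There is an absolute constant $C>0$ such that the following holds. Let $\Gamma$ be an extension parallel congestion game with $n$ players, common strategy set $\mathcal{P}=\{p_1,\dots,p_q\}$ and non-negative non-decreasing cost functions, let $T\geq 0$ and $\epsilon\in(0,1)$. Consider the procedure: start from an arbitrary base $B_0$ of the $n$-uniform matroid on $E'=\{(p,j):p\in\mathcal{P},1\le j\le n\}$ (i.e., any $n$-element subset of $E'$), run the base-exchange Markov chain with weights $w_\Pi$ for $t$ steps, obtaining $B_t$; let $\alpha=\alpha(B_t)$; output a strategy profile $s$ chosen uniformly at random from $\mathcal{S}(\alpha)$. If $t\geq C\,n\log(n/\epsilon)$, then the distribution $\bar\pi$ of the output satisfies $d_{TV}(\bar\pi,\pi)\leq\epsilon$, where $\pi$ is the Gibbs distribution of $\Gamma$ at temperature $T$.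
   Context: EP congestion game: player set $N=[n]$; resources are the arcs of an extension parallel network (defined recursively: a single arc $(o,d)$; parallel composition of two EP networks, identifying sources and targets; series composition of a single arc with an EP network); every player's strategies are the $o,d$-paths $\mathcal{P}$; arc $e$ has cost $c_e:\mathbb{Z}_{\ge0}\to\mathbb{Q}$. $\ell_e(s)=|\{i:e\in s_i\}|$; Rosenthal's potential $\Phi(s)=\sum_e\sum_{k=1}^{\ell_e(s)}c_e(k)$. Gibbs distribution on $\mathcal{P}^n$: $\pi(s)=e^{-T\Phi(s)}/\sum_{t\in\mathcal{P}^n}e^{-T\Phi(t)}$. Strategy load profile $z(s)_p=|\{i:s_i=p\}|$, $\mathcal{S}(\alpha)=\{s:z(s)=\alpha\}$, $\Phi(\alpha)=\Phi(s)$ for $s\in\mathcal{S}(\alpha)$. For $B\subseteq E'$, $\alpha(B)_p=|\{j:(p,j)\in B\}|$. Weights: $w_\Pi(B)=\binom{n}{\alpha(B)}^{-1}\frac{n!}{\alpha(B)!}e^{-T\Phi(\alpha(B))}$ where $\binom{n}{\alpha}=\prod_p\binom{n}{\alpha_p}$, $\alpha!=\prod_p\alpha_p!$. Base-exchange Markov chain: from base $B$, choose $e\in B$ uniformly at random, then move to a base $B'\supseteq B\setminus\{e\}$ with probability proportional to $w_\Pi(B')$. $d_{TV}(\mu,\nu)=\frac12\sum_x|\mu(x)-\nu(x)|$. *)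

theory Defs
  imports Complex_Main "HOL-Library.FuncSet"
begin

text \<open>An EP network with arcs labelled by elements of 'e. Arc e is a single
arc (o,d); Par composes two EP networks in parallel (identifying sources and
targets); Ser composes a single arc in series with an EP network.\<close>

datatype 'e ep = Arc 'e | Par "'e ep" "'e ep" | Ser 'e "'e ep"

fun arcs :: "'e ep \<Rightarrow> 'e set" where
  "arcs (Arc e) = {e}"
| "arcs (Par a b) = arcs a \<union> arcs b"
| "arcs (Ser e a) = insert e (arcs a)"

fun wf_ep :: "'e ep \<Rightarrow> bool" where
  "wf_ep (Arc e) = True"
| "wf_ep (Par a b) = (wf_ep a \<and> wf_ep b \<and> arcs a \<inter> arcs b = {})"
| "wf_ep (Ser e a) = (wf_ep a \<and> e \<notin> arcs a)"

fun paths :: "'e ep \<Rightarrow> 'e set set" where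
  "paths (Arc e) = {{e}}"
| "paths (Par a b) = paths a \<union> paths b"
| "paths (Ser e a) = insert e ` paths a"

definition profiles :: "'e ep \<Rightarrow> nat \<Rightarrow> (nat \<Rightarrow> 'e set) set" where
  "profiles G n = {..<n} \<rightarrow>\<^sub>E paths G"

definition load :: "nat \<Rightarrow> (nat \<Rightarrow> 'e set) \<Rightarrow> 'e \<Rightarrow> nat" where
  "load n s e = card {i. i < n \<and> e \<in> s i}"

definition potential :: "'e ep \<Rightarrow> nat \<Rightarrow> ('e \<Rightarrow> nat \<Rightarrow> rat) \<Rightarrow> (nat \<Rightarrow> 'e set) \<Rightarrow> real" where
  "potential G n c s = (\<Sum>e\<in>arcs G. \<Sum>k=1..load n s e. real_of_rat (c e k))"

definition gibbs :: "'e ep \<Rightarrow> nat \<Rightarrow> ('e \<Rightarrow> nat \<Rightarrow> rat) \<Rightarrow> real \<Rightarrow> (nat \<Rightarrow> 'e set) \<Rightarrow> real" where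
  "gibbs G n c T s = exp (- T * potential G n c s) /
      (\<Sum>u\<in>profiles G n. exp (- T * potential G n c u))"

definition zload :: "nat \<Rightarrow> (nat \<Rightarrow> 'e set) \<Rightarrow> 'e set \<Rightarrow> nat" where
  "zload n s p = card {i. i < n \<and> s i = p}"

definition Sprof :: "'e ep \<Rightarrow> nat \<Rightarrow> ('e set \<Rightarrow> nat) \<Rightarrow> (nat \<Rightarrow> 'e set) set" where
  "Sprof G n \<alpha> = {s \<in> profiles G n. \<forall>p\<in>paths G. zload n s p = \<alpha> p}"

text \<open>Potential of a strategy load profile: the potential of any profile in S(alpha).\<close>
definition potential_lp :: "'e ep \<Rightarrow> nat \<Rightarrow> ('e \<Rightarrow> nat \<Rightarrow> rat) \<Rightarrow> ('e set \<Rightarrow> nat) \<Rightarrow> real" where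
  "potential_lp G n c \<alpha> = potential G n c (SOME s. s \<in> Sprof G n \<alpha>)"

definition Eprime :: "'e ep \<Rightarrow> nat \<Rightarrow> ('e set \<times> nat) set" where
  "Eprime G n = paths G \<times> {1..n}"

definition bases :: "'e ep \<Rightarrow> nat \<Rightarrow> ('e set \<times> nat) set set" where
  "bases G n = {B. B \<subseteq> Eprime G n \<and> card B = n}"

definition alphaB :: "('e set \<times> nat) set \<Rightarrow> 'e set \<Rightarrow> nat" where
  "alphaB B p = card {j. (p, j) \<in> B}"

definition weight :: "'e ep \<Rightarrow> nat \<Rightarrow> ('e \<Rightarrow> nat \<Rightarrow> rat) \<Rightarrow> real \<Rightarrow> ('e set \<times> nat) set \<Rightarrow> real" where
  "weight G n c T B =
     inverse (\<Prod>p\<in>paths G. real (n choose alphaB B p))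
     * (fact n / (\<Prod>p\<in>paths G. fact (alphaB B p)))
     * exp (- T * potential_lp G n c (alphaB B))"

definition trans :: "'e ep \<Rightarrow> nat \<Rightarrow> ('e \<Rightarrow> nat \<Rightarrow> rat) \<Rightarrow> real \<Rightarrow>
    ('e set \<times> nat) set \<Rightarrow> ('e set \<times> nat) set \<Rightarrow> real" where
  "trans G n c T B B' =
     (\<Sum>e\<in>B. (1 / real (card B)) *
        (if B' \<in> bases G n \<and> B - {e} \<subseteq> B'
         then weight G n c T B' /
              (\<Sum>B''\<in>{B'' \<in> bases G n. B - {e} \<subseteq> B''}. weight G n c T B'')
         else 0))"

fun chain_dist :: "'e ep \<Rightarrow> nat \<Rightarrow> ('e \<Rightarrow> nat \<Rightarrow> rat) \<Rightarrow> real \<Rightarrow>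
    ('e set \<times> nat) set \<Rightarrow> nat \<Rightarrow> ('e set \<times> nat) set \<Rightarrow> real" where
  "chain_dist G n c T B0 0 B = (if B = B0 then 1 else 0)"
| "chain_dist G n c T B0 (Suc t) B' =
     (\<Sum>B\<in>bases G n. chain_dist G n c T B0 t B * trans G n c T B B')"

definition output_dist :: "'e ep \<Rightarrow> nat \<Rightarrow> ('e \<Rightarrow> nat \<Rightarrow> rat) \<Rightarrow> real \<Rightarrow>
    ('e set \<times> nat) set \<Rightarrow> nat \<Rightarrow> (nat \<Rightarrow> 'e set) \<Rightarrow> real" where
  "output_dist G n c T B0 t s =
     (\<Sum>B\<in>bases G n. chain_dist G n c T B0 t B *
        (if s \<in> Sprof G n (alphaB B) then 1 / real (card (Sprof G n (alphaB B))) else 0))"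

definition dTV :: "'a set \<Rightarrow> ('a \<Rightarrow> real) \<Rightarrow> ('a \<Rightarrow> real) \<Rightarrow> real" where
  "dTV X \<mu> \<nu> = (1/2) * (\<Sum>x\<in>X. \<bar>\<mu> x - \<nu> x\<bar>)"

end

theory Submission
  imports Defs "HOL-Library.Multiset"
begin

text \<open>On the multiset of chosen paths, the base-exchange chain is single-site Glauber dynamics (remove a
  uniformly random player, resample its path from the conditional Gibbs law): the number of free copies of a
  path exactly cancels the combinatorial factors of the weights.

  Arcs of an extension parallel network form a forest, whence two facts about the Gibbs weight. First,
  \<open>w (C + p + q) * w C\<close> equals \<open>w (C + p) * w (C + q)\<close> times a kernel \<open>K\<close> depending on \<open>p \<inter> q\<close>, and
  \<open>1 - K\<close> is positive semidefinite. Through a trickle-down argument this gives negative correlations for any number of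
  players, hence log-concavity of the generating polynomial, entropic independence, and contraction of relative
  entropy by \<open>1 - 1/n\<close> per step. Second, the potential is M\<open>\<natural>\<close>-convex. By the exchange property a
  conditional probability \<open>P(x | z)\<close> is at most \<open>k\<close> times the corresponding \<open>k\<close>-player marginal, whatever
  \<open>z\<close> is. So, once every player has been updated, the law of the chain has density at most \<open>n!\<close> with respect to the Gibbs
  distribution, and its relative entropy is at most of order \<open>n\<^sup>2\<close>, for every initial state and every
  temperature.\<close>

subsection \<open>Sums over multisets and a trickle-down lemma\<close>

text \<open>The obstacle is uniformity in \<open>T\<close> and in the costs. From a point mass the
  relative entropy is the logarithm of an inverse Gibbs probability, which grows with the potential,
  so contraction alone cannot give a time of order \<open>n * ln (n / \<epsilon>)\<close>. The
  factorial in the warm start is a product: when a player receives its last update while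
  \<open>k\<close> players, itself included, still have updates to come, the exchange property costs
  a factor \<open>k\<close>, and the arbitrary current values of the others drop out of the bound.

  Trickle-down is free of loss here because averaging the inequality over one pinned player says
  that the two-player Markov operator is at most its own square. Its eigenvalues are then
  nonpositive or at least 1, and strict positivity of the weights leaves only the constants for the
  second alternative.

  Weights stay unnormalised throughout. Conditioning on a player is then just adding an element to a
  multiset, and every induction on the number of players can be applied to a pinned subsystem. Of
  the \<open>t\<close> steps one half serves to update every player and the other half to contract
  the entropy; the constant 40 comes from this split.\<close>

text \<open>The sum ranges over ordered tuples, so a multiset is counted once for each of its
  orderings. This matches summation over strategy profiles and keeps multinomial coefficients
  implicit.\<close>

primrec msum :: "'p set \<Rightarrow> nat \<Rightarrow> ('p multiset \<Rightarrow> real) \<Rightarrow> real" where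
  "msum P 0 F = F {#}"
| "msum P (Suc n) F = (\<Sum>p\<in>P. msum P n (\<lambda>A. F (add_mset p A)))"

lemma msum_cong:
  "(\<And>A. set_mset A \<subseteq> P \<Longrightarrow> size A = n \<Longrightarrow> F A = F' A) \<Longrightarrow> msum P n F = msum P n F'"
proof (induction n arbitrary: F F')
  case (Suc n)
  have "msum P n (\<lambda>A. F (add_mset p A)) = msum P n (\<lambda>A. F' (add_mset p A))" if "p \<in> P" for p
    by (rule Suc.IH, rule Suc.prems) (use that in auto)
  then show ?case by simp
qed simp

lemma msum_mono:
  "(\<And>A. set_mset A \<subseteq> P \<Longrightarrow> size A = n \<Longrightarrow> F A \<le> F' A) \<Longrightarrow> msum P n F \<le> msum P n F'"
proof (induction n arbitrary: F F')
  case (Suc n)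
  have "msum P n (\<lambda>A. F (add_mset p A)) \<le> msum P n (\<lambda>A. F' (add_mset p A))" if "p \<in> P" for p
    by (rule Suc.IH, rule Suc.prems) (use that in auto)
  then show ?case by (simp add: sum_mono)
qed simp

lemma msum_add: "msum P n (\<lambda>A. F A + H A) = msum P n F + msum P n H"
  by (induction n arbitrary: F H) (auto simp: sum.distrib)

lemma msum_cmult: "msum P n (\<lambda>A. c * F A) = c * msum P n F"
  by (induction n arbitrary: F) (auto simp: sum_distrib_left)

lemma msum_cmult_right: "msum P n (\<lambda>A. F A * c) = msum P n F * c"
  using msum_cmult[of P n c F] by (simp add: mult.commute)

lemma msum_diff: "msum P n (\<lambda>A. F A - H A) = msum P n F - msum P n H"
  using msum_add[of P n F "\<lambda>A. (-1) * H A"] msum_cmult[of P n "-1" H] by simp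

lemma msum_zero [simp]: "msum P n (\<lambda>A. 0) = 0"
  by (induction n) auto

lemma msum_sum: "msum P n (\<lambda>A. \<Sum>i\<in>I. F i A) = (\<Sum>i\<in>I. msum P n (F i))"
proof (induction n arbitrary: F)
  case (Suc n)
  then show ?case by (simp add: sum.swap[of _ I P])
qed simp

lemma msum_nonneg:
  "(\<And>A. set_mset A \<subseteq> P \<Longrightarrow> size A = n \<Longrightarrow> 0 \<le> F A) \<Longrightarrow> 0 \<le> msum P n F"
  using msum_mono[of P n "\<lambda>_. 0" F] by simp

lemma msum_pos:
  assumes "finite P" "P \<noteq> {}"
  shows "(\<And>A. set_mset A \<subseteq> P \<Longrightarrow> size A = n \<Longrightarrow> 0 < F A) \<Longrightarrow> 0 < msum P n F"
proof (induction n arbitrary: F)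
  case (Suc n)
  have "0 < msum P n (\<lambda>A. F (add_mset p A))" if "p \<in> P" for p
    by (rule Suc.IH, rule Suc.prems) (use that in auto)
  then show ?case using assms by (simp add: sum_pos)
qed simp

text \<open>Mark one position of a tuple: by symmetry all \<open>Suc n\<close> positions contribute
  equally. This double count is the source of the factor \<open>Suc n\<close> in entropic
  independence, in the Glauber operator and in the conditional bound.\<close>

lemma msum_pull:
  "msum P (Suc n) (\<lambda>A. \<Sum>x\<in>#A. G x (A - {#x#})) = real (Suc n) * (\<Sum>p\<in>P. msum P n (G p))"
proof (induction n arbitrary: G)
  case 0
  show ?case by simp
next
  case (Suc n)
  have eq: "(\<Sum>x\<in>#add_mset p A. G x (add_mset p A - {#x#})) =
      G p A + (\<Sum>x\<in>#A. G x (add_mset p (A - {#x#})))" for p A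
  proof -
    have "(\<Sum>x\<in>#A. G x (add_mset p A - {#x#})) = (\<Sum>x\<in>#A. G x (add_mset p (A - {#x#})))"
      by (intro arg_cong[of _ _ sum_mset] image_mset_cong) simp
    then show ?thesis by simp
  qed
  have "msum P (Suc (Suc n)) (\<lambda>A. \<Sum>x\<in>#A. G x (A - {#x#}))
      = (\<Sum>p\<in>P. msum P (Suc n) (\<lambda>A. G p A + (\<Sum>x\<in>#A. G x (add_mset p (A - {#x#})))))"
    by (subst msum.simps(2)) (simp only: eq)
  also have "\<dots> = (\<Sum>p\<in>P. msum P (Suc n) (G p) +
      msum P (Suc n) (\<lambda>A. \<Sum>x\<in>#A. G x (add_mset p (A - {#x#}))))"
    by (intro sum.cong refl msum_add)
  also have "\<dots> = (\<Sum>p\<in>P. msum P (Suc n) (G p) +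
      real (Suc n) * (\<Sum>q\<in>P. msum P n (\<lambda>A. G q (add_mset p A))))"
    by (intro sum.cong refl arg_cong2[of _ _ _ _ "(+)"] Suc.IH)
  also have "\<dots> = (\<Sum>p\<in>P. msum P (Suc n) (G p)) +
      real (Suc n) * (\<Sum>p\<in>P. \<Sum>q\<in>P. msum P n (\<lambda>A. G q (add_mset p A)))"
    by (simp only: sum.distrib sum_distrib_left)
  also have "(\<Sum>p\<in>P. \<Sum>q\<in>P. msum P n (\<lambda>A. G q (add_mset p A))) = (\<Sum>q\<in>P. msum P (Suc n) (G q))"
    by (subst sum.swap) simp
  finally show ?case by (simp add: algebra_simps del: msum.simps)
qed

text \<open>For the Markov operator \<open>K\<close>, the row normalisation of \<open>M\<close>,
  hypothesis \<open>H\<close> reads \<open>K <= K^2\<close> in the inner product weighted by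
  \<open>\<mu>\<close>, so an eigenvalue is nonpositive or at least 1. Positive entries exclude the
  latter on mean-zero functions. The conclusion is nonpositivity there, completed by equality on
  constants. A supremum of Rayleigh quotients stands in for the top eigenvalue.\<close>

lemma trickle_down:
  fixes M :: "'p \<Rightarrow> 'p \<Rightarrow> real"
  assumes fin: "finite P" and ne: "P \<noteq> {}"
    and pos: "\<And>p q. p \<in> P \<Longrightarrow> q \<in> P \<Longrightarrow> 0 < M p q"
    and sym: "\<And>p q. M p q = M q p"
    and mu: "\<And>p. \<mu> p = (\<Sum>q\<in>P. M p q)"
    and H: "\<And>u. (\<Sum>p\<in>P. \<Sum>q\<in>P. u p * u q * M p q) \<le> (\<Sum>r\<in>P. (\<Sum>p\<in>P. M r p * u p)\<^sup>2 / \<mu> r)"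
  shows "(\<Sum>p\<in>P. \<mu> p) * (\<Sum>p\<in>P. \<Sum>q\<in>P. u p * u q * M p q) \<le> (\<Sum>p\<in>P. \<mu> p * u p)\<^sup>2"
proof -
  define B where "B f g = (\<Sum>p\<in>P. \<Sum>q\<in>P. f p * g q * M p q)" for f g
  define ip where "ip f g = (\<Sum>p\<in>P. \<mu> p * (f p * g p))" for f g
  define m where "m f = (\<Sum>p\<in>P. \<mu> p * f p)" for f
  define K where "K f r = (\<Sum>p\<in>P. M r p * f p) / \<mu> r" for f r
  define Z where "Z = (\<Sum>p\<in>P. \<mu> p)"
  have mupos: "0 < \<mu> p" if "p \<in> P" for p
    unfolding mu using that fin ne pos by (intro sum_pos) auto
  have Zpos: "0 < Z" unfolding Z_def using fin ne mupos by (intro sum_pos) auto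
  have Bsym: "B f g = B g f" for f g
    unfolding B_def by (subst sum.swap) (simp add: sym mult_ac)
  have BK: "B f g = ip f (K g)" for f g
    unfolding B_def ip_def K_def
    by (intro sum.cong refl) (use mupos in \<open>force simp: sum_distrib_left mult_ac sum_divide_distrib less_imp_neq\<close>)
  have Badd: "B (\<lambda>p. a * f p + b * g p) h = a * B f h + b * B g h" for a b f g h
    unfolding B_def by (simp add: sum.distrib sum_distrib_left algebra_simps)
  have Badd2: "B h (\<lambda>p. a * f p + b * g p) = a * B h f + b * B h g" for a b f g h
    using Badd Bsym by metis
  have ipsym: "ip f g = ip g f" for f g unfolding ip_def by (simp add: mult_ac)
  have ipadd: "ip (\<lambda>p. a * f p + b * g p) h = a * ip f h + b * ip g h" for a b f g h
    unfolding ip_def by (simp add: sum.distrib sum_distrib_left algebra_simps)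
  have ipadd2: "ip h (\<lambda>p. a * f p + b * g p) = a * ip h f + b * ip h g" for a b f g h
    using ipadd ipsym by metis
  have madd: "m (\<lambda>p. a * f p + b * g p) = a * m f + b * m g" for a b f g
    unfolding m_def by (simp add: sum.distrib sum_distrib_left algebra_simps)
  have B1: "B (\<lambda>_. 1) f = m f" for f
    unfolding B_def m_def mu by (subst sum.swap) (simp add: sym sum_distrib_left mult_ac)
  have mK: "m (K f) = m f" for f
    unfolding B1[symmetric] using BK[of "\<lambda>_. 1" f] by (simp add: B1 ip_def m_def)
  have ip_nonneg: "0 \<le> ip f f" for f
    unfolding ip_def using mupos by (intro sum_nonneg) (simp add: less_imp_le)
  have HK: "B f f \<le> ip (K f) (K f)" for f
  proof -
    have "ip (K f) (K f) = (\<Sum>r\<in>P. (\<Sum>p\<in>P. M r p * f p)\<^sup>2 / \<mu> r)"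
      unfolding ip_def K_def using mupos
      by (intro sum.cong refl) (force simp: power2_eq_square field_simps)
    then show ?thesis using H[of f] unfolding B_def by simp
  qed
  have expand: "(\<Sum>p\<in>P. \<Sum>q\<in>P. M p q * (f p - s * f q)\<^sup>2) = (1 + s\<^sup>2) * ip f f - 2 * s * B f f" for f s
  proof -
    have "(\<Sum>p\<in>P. \<Sum>q\<in>P. M p q * (f p - s * f q)\<^sup>2)
       = (\<Sum>p\<in>P. \<Sum>q\<in>P. M p q * (f p * f p)) + s\<^sup>2 * (\<Sum>p\<in>P. \<Sum>q\<in>P. M p q * (f q * f q)) - 2 * s * B f f"
      unfolding B_def sum_distrib_left sum.distrib[symmetric] sum_subtractf[symmetric]
      by (intro sum.cong refl) (simp add: power2_eq_square algebra_simps)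
    moreover have "(\<Sum>p\<in>P. \<Sum>q\<in>P. M p q * (f p * f p)) = ip f f"
      unfolding ip_def mu by (simp add: sum_distrib_right)
    moreover have "(\<Sum>p\<in>P. \<Sum>q\<in>P. M p q * (f q * f q)) = ip f f"
      unfolding ip_def mu by (subst sum.swap) (simp add: sum_distrib_right sym)
    ultimately show ?thesis by (simp add: algebra_simps)
  qed
  have Blow: "- ip f f \<le> B f f" for f
  proof -
    have "0 \<le> (\<Sum>p\<in>P. \<Sum>q\<in>P. M p q * (f p - (-1) * f q)\<^sup>2)"
      using pos by (intro sum_nonneg) (simp add: less_imp_le)
    then show ?thesis unfolding expand by simp
  qed
  \<comment> \<open>Since \<open>P\<close> is finite, the least ratio is a uniform minorisation of
    Doeblin type; it makes the spectral gap strict.\<close>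
  obtain c where c: "0 < c" "\<And>p q. p \<in> P \<Longrightarrow> q \<in> P \<Longrightarrow> c * (\<mu> p * \<mu> q) \<le> M p q"
  proof -
    let ?S = "(\<lambda>(p,q). M p q / (\<mu> p * \<mu> q)) ` (P \<times> P)"
    have fS: "finite ?S" "?S \<noteq> {}" using fin ne by auto
    have "Min ?S \<in> ?S" using fS by (rule Min_in)
    then have "0 < Min ?S" using pos mupos by (force simp del: Min_in)
    moreover have "Min ?S * (\<mu> p * \<mu> q) \<le> M p q" if "p \<in> P" "q \<in> P" for p q
    proof -
      have "Min ?S \<le> M p q / (\<mu> p * \<mu> q)" using fS that by (intro Min_le) auto
      then show ?thesis using mupos that by (simp add: pos_le_divide_eq)
    qed
    ultimately show ?thesis using that by blast
  qed
  define \<kappa> where "\<kappa> = c * Z"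
  have kpos: "0 < \<kappa>" unfolding \<kappa>_def using c Zpos by simp
  have gap: "B f f \<le> (1 - \<kappa>) * ip f f" if "m f = 0" for f
  proof -
    have "c * (\<Sum>p\<in>P. \<Sum>q\<in>P. (\<mu> p * \<mu> q) * (f p - f q)\<^sup>2) \<le> (\<Sum>p\<in>P. \<Sum>q\<in>P. M p q * (f p - 1 * f q)\<^sup>2)"
      unfolding sum_distrib_left
    proof (intro sum_mono)
      fix p q assume "p \<in> P" "q \<in> P"
      then have "(c * (\<mu> p * \<mu> q)) * (f p - f q)\<^sup>2 \<le> M p q * (f p - f q)\<^sup>2"
        by (intro mult_right_mono c) auto
      then show "c * (\<mu> p * \<mu> q * (f p - f q)\<^sup>2) \<le> M p q * (f p - 1 * f q)\<^sup>2"
        by (simp add: mult.assoc)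
    qed
    moreover have "(\<Sum>p\<in>P. \<Sum>q\<in>P. (\<mu> p * \<mu> q) * (f p - f q)\<^sup>2) = 2 * Z * ip f f - 2 * (m f * m f)"
    proof -
      have "(\<Sum>p\<in>P. \<Sum>q\<in>P. (\<mu> p * \<mu> q) * (f p - f q)\<^sup>2)
        = (\<Sum>p\<in>P. \<Sum>q\<in>P. \<mu> p * (f p * f p) * \<mu> q) + (\<Sum>p\<in>P. \<Sum>q\<in>P. \<mu> p * (\<mu> q * (f q * f q))) - 2 * (\<Sum>p\<in>P. \<Sum>q\<in>P. \<mu> p * f p * (\<mu> q * f q))"
        unfolding sum_distrib_left sum.distrib[symmetric] sum_subtractf[symmetric]
        by (intro sum.cong refl) (simp add: power2_eq_square algebra_simps)
      moreover have "(\<Sum>p\<in>P. \<Sum>q\<in>P. \<mu> p * (f p * f p) * \<mu> q) = ip f f * Z"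
        unfolding ip_def Z_def sum_product ..
      moreover have "(\<Sum>p\<in>P. \<Sum>q\<in>P. \<mu> p * (\<mu> q * (f q * f q))) = Z * ip f f"
        unfolding ip_def Z_def sum_product ..
      moreover have "(\<Sum>p\<in>P. \<Sum>q\<in>P. \<mu> p * f p * (\<mu> q * f q)) = m f * m f"
        unfolding m_def sum_product ..
      ultimately show ?thesis by simp
    qed
    ultimately show ?thesis unfolding expand using that by (simp add: \<kappa>_def algebra_simps)
  qed
  have neg: "B f f \<le> 0" if mf: "m f = 0" for f
  proof (rule ccontr)
    assume "\<not> B f f \<le> 0"
    then have Bf: "0 < B f f" by simp
    have ipf: "0 < ip f f"
    proof (rule ccontr)
      assume "\<not> 0 < ip f f"
      then have "ip f f = 0" using ip_nonneg[of f] by simp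
      then show False using gap[OF mf] Bf by simp
    qed
    define S where "S = {B v v | v. m v = 0 \<and> ip v v = 1}"
    define L where "L = Sup S"
    have hom: "B (\<lambda>p. a * v p) (\<lambda>p. a * v p) = a\<^sup>2 * B v v" "ip (\<lambda>p. a * v p) (\<lambda>p. a * v p) = a\<^sup>2 * ip v v"
      "m (\<lambda>p. a * v p) = a * m v" for a v
      unfolding B_def ip_def m_def by (simp_all add: power2_eq_square sum_distrib_left mult_ac)
    have bdd: "bdd_above S" unfolding S_def
      using gap by (intro bdd_aboveI[of _ "1 - \<kappa>"]) force
    have memS: "B v v / ip v v \<in> S" if "m v = 0" "0 < ip v v" for v
    proof -
      define w where "w = (\<lambda>p. 1 / sqrt (ip v v) * v p)"
      have "(1 / sqrt (ip v v))\<^sup>2 = 1 / ip v v" using that by (simp add: power_divide)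
      then have "B w w = B v v / ip v v" "ip w w = 1" "m w = 0"
        unfolding w_def hom using that by simp_all
      then show ?thesis unfolding S_def by (intro CollectI exI[of _ w]) simp
    qed
    have up: "B v v \<le> L * ip v v" if "m v = 0" for v
    proof (cases "ip v v = 0")
      case True
      then show ?thesis using gap[OF that] by simp
    next
      case False
      then have p: "0 < ip v v" using ip_nonneg[of v] by simp
      have "B v v / ip v v \<le> L" unfolding L_def by (intro cSup_upper bdd memS that p)
      then show ?thesis using p by (simp add: field_simps)
    qed
    have lpos: "0 < L" using up[OF mf] Bf ipf by (smt (verit) mult_nonneg_nonneg zero_less_mult_iff)
    have ne: "S \<noteq> {}" using memS[OF mf ipf] by auto
    have l1: "L \<le> 1 - \<kappa>" unfolding L_def
      by (rule cSup_least[OF ne]) (use gap in \<open>force simp: S_def\<close>)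
    \<comment> \<open>Since \<open>L * ip - B\<close> is positive semidefinite on mean-zero functions, near-maximisers are near-eigenvectors,
      and for these the hypothesis gives \<open>L \<le> L\<^sup>2\<close>.\<close>
    have imp: "B v v \<le> L - L * (1 - L) / 3" if mv: "m v = 0" and iv: "ip v v = 1" for v
    proof -
      define g where "g = (\<lambda>p. L * v p + (-1) * K v p)"
      have mg: "m g = 0" unfolding g_def madd mK mv by simp
      \<comment> \<open>\<open>g\<close> is the residual of \<open>v\<close> as an eigenvector for
        \<open>L\<close>. Since \<open>L * ip g g - B g g\<close> is at most
        \<open>2 * ip g g\<close>, the step length 1/2 is the best one, and it bounds
        \<open>ip g g\<close> by \<open>2 * (L - B v v)\<close>.\<close>
      let ?h = "\<lambda>p. 1 * v p + (-1/2) * g p"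
      have mh: "m ?h = 0" unfolding madd mg mv by simp
      have "ip g g = ip g (\<lambda>p. L * v p + (-1) * K v p)"
        by (rule arg_cong[of _ _ "ip g"]) (rule g_def)
      then have A_vg: "L * ip g v - B g v = ip g g"
        unfolding ipadd2 BK[of g v] by simp
      have "0 \<le> L * ip ?h ?h - B ?h ?h" using up[OF mh] by simp
      also have "\<dots> = (L * ip v v - B v v) - (L * ip g v - B g v) + 1/4 * (L * ip g g - B g g)"
        unfolding ipadd ipadd2 Badd Badd2 using ipsym[of v g] Bsym[of v g] by (simp add: algebra_simps)
      also have "\<dots> \<le> (L * ip v v - B v v) - ip g g + 1/4 * (2 * ip g g)"
      proof -
        have "L * ip g g \<le> 1 * ip g g" using l1 kpos by (intro mult_right_mono ip_nonneg) simp
        then have "L * ip g g - B g g \<le> 2 * ip g g" using Blow[of g] by argo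
        then show ?thesis unfolding A_vg by argo
      qed
      finally have N: "ip g g \<le> 2 * (L - B v v)" unfolding iv by argo
      have Kv: "K v = (\<lambda>p. L * v p + (-1) * g p)" unfolding g_def by auto
      have "B v v \<le> ip (K v) (K v)" by (rule HK)
      also have "\<dots> = L\<^sup>2 * ip v v - 2 * L * ip g v + ip g g"
        unfolding Kv ipadd ipadd2 using ipsym[of v g] by (simp add: algebra_simps power2_eq_square)
      also have "ip g v = L * ip v v - B v v"
        unfolding g_def ipadd using BK[of v v] ipsym[of v "K v"] by simp
      finally have "B v v \<le> L\<^sup>2 - 2 * L * (L - B v v) + ip g g" using iv by simp
      moreover have "0 \<le> 2 * L * (L - B v v)" using lpos up[OF mv] iv by simp
      ultimately have "3 * B v v \<le> L\<^sup>2 + 2 * L" using N by argo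
      moreover have "L * (1 - L) = L - L\<^sup>2" by (simp add: power2_eq_square algebra_simps)
      ultimately show ?thesis by argo
    qed
    have "L \<le> L - L * (1 - L) / 3"
    proof -
      have "Sup S \<le> L - L * (1 - L) / 3"
        by (rule cSup_least[OF ne]) (use imp in \<open>auto simp: S_def\<close>)
      then show ?thesis by (simp only: L_def)
    qed
    then show False using lpos l1 kpos by (simp add: mult_le_0_iff)
  qed
  define a where "a = m u / Z"
  define v where "v = (\<lambda>p. 1 * u p + (-a) * 1)"
  have m1: "m (\<lambda>_. 1) = Z" unfolding m_def Z_def by simp
  have mv: "m v = 0" unfolding v_def madd m1 a_def using Zpos by simp
  have u: "u = (\<lambda>p. 1 * v p + a * 1)" unfolding v_def by auto
  have "B u u = B v v + 2 * a * m v + a\<^sup>2 * Z"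
    unfolding u Badd Badd2 using Bsym[of v "\<lambda>_. 1"] by (simp add: B1 m1 power2_eq_square algebra_simps)
  also have "\<dots> \<le> a\<^sup>2 * Z" using neg[OF mv] mv by simp
  finally have "Z * B u u \<le> Z * (a\<^sup>2 * Z)" using Zpos by simp
  also have "\<dots> = (m u)\<^sup>2" unfolding a_def using Zpos by (simp add: power2_eq_square)
  finally show ?thesis unfolding Z_def B_def m_def .
qed

subsection \<open>Negative dependence\<close>

text \<open>A local condition across three consecutive numbers of players: the matrix
  \<open>w C * w (C + p + q) - w (C + p) * w (C + q)\<close> is negative semidefinite. Positivity is
  asked of all multisets, also those with elements outside \<open>P\<close>, so that later quotients
  carry no side conditions.\<close>

definition neg_dep :: "'p set \<Rightarrow> ('p multiset \<Rightarrow> real) \<Rightarrow> bool" where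
  "neg_dep P w \<longleftrightarrow> (\<forall>A. 0 < w A) \<and>
     (\<forall>C u. w C * (\<Sum>p\<in>P. \<Sum>q\<in>P. u p * u q * w (add_mset p (add_mset q C)))
        \<le> (\<Sum>p\<in>P. u p * w (add_mset p C))\<^sup>2)"

lemma neg_dep_pos: "neg_dep P w \<Longrightarrow> 0 < w A"
  by (simp add: neg_dep_def)

lemma neg_dep_add_mset:
  assumes "neg_dep P w" shows "neg_dep P (\<lambda>A. w (add_mset r A))"
  unfolding neg_dep_def
proof (intro conjI allI)
  fix C u
  show "w (add_mset r C) * (\<Sum>p\<in>P. \<Sum>q\<in>P. u p * u q * w (add_mset r (add_mset p (add_mset q C))))
      \<le> (\<Sum>p\<in>P. u p * w (add_mset r (add_mset p C)))\<^sup>2"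
    using assms unfolding neg_dep_def by (simp add: add_mset_commute[of r])
qed (use assms in \<open>simp add: neg_dep_def\<close>)

text \<open>The factors of \<open>p\<close> and \<open>q\<close> are absorbed into the test
  function, and those of \<open>C\<close> enter both sides squared. Stability under external fields
  is what later turns an inequality at one point into log-concavity along a segment.\<close>

lemma neg_dep_tilt:
  assumes "neg_dep P w" "\<And>x. 0 < f x"
  shows "neg_dep P (\<lambda>A. w A * (\<Prod>x\<in>#A. f x))"
  unfolding neg_dep_def
proof (intro conjI allI)
  fix C u
  let ?c = "\<Prod>x\<in>#C. f x"
  have "w C * (\<Sum>p\<in>P. \<Sum>q\<in>P. (u p * f p) * (u q * f q) * w (add_mset p (add_mset q C)))
        \<le> (\<Sum>p\<in>P. (u p * f p) * w (add_mset p C))\<^sup>2"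
    using assms(1) unfolding neg_dep_def by (elim conjE allE[of _ C] allE[of _ "\<lambda>p. u p * f p"])
  then have "?c\<^sup>2 * (w C * (\<Sum>p\<in>P. \<Sum>q\<in>P. (u p * f p) * (u q * f q) * w (add_mset p (add_mset q C))))
        \<le> ?c\<^sup>2 * (\<Sum>p\<in>P. (u p * f p) * w (add_mset p C))\<^sup>2"
    by (intro mult_left_mono) auto
  then show "w C * ?c * (\<Sum>p\<in>P. \<Sum>q\<in>P. u p * u q * (w (add_mset p (add_mset q C)) * (\<Prod>x\<in>#add_mset p (add_mset q C). f x)))
      \<le> (\<Sum>p\<in>P. u p * (w (add_mset p C) * (\<Prod>x\<in>#add_mset p C. f x)))\<^sup>2"
    unfolding power_mult_distrib[symmetric] unfolding power2_eq_square[of ?c]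
    by (simp add: sum_distrib_left mult_ac)
next
  fix A
  have "0 < (\<Prod>x\<in>#A. f x)" using assms(2) by (induction A) auto
  then show "0 < w A * (\<Prod>x\<in>#A. f x)" using assms(1) by (simp add: neg_dep_def)
qed

text \<open>The local condition lifted to the pair marginal of \<open>m + 2\<close> players. The
  induction hypothesis for the weight with one more player \<open>r\<close> pinned, divided by
  \<open>\<mu> r\<close> and summed over \<open>r\<close>, is exactly the hypothesis of
  \<open>trickle_down\<close>.\<close>

lemma neg_dep_msum:
  assumes fin: "finite P" and ne: "P \<noteq> {}"
  shows "neg_dep P w \<Longrightarrow>
    msum P (Suc (Suc m)) w * (\<Sum>p\<in>P. \<Sum>q\<in>P. u p * u q * msum P m (\<lambda>A. w (add_mset p (add_mset q A))))
      \<le> (\<Sum>p\<in>P. u p * msum P (Suc m) (\<lambda>A. w (add_mset p A)))\<^sup>2"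
proof (induction m arbitrary: w u)
  case 0
  then have H: "w {#} * (\<Sum>p\<in>P. \<Sum>q\<in>P. v p * v q * w (add_mset p (add_mset q {#})))
        \<le> (\<Sum>p\<in>P. v p * w (add_mset p {#}))\<^sup>2" for v
    unfolding neg_dep_def by (elim conjE allE[of _ "{#}"] allE[of _ v])
  have pos: "0 < w A" for A using 0 by (rule neg_dep_pos)
  define Q where "Q f g = (\<Sum>p\<in>P. \<Sum>q\<in>P. f p * g q * w (add_mset p (add_mset q {#})))"
    for f g :: "'a \<Rightarrow> real"
  define l where "l f = (\<Sum>p\<in>P. f p * w (add_mset p {#}))" for f :: "'a \<Rightarrow> real"
  have Qsym: "Q f g = Q g f" for f g
    unfolding Q_def by (subst sum.swap) (simp add: mult_ac add_mset_commute)
  have Q11: "0 < Q (\<lambda>_. 1) (\<lambda>_. 1)"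
    unfolding Q_def using fin ne pos by (auto intro!: sum_pos)
  have l1: "0 < l (\<lambda>_. 1)"
    unfolding l_def using fin ne pos by (auto intro!: sum_pos)
  \<comment> \<open>Reverse Cauchy-Schwarz: \<open>Q\<close> is nonpositive on the hyperplane where
    \<open>l\<close> vanishes and positive at the constant 1, so \<open>u\<close> is shifted by a
    constant into that hyperplane.\<close>
  define c where "c = l u / l (\<lambda>_. 1)"
  let ?v = "\<lambda>p. u p - c * 1"
  have "l ?v = l u - c * l (\<lambda>_. 1)"
    unfolding l_def by (simp add: algebra_simps sum_subtractf sum_distrib_left)
  then have "l ?v = 0" using l1 by (simp add: c_def)
  then have "w {#} * Q ?v ?v \<le> 0" using H[of ?v] unfolding Q_def l_def by simp
  then have "Q ?v ?v \<le> 0" using pos[of "{#}"] by (simp add: mult_le_0_iff)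
  moreover have "Q ?v ?v = Q u u - c * Q u (\<lambda>_. 1) - c * Q (\<lambda>_. 1) u + c\<^sup>2 * Q (\<lambda>_. 1) (\<lambda>_. 1)"
    unfolding Q_def by (simp add: algebra_simps sum_subtractf sum.distrib sum_distrib_left power2_eq_square)
  ultimately have "Q u u - 2 * c * Q u (\<lambda>_. 1) + c\<^sup>2 * Q (\<lambda>_. 1) (\<lambda>_. 1) \<le> 0"
    unfolding Qsym[of "\<lambda>_. 1" u] by argo
  then have "Q (\<lambda>_. 1) (\<lambda>_. 1) * (Q u u - 2 * c * Q u (\<lambda>_. 1) + c\<^sup>2 * Q (\<lambda>_. 1) (\<lambda>_. 1)) \<le> 0"
    using Q11 by (intro mult_nonneg_nonpos) auto
  moreover have "Q (\<lambda>_. 1) (\<lambda>_. 1) * (Q u u - 2 * c * Q u (\<lambda>_. 1) + c\<^sup>2 * Q (\<lambda>_. 1) (\<lambda>_. 1))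
      = Q (\<lambda>_. 1) (\<lambda>_. 1) * Q u u - (Q u (\<lambda>_. 1))\<^sup>2 + (c * Q (\<lambda>_. 1) (\<lambda>_. 1) - Q u (\<lambda>_. 1))\<^sup>2"
    by (simp add: power2_eq_square algebra_simps)
  moreover have "0 \<le> (c * Q (\<lambda>_. 1) (\<lambda>_. 1) - Q u (\<lambda>_. 1))\<^sup>2" by simp
  ultimately have "Q (\<lambda>_. 1) (\<lambda>_. 1) * Q u u \<le> (Q u (\<lambda>_. 1))\<^sup>2" by argo
  then show ?case by (simp add: Q_def sum_distrib_left)
next
  case (Suc m)
  define M where "M p q = msum P (Suc m) (\<lambda>A. w (add_mset p (add_mset q A)))" for p q
  define \<mu> where "\<mu> p = (\<Sum>q\<in>P. M p q)" for p
  have pos: "0 < w A" for A using Suc.prems by (rule neg_dep_pos)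
  have Mpos: "0 < M p q" for p q unfolding M_def by (rule msum_pos[OF fin ne pos])
  have mupos: "0 < \<mu> p" for p unfolding \<mu>_def using fin ne Mpos by (intro sum_pos) auto
  have mu_eq: "\<mu> p = msum P (Suc (Suc m)) (\<lambda>A. w (add_mset p A))" for p
    unfolding \<mu>_def M_def by simp
  have "(\<Sum>p\<in>P. \<mu> p) * (\<Sum>p\<in>P. \<Sum>q\<in>P. u p * u q * M p q) \<le> (\<Sum>p\<in>P. \<mu> p * u p)\<^sup>2"
  proof (rule trickle_down[OF fin ne])
    fix v
    have 1: "(\<Sum>p\<in>P. \<Sum>q\<in>P. v p * v q * msum P m (\<lambda>A. w (add_mset r (add_mset p (add_mset q A)))))
       \<le> (\<Sum>p\<in>P. M r p * v p)\<^sup>2 / \<mu> r" for r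
      using Suc.IH[OF neg_dep_add_mset[OF Suc.prems, of r], of v] mupos[of r]
      by (simp add: pos_le_divide_eq mu_eq[symmetric] M_def mult.commute del: msum.simps)
    have "M p q = (\<Sum>r\<in>P. msum P m (\<lambda>A. w (add_mset r (add_mset p (add_mset q A)))))" for p q
      unfolding M_def by (simp add: add_mset_commute)
    then have "(\<Sum>p\<in>P. \<Sum>q\<in>P. v p * v q * M p q)
      = (\<Sum>p\<in>P. \<Sum>q\<in>P. \<Sum>r\<in>P. v p * v q * msum P m (\<lambda>A. w (add_mset r (add_mset p (add_mset q A)))))"
      by (simp add: sum_distrib_left)
    also have "\<dots> = (\<Sum>p\<in>P. \<Sum>r\<in>P. \<Sum>q\<in>P. v p * v q * msum P m (\<lambda>A. w (add_mset r (add_mset p (add_mset q A)))))"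
      by (intro sum.cong refl sum.swap)
    also have "\<dots> = (\<Sum>r\<in>P. \<Sum>p\<in>P. \<Sum>q\<in>P. v p * v q * msum P m (\<lambda>A. w (add_mset r (add_mset p (add_mset q A)))))"
      by (rule sum.swap)
    also have "\<dots> \<le> (\<Sum>r\<in>P. (\<Sum>p\<in>P. M r p * v p)\<^sup>2 / \<mu> r)"
      by (intro sum_mono 1)
    finally show "(\<Sum>p\<in>P. \<Sum>q\<in>P. v p * v q * M p q) \<le> (\<Sum>r\<in>P. (\<Sum>p\<in>P. M r p * v p)\<^sup>2 / \<mu> r)" .
  next
    show "M p q = M q p" for p q unfolding M_def by (simp only: add_mset_commute)
  qed (use Mpos \<mu>_def in auto)
  moreover have "msum P (Suc (Suc (Suc m))) w = (\<Sum>p\<in>P. \<mu> p)"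
    unfolding mu_eq by (rule msum.simps(2))
  moreover have "(\<Sum>p\<in>P. \<mu> p * u p) = (\<Sum>p\<in>P. u p * msum P (Suc (Suc m)) (\<lambda>A. w (add_mset p A)))"
    unfolding mu_eq by (intro sum.cong refl mult.commute)
  ultimately show ?case unfolding M_def by (simp del: msum.simps)
qed


section \<open>Log-concavity of the tilted partition function\<close>

text \<open>By symmetry the \<open>n\<close> factors depending on \<open>t\<close> contribute
  equally to the product rule. For \<open>n = 0\<close> the truncated \<open>n - 1\<close> is
  harmless because of the factor \<open>real n\<close>.\<close>

lemma msum_tilt_deriv:
  "((\<lambda>t. msum P n (\<lambda>A. F A * (\<Prod>x\<in>#A. 1 + t * g x))) has_real_derivative
     real n * (\<Sum>q\<in>P. g q * msum P (n - 1) (\<lambda>A. F (add_mset q A) * (\<Prod>x\<in>#A. 1 + t * g x)))) (at t)"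
proof (induction n arbitrary: F)
  case 0
  show ?case by simp
next
  case (Suc n)
  let ?\<Pi> = "\<lambda>s A. \<Prod>x\<in>#A. 1 + s * g x"
  have f: "(\<lambda>t. msum P (Suc n) (\<lambda>A. F A * ?\<Pi> t A)) =
      (\<lambda>t. \<Sum>p\<in>P. (1 + t * g p) * msum P n (\<lambda>A. F (add_mset p A) * ?\<Pi> t A))"
    by (simp add: msum_cmult[symmetric] mult_ac)
  have "((\<lambda>t. \<Sum>p\<in>P. (1 + t * g p) * msum P n (\<lambda>A. F (add_mset p A) * ?\<Pi> t A)) has_real_derivative
      (\<Sum>p\<in>P. g p * msum P n (\<lambda>A. F (add_mset p A) * ?\<Pi> t A)
        + (1 + t * g p) * (real n * (\<Sum>q\<in>P. g q * msum P (n - 1) (\<lambda>A. F (add_mset p (add_mset q A)) * ?\<Pi> t A))))) (at t)"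
  proof (rule DERIV_sum)
    fix p
    have "((\<lambda>t. 1 + t * g p) has_real_derivative g p) (at t)"
      by (auto intro!: derivative_eq_intros)
    from DERIV_mult[OF this Suc.IH[of "\<lambda>A. F (add_mset p A)"]]
    show "((\<lambda>t. (1 + t * g p) * msum P n (\<lambda>A. F (add_mset p A) * ?\<Pi> t A)) has_real_derivative
       g p * msum P n (\<lambda>A. F (add_mset p A) * ?\<Pi> t A)
        + (1 + t * g p) * (real n * (\<Sum>q\<in>P. g q * msum P (n - 1) (\<lambda>A. F (add_mset p (add_mset q A)) * ?\<Pi> t A)))) (at t)"
      by (rule DERIV_cong) simp
  qed
  moreover have "(\<Sum>p\<in>P. (1 + t * g p) * (real n * (\<Sum>q\<in>P. g q * msum P (n - 1) (\<lambda>A. F (add_mset p (add_mset q A)) * ?\<Pi> t A))))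
     = real n * (\<Sum>q\<in>P. g q * msum P n (\<lambda>A. F (add_mset q A) * ?\<Pi> t A))"
  proof (cases n)
    case (Suc k)
    have "(\<Sum>p\<in>P. (1 + t * g p) * (\<Sum>q\<in>P. g q * msum P k (\<lambda>A. F (add_mset p (add_mset q A)) * ?\<Pi> t A)))
       = (\<Sum>q\<in>P. g q * (\<Sum>p\<in>P. (1 + t * g p) * msum P k (\<lambda>A. F (add_mset p (add_mset q A)) * ?\<Pi> t A)))"
      unfolding sum_distrib_left by (subst sum.swap) (simp add: mult_ac)
    also have "\<dots> = (\<Sum>q\<in>P. g q * msum P n (\<lambda>A. F (add_mset q A) * ?\<Pi> t A))"
      by (simp add: Suc msum_cmult[symmetric] mult_ac add_mset_commute)
    finally show ?thesis
      unfolding mult.left_commute[of _ "real n"] sum_distrib_left[symmetric] by (simp add: Suc)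
  qed simp
  ultimately show ?case unfolding f
    by (elim DERIV_cong) (simp add: sum.distrib algebra_simps)
qed

text \<open>The tangent inequality for a log-concave generating polynomial: \<open>mean\<close>
  makes the slope vanish at the untilted end of the segment from 1 to \<open>f\<close>, and
  log-concavity along the segment keeps the slope nonpositive.\<close>

lemma msum_tilt_le:
  assumes fin: "finite P" and ne: "P \<noteq> {}" and nd: "neg_dep P w" and f: "\<And>x. 0 < f x"
    and mean: "(\<Sum>p\<in>P. f p * msum P n (\<lambda>A. w (add_mset p A))) = msum P (Suc n) w"
  shows "msum P (Suc n) (\<lambda>A. w A * (\<Prod>x\<in>#A. f x)) \<le> msum P (Suc n) w"
proof -
  define g where "g x = f x - 1" for x
  let ?\<Pi> = "\<lambda>s A. \<Prod>x\<in>#A. 1 + s * g x"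
  define \<phi> where "\<phi> t = msum P (Suc n) (\<lambda>A. w A * ?\<Pi> t A)" for t
  define \<phi>1 where "\<phi>1 t = real (Suc n) * (\<Sum>q\<in>P. g q * msum P n (\<lambda>A. w (add_mset q A) * ?\<Pi> t A))" for t
  define \<phi>2 where "\<phi>2 t = real (Suc n) * (\<Sum>q\<in>P. g q * (real n * (\<Sum>r\<in>P. g r * msum P (n - 1) (\<lambda>A. w (add_mset q (add_mset r A)) * ?\<Pi> t A))))" for t
  have D1: "(\<phi> has_real_derivative \<phi>1 t) (at t)" for t
    unfolding \<phi>_def \<phi>1_def using msum_tilt_deriv[where n = "Suc n" and F = w and g = g] by simp
  have D2: "(\<phi>1 has_real_derivative \<phi>2 t) (at t)" for t
    unfolding \<phi>1_def \<phi>2_def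
    by (intro DERIV_cmult DERIV_sum msum_tilt_deriv[where F = "\<lambda>A. w (add_mset p A)" for p])
  have pos1: "0 < 1 + t * g x" if "0 \<le> t" "t \<le> 1" for t x
  proof (cases "t = 1")
    case True then show ?thesis using f by (simp add: g_def)
  next
    case False
    then have "0 \<le> t * f x" "0 < 1 - t" using that f[of x] by auto
    then show ?thesis by (simp add: g_def algebra_simps)
  qed
  have nd_t: "neg_dep P (\<lambda>A. w A * ?\<Pi> t A)" if "0 \<le> t" "t \<le> 1" for t
    by (rule neg_dep_tilt[OF nd pos1[OF that]])
  have phi_pos: "0 < \<phi> t" if "0 \<le> t" "t \<le> 1" for t
    unfolding \<phi>_def by (rule msum_pos[OF fin ne neg_dep_pos[OF nd_t[OF that]]])
  have logconc: "\<phi> t * \<phi>2 t \<le> (\<phi>1 t)\<^sup>2" if t: "0 \<le> t" "t \<le> 1" for t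
  proof (cases n)
    case 0
    then show ?thesis by (simp add: \<phi>2_def)
  next
    case (Suc m)
    define X where "X = (\<Sum>q\<in>P. \<Sum>r\<in>P. g q * g r * msum P m (\<lambda>A. w (add_mset q (add_mset r A)) * ?\<Pi> t A))"
    define Y where "Y = (\<Sum>q\<in>P. g q * msum P n (\<lambda>A. w (add_mset q A) * ?\<Pi> t A))"
    \<comment> \<open>A differentiated player carries \<open>g\<close> in place of its tilt factor
      \<open>1 + t * g\<close>; dividing by that factor turns the tilted marginals of
      \<open>neg_dep_msum\<close> into derivatives of \<open>\<phi>\<close>.\<close>
    define u where "u p = g p / (1 + t * g p)" for p
    have u: "u p * (1 + t * g p) = g p" for p using pos1[OF t, of p] by (simp add: u_def)
    have 1: "msum P m (\<lambda>A. w (add_mset p (add_mset q A)) * ?\<Pi> t (add_mset p (add_mset q A)))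
        = (1 + t * g p) * (1 + t * g q) * msum P m (\<lambda>A. w (add_mset p (add_mset q A)) * ?\<Pi> t A)" for p q
      by (simp add: msum_cmult[symmetric] mult_ac)
    have 2: "msum P n (\<lambda>A. w (add_mset p A) * ?\<Pi> t (add_mset p A))
        = (1 + t * g p) * msum P n (\<lambda>A. w (add_mset p A) * ?\<Pi> t A)" for p
      by (simp add: msum_cmult[symmetric] mult_ac)
    have 3: "u p * u q * ((1 + t * g p) * (1 + t * g q) * z) = g p * g q * z" for p q z
      using u[of p] u[of q] by (metis (no_types, opaque_lifting) mult.assoc mult.left_commute)
    have 4: "u p * ((1 + t * g p) * z) = g p * z" for p z
      using u[of p] by (metis mult.assoc)
    have "\<phi> t * X \<le> Y\<^sup>2"
      using neg_dep_msum[OF fin ne nd_t[OF t], of m u]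
      unfolding Suc[symmetric] 1 2 3 4 \<phi>_def X_def Y_def by simp
    then have "real (Suc n) * real n * (\<phi> t * X) \<le> real (Suc n) * real n * Y\<^sup>2"
      by (intro mult_left_mono) auto
    also have "\<dots> \<le> real (Suc n) * real (Suc n) * Y\<^sup>2"
      by (intro mult_right_mono mult_left_mono) auto
    also have "\<dots> = (\<phi>1 t)\<^sup>2" unfolding \<phi>1_def Y_def by (simp add: power_mult_distrib power2_eq_square)
    finally have "real (Suc n) * real n * (\<phi> t * X) \<le> (\<phi>1 t)\<^sup>2" .
    moreover have "\<phi>2 t = real (Suc n) * real n * X"
      unfolding \<phi>2_def X_def Suc by (simp add: sum_distrib_left mult_ac)
    ultimately show ?thesis by (simp only: mult_ac)
  qed
  define \<psi> where "\<psi> t = \<phi>1 t / \<phi> t" for t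
  have psi: "\<psi> t \<le> \<psi> 0" if t: "0 \<le> t" "t \<le> 1" for t
  proof (rule DERIV_nonpos_imp_nonincreasing[OF t(1)])
    fix s assume "0 \<le> s" "s \<le> t"
    then have s: "0 \<le> s" "s \<le> 1" using t by auto
    have "(\<psi> has_real_derivative (\<phi>2 s * \<phi> s - \<phi>1 s * \<phi>1 s) / (\<phi> s * \<phi> s)) (at s)"
      unfolding \<psi>_def using phi_pos[OF s] by (intro DERIV_divide D1 D2) auto
    moreover have "(\<phi>2 s * \<phi> s - \<phi>1 s * \<phi>1 s) / (\<phi> s * \<phi> s) \<le> 0"
      using logconc[OF s] by (intro divide_nonpos_nonneg) (auto simp: power2_eq_square mult_ac)
    ultimately show "\<exists>y. (\<psi> has_real_derivative y) (at s) \<and> y \<le> 0" by blast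
  qed
  have "\<phi>1 0 = 0"
    unfolding \<phi>1_def g_def using mean by (simp add: algebra_simps sum_subtractf)
  then have "\<phi>1 t \<le> 0" if "0 \<le> t" "t \<le> 1" for t
    using psi[OF that] phi_pos[OF that] by (simp add: \<psi>_def divide_le_0_iff)
  then have "\<phi> 1 \<le> \<phi> 0"
    by (intro DERIV_nonpos_imp_nonincreasing[of 0 1]) (use D1 in auto)
  then show ?thesis by (simp add: \<phi>_def g_def del: msum.simps)
qed

subsection \<open>Entropy contraction\<close>

lemma msum_pull_sum_mset:
  "msum P (Suc n) (\<lambda>A. H A * (\<Sum>x\<in>#A. g x)) = real (Suc n) * (\<Sum>p\<in>P. g p * msum P n (\<lambda>A. H (add_mset p A)))"
proof -
  have "msum P (Suc n) (\<lambda>A. H A * (\<Sum>x\<in>#A. g x))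
      = msum P (Suc n) (\<lambda>A. \<Sum>x\<in>#A. g x * H (add_mset x (A - {#x#})))"
  proof (rule msum_cong)
    fix A
    have "(\<Sum>x\<in>#A. g x * H (add_mset x (A - {#x#}))) = (\<Sum>x\<in>#A. H A * g x)"
      by (intro arg_cong[of _ _ sum_mset] image_mset_cong) simp
    then show "H A * (\<Sum>x\<in>#A. g x) = (\<Sum>x\<in>#A. g x * H (add_mset x (A - {#x#})))"
      by (simp add: sum_mset_distrib_left)
  qed
  also have "\<dots> = real (Suc n) * (\<Sum>p\<in>P. msum P n (\<lambda>C. g p * H (add_mset p C)))"
    by (rule msum_pull)
  finally show ?thesis unfolding msum_cmult .
qed

text \<open>The tangent line of the convex function \<open>y * ln y\<close> at \<open>z\<close>. It
  serves as the duality inequality for entropy and as the source of Jensen's inequality.\<close>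

lemma gibbs_variational:
  fixes y z :: real assumes "0 < y" "0 < z"
  shows "y * ln z + y - z \<le> y * ln y"
proof -
  have "ln (z / y) \<le> z / y - 1" using assms by (intro ln_le_minus_one) auto
  then have "y * (ln z - ln y) \<le> y * (z / y - 1)"
    using assms by (intro mult_left_mono) (auto simp: ln_div)
  then show ?thesis using assms by (simp add: algebra_simps)
qed

lemma ln_prod_mset:
  assumes "\<And>x. 0 < f x" shows "ln (\<Prod>x\<in>#A. f x) = (\<Sum>x\<in>#A. ln (f x :: real))" "0 < (\<Prod>x\<in>#A. f x)"
proof -
  have pos: "0 < (\<Prod>x\<in>#A. f x)" for A by (induction A) (use assms in auto)
  then show "0 < (\<Prod>x\<in>#A. f x)" .
  show "ln (\<Prod>x\<in>#A. f x) = (\<Sum>x\<in>#A. ln (f x))"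
    by (induction A) (use assms pos in \<open>auto simp: ln_mult less_imp_neq[symmetric]\<close>)
qed

text \<open>Entropic independence. The density \<open>h\<close> is tested against the product
  \<open>c * (\<Prod>x\<in>#A. f x)\<close> of normalised one-player density ratios: the logarithm
  of the product yields \<open>Suc n\<close> times the marginal entropy, and the remaining term is
  the partition function tilted by \<open>f\<close>, at most \<open>Z\<close> since \<open>f\<close>
  meets the normalisation of \<open>msum_tilt_le\<close>.\<close>

lemma marginal_entropy_le:
  fixes P :: "'p set" and w h :: "'p multiset \<Rightarrow> real" and n :: nat
  assumes fin: "finite P" and ne: "P \<noteq> {}" and nd: "neg_dep P w" and h: "\<And>A. 0 < h A"
  defines "e \<equiv> \<lambda>p. msum P n (\<lambda>A. w (add_mset p A) * h (add_mset p A))"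
    and "z \<equiv> \<lambda>p. msum P n (\<lambda>A. w (add_mset p A))"
    and "E \<equiv> msum P (Suc n) (\<lambda>A. w A * h A)" and "Z \<equiv> msum P (Suc n) w"
  shows "real (Suc n) * ((\<Sum>p\<in>P. e p * ln (e p / z p)) - E * ln (E / Z))
    \<le> msum P (Suc n) (\<lambda>A. w A * (h A * ln (h A))) - E * ln (E / Z)"
proof -
  have w: "0 < w A" for A using nd by (rule neg_dep_pos)
  have ep: "0 < e p" for p unfolding e_def by (rule msum_pos[OF fin ne]) (simp add: w h)
  have zp: "0 < z p" for p unfolding z_def by (rule msum_pos[OF fin ne]) (simp add: w h)
  have Ep: "0 < E" unfolding E_def by (rule msum_pos[OF fin ne]) (simp add: w h)
  have Zp: "0 < Z" unfolding Z_def by (rule msum_pos[OF fin ne]) (simp add: w h)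
  have Esum: "E = (\<Sum>p\<in>P. e p)" unfolding E_def e_def by simp
  define f where "f p = (e p / z p) / (E / Z)" for p
  have f: "0 < f p" for p unfolding f_def using ep zp Ep Zp by simp
  have fz: "f p * z p = Z / E * e p" for p unfolding f_def using zp[of p] Ep by (simp add: field_simps)
  have "(\<Sum>p\<in>P. f p * z p) = Z"
    unfolding fz sum_distrib_left[symmetric] Esum[symmetric] using Ep by simp
  then have tilt: "msum P (Suc n) (\<lambda>A. w A * (\<Prod>x\<in>#A. f x)) \<le> Z"
    unfolding Z_def z_def by (rule msum_tilt_le[OF fin ne nd f])
  define c where "c = E / Z"
  have c: "0 < c" unfolding c_def using Ep Zp by simp
  have pt: "(w A * h A) * ln c + (w A * h A) * (\<Sum>x\<in>#A. ln (f x)) + w A * h A - c * (w A * (\<Prod>x\<in>#A. f x)) \<le> w A * (h A * ln (h A))" for A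
  proof -
    have "h A * ln (c * (\<Prod>x\<in>#A. f x)) + h A - c * (\<Prod>x\<in>#A. f x) \<le> h A * ln (h A)"
      by (intro gibbs_variational h mult_pos_pos c ln_prod_mset f)
    also have "ln (c * (\<Prod>x\<in>#A. f x)) = ln c + (\<Sum>x\<in>#A. ln (f x))"
      using ln_prod_mset[where f = f and A = A, OF f] c by (simp add: ln_mult_pos)
    finally have "w A * (h A * (ln c + (\<Sum>x\<in>#A. ln (f x))) + h A - c * (\<Prod>x\<in>#A. f x)) \<le> w A * (h A * ln (h A))"
      using w[of A] by (intro mult_left_mono) auto
    then show ?thesis by (simp add: algebra_simps)
  qed
  have ln_f: "ln (f p) = ln (e p / z p) - ln c" for p
    unfolding f_def c_def using ep[of p] zp[of p] Ep Zp by (intro ln_divide_pos) auto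
  have "E * ln c + real (Suc n) * (\<Sum>p\<in>P. ln (f p) * e p) + E - c * msum P (Suc n) (\<lambda>A. w A * (\<Prod>x\<in>#A. f x))
    = msum P (Suc n) (\<lambda>A. (w A * h A) * ln c + (w A * h A) * (\<Sum>x\<in>#A. ln (f x)) + w A * h A - c * (w A * (\<Prod>x\<in>#A. f x)))"
    unfolding msum_diff msum_add msum_cmult msum_cmult_right msum_pull_sum_mset e_def E_def ..
  also have "\<dots> \<le> msum P (Suc n) (\<lambda>A. w A * (h A * ln (h A)))"
    by (rule msum_mono) (rule pt)
  finally have 1: "E * ln c + real (Suc n) * (\<Sum>p\<in>P. ln (f p) * e p) + E - c * msum P (Suc n) (\<lambda>A. w A * (\<Prod>x\<in>#A. f x))
    \<le> msum P (Suc n) (\<lambda>A. w A * (h A * ln (h A)))" .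
  have "c * msum P (Suc n) (\<lambda>A. w A * (\<Prod>x\<in>#A. f x)) \<le> c * Z"
    using c tilt by (intro mult_left_mono) auto
  moreover have "c * Z = E" unfolding c_def using Zp by simp
  moreover have S: "(\<Sum>p\<in>P. ln (f p) * e p) = (\<Sum>p\<in>P. e p * ln (e p / z p)) - E * ln c"
    unfolding ln_f by (simp add: right_diff_distrib left_diff_distrib sum_subtractf Esum sum_distrib_right mult.commute[of _ "e _"])
  ultimately show ?thesis using 1 unfolding c_def[symmetric] S[symmetric] by argo
qed

section \<open>The resampling operator and Glauber dynamics\<close>

definition tot :: "'p set \<Rightarrow> ('p multiset \<Rightarrow> real) \<Rightarrow> 'p multiset \<Rightarrow> real" where
  "tot P w C = (\<Sum>p\<in>P. w (add_mset p C))"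

text \<open>The conditional expectation of \<open>h\<close> when all players but one form
  \<open>C\<close> and the last one is drawn from its conditional Gibbs law.\<close>

definition up :: "'p set \<Rightarrow> ('p multiset \<Rightarrow> real) \<Rightarrow> ('p multiset \<Rightarrow> real) \<Rightarrow> 'p multiset \<Rightarrow> real" where
  "up P w h C = (\<Sum>p\<in>P. w (add_mset p C) * h (add_mset p C)) / tot P w C"

text \<open>The value on the empty multiset is chosen so that constants are fixed and positivity is preserved everywhere.\<close>

definition glauber :: "'p set \<Rightarrow> ('p multiset \<Rightarrow> real) \<Rightarrow> ('p multiset \<Rightarrow> real) \<Rightarrow> 'p multiset \<Rightarrow> real" where
  "glauber P w h A = (if A = {#} then h A else (\<Sum>x\<in>#A. up P w h (A - {#x#})) / real (size A))"

lemma tot_pos: "finite P \<Longrightarrow> P \<noteq> {} \<Longrightarrow> (\<And>A. 0 < w A) \<Longrightarrow> 0 < tot P w C"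
  unfolding tot_def by (intro sum_pos) auto

text \<open>For normalised \<open>h\<close>, forgetting one of \<open>n + 1\<close> players keeps at
  most the share \<open>n / (n + 1)\<close> of the relative entropy. Chain rule: pin
  \<open>p\<close>, use the induction hypothesis in the conditional system and sum over
  \<open>p\<close>; the leftover terms form the one-player marginal entropy, which
  \<open>marginal_entropy_le\<close> bounds by its share of the total. The term with
  \<open>E / Z\<close> is present because pinned systems are not normalised.\<close>

lemma up_entropy_le:
  assumes fin: "finite P" and ne: "P \<noteq> {}"
  shows "neg_dep P w \<Longrightarrow> (\<And>A. 0 < h A) \<Longrightarrow>
    real (Suc n) * msum P n (\<lambda>C. tot P w C * (up P w h C * ln (up P w h C)))
     \<le> real n * msum P (Suc n) (\<lambda>A. w A * (h A * ln (h A)))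
       + msum P (Suc n) (\<lambda>A. w A * h A) * ln (msum P (Suc n) (\<lambda>A. w A * h A) / msum P (Suc n) w)"
proof (induction n arbitrary: w h)
  case 0
  have "0 < tot P w {#}" by (rule tot_pos[OF fin ne neg_dep_pos[OF 0(1)]])
  then show ?case by (simp add: up_def tot_def)
next
  case (Suc n)
  define e where "e p = msum P (Suc n) (\<lambda>A. w (add_mset p A) * h (add_mset p A))" for p
  define z where "z p = msum P (Suc n) (\<lambda>A. w (add_mset p A))" for p
  define a where "a p = msum P (Suc n) (\<lambda>A. w (add_mset p A) * (h (add_mset p A) * ln (h (add_mset p A))))" for p
  define E where "E = msum P (Suc (Suc n)) (\<lambda>A. w A * h A)"
  define Z where "Z = msum P (Suc (Suc n)) w"
  define b where "b p = msum P n (\<lambda>C. tot P w (add_mset p C) * (up P w h (add_mset p C) * ln (up P w h (add_mset p C))))" for p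
  have t: "tot P (\<lambda>A. w (add_mset p A)) C = tot P w (add_mset p C)" for p C
    unfolding tot_def by (simp add: add_mset_commute)
  have u: "up P (\<lambda>A. w (add_mset p A)) (\<lambda>A. h (add_mset p A)) C = up P w h (add_mset p C)" for p C
    unfolding up_def t by (simp add: add_mset_commute)
  have 1: "real (Suc n) * b p \<le> real n * a p + e p * ln (e p / z p)" for p
    using Suc.IH[OF neg_dep_add_mset[OF Suc.prems(1), of p], of "\<lambda>A. h (add_mset p A)", OF Suc.prems(2)]
    unfolding t u b_def a_def e_def z_def by (simp only:)
  define B where "B = (\<Sum>p\<in>P. b p)"
  define A where "A = (\<Sum>p\<in>P. a p)"
  define S where "S = (\<Sum>p\<in>P. e p * ln (e p / z p))"
  have "(\<Sum>p\<in>P. real (Suc n) * b p) \<le> (\<Sum>p\<in>P. real n * a p + e p * ln (e p / z p))"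
    by (intro sum_mono 1)
  then have 2: "real (Suc n) * B \<le> real n * A + S"
    by (simp only: B_def A_def S_def sum_distrib_left sum.distrib)
  have A: "A = msum P (Suc (Suc n)) (\<lambda>A. w A * (h A * ln (h A)))"
    unfolding A_def a_def by simp
  have 3: "real (Suc (Suc n)) * (S - E * ln (E / Z)) \<le> A - E * ln (E / Z)"
    unfolding A S_def e_def z_def E_def Z_def
    by (rule marginal_entropy_le[OF fin ne Suc.prems])
  define N where "N = real (Suc n)"
  define F where "F = E * ln (E / Z)"
  have N: "0 < N" "real n = N - 1" "real (Suc (Suc n)) = N + 1" by (auto simp: N_def)
  have "(N + 1) * (N * B) \<le> (N + 1) * ((N - 1) * A + S)"
    using 2 N unfolding N_def[symmetric] by (intro mult_left_mono) auto
  also have "\<dots> = (N * N - 1) * A + ((N + 1) * (S - F)) + (N + 1) * F"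
    by (simp add: algebra_simps)
  also have "\<dots> \<le> (N * N - 1) * A + (A - F) + (N + 1) * F"
    using 3 unfolding N(3) F_def[symmetric] by simp
  also have "\<dots> = N * (N * A + F)" by (simp add: algebra_simps)
  finally have "N * ((N + 1) * B) \<le> N * (N * A + F)" by (simp add: algebra_simps)
  then have "(N + 1) * B \<le> N * A + F" using N(1) by simp
  moreover have "B = msum P (Suc n) (\<lambda>C. tot P w C * (up P w h C * ln (up P w h C)))"
    unfolding B_def b_def by simp
  ultimately show ?case unfolding A F_def E_def Z_def N(3) unfolding N_def by (simp only:)
qed

lemma msum_down:
  "msum P (Suc n) (\<lambda>A. F A * (\<Sum>x\<in>#A. g (A - {#x#})))
    = real (Suc n) * msum P n (\<lambda>C. (\<Sum>p\<in>P. F (add_mset p C)) * g C)"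
proof -
  have "msum P (Suc n) (\<lambda>A. F A * (\<Sum>x\<in>#A. g (A - {#x#})))
      = msum P (Suc n) (\<lambda>A. \<Sum>x\<in>#A. F (add_mset x (A - {#x#})) * g (A - {#x#}))"
  proof (rule msum_cong)
    fix A
    have "(\<Sum>x\<in>#A. F (add_mset x (A - {#x#})) * g (A - {#x#})) = (\<Sum>x\<in>#A. F A * g (A - {#x#}))"
      by (intro arg_cong[of _ _ sum_mset] image_mset_cong) simp
    then show "F A * (\<Sum>x\<in>#A. g (A - {#x#})) = (\<Sum>x\<in>#A. F (add_mset x (A - {#x#})) * g (A - {#x#}))"
      by (simp add: sum_mset_distrib_left)
  qed
  also have "\<dots> = real (Suc n) * (\<Sum>p\<in>P. msum P n (\<lambda>C. F (add_mset p C) * g C))"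
    by (rule msum_pull)
  finally show ?thesis by (simp add: msum_sum[symmetric] sum_distrib_right)
qed

lemma up_const:
  assumes "finite P" "P \<noteq> {}" "\<And>A. 0 < w A" shows "up P w (\<lambda>_. c) C = c"
  using tot_pos[of P w C] assms by (simp add: up_def sum_distrib_right[symmetric] tot_def[symmetric])

lemma up_pos:
  assumes "finite P" "P \<noteq> {}" "\<And>A. 0 < w A" "\<And>A. 0 < h A" shows "0 < up P w h C"
  unfolding up_def using assms by (intro divide_pos_pos tot_pos sum_pos mult_pos_pos) auto

text \<open>A Glauber step removes a random player and then resamples, and these halves are adjoint
  to each other. The right-hand side is symmetric in \<open>k\<close> and \<open>h\<close>, which is
  reversibility.\<close>

lemma glauber_sym:
  assumes fin: "finite P" and ne: "P \<noteq> {}" and w: "\<And>A. 0 < w A"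
  shows "msum P (Suc n) (\<lambda>A. w A * (k A * glauber P w h A))
    = msum P n (\<lambda>C. tot P w C * (up P w k C * up P w h C))"
proof -
  have "msum P (Suc n) (\<lambda>A. w A * (k A * glauber P w h A))
      = msum P (Suc n) (\<lambda>A. (w A * k A / real (Suc n)) * (\<Sum>x\<in>#A. up P w h (A - {#x#})))"
    by (rule msum_cong) (auto simp: glauber_def)
  also have "\<dots> = real (Suc n) * msum P n (\<lambda>C. (\<Sum>p\<in>P. w (add_mset p C) * k (add_mset p C) / real (Suc n)) * up P w h C)"
    by (rule msum_down)
  also have "\<dots> = msum P n (\<lambda>C. tot P w C * (up P w k C * up P w h C))"
    unfolding msum_cmult[symmetric]
  proof (rule msum_cong)
    fix C
    have "0 < tot P w C" using tot_pos[of P w C] fin ne w by blast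
    then show "real (Suc n) * ((\<Sum>p\<in>P. w (add_mset p C) * k (add_mset p C) / real (Suc n)) * up P w h C)
       = tot P w C * (up P w k C * up P w h C)"
      by (simp add: up_def sum_divide_distrib[symmetric])
  qed
  finally show ?thesis .
qed

lemma glauber_adjoint:
  assumes "finite P" "P \<noteq> {}" "\<And>A. 0 < w A"
  shows "msum P (Suc n) (\<lambda>A. w A * (k A * glauber P w h A)) = msum P (Suc n) (\<lambda>A. w A * (glauber P w k A * h A))"
  using glauber_sym[of P w n k h] glauber_sym[of P w n h k] assms
  by (simp add: mult_ac del: msum.simps)

lemma glauber_const:
  assumes "finite P" "P \<noteq> {}" "\<And>A. 0 < w A" shows "glauber P w (\<lambda>_. c) A = c"
  using assms up_const[of P w c] by (simp add: glauber_def)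

lemma glauber_linear:
  "glauber P w (\<lambda>A. a * h A + b * k A) A = a * glauber P w h A + b * glauber P w k A"
proof -
  have "up P w (\<lambda>A. a * h A + b * k A) C = a * up P w h C + b * up P w k C" for C
    unfolding up_def
    by (simp add: add_divide_distrib[symmetric] sum.distrib sum_distrib_left distrib_left mult.left_commute)
  then show ?thesis unfolding glauber_def
    by (simp add: sum_mset.distrib sum_mset_distrib_left[symmetric] add_divide_distrib)
qed

lemma glauber_nonneg:
  assumes "\<And>A. 0 < w A" "\<And>A. 0 \<le> h A" shows "0 \<le> glauber P w h A"
proof -
  have u: "0 \<le> up P w h C" for C
    unfolding up_def tot_def using assms by (intro divide_nonneg_nonneg sum_nonneg mult_nonneg_nonneg) (auto intro: less_imp_le)
  have "0 \<le> (\<Sum>x\<in>#M. up P w h (A - {#x#}))" for M by (induction M) (auto simp: u)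
  then show ?thesis unfolding glauber_def using assms(2) by simp
qed

lemma glauber_pos:
  assumes "finite P" "P \<noteq> {}" "\<And>A. 0 < w A" "\<And>A. 0 < h A"
  shows "0 < glauber P w h A"
proof -
  have u: "0 < up P w h C" for C using up_pos[of P w h] assms by blast
  have "0 < (\<Sum>x\<in>#M. up P w h (A - {#x#}))" if "M \<noteq> {#}" for M
    using that
  proof (induction M)
    case (add y M)
    then show ?case using u by (cases "M = {#}") (auto intro: add_pos_pos)
  qed simp
  then show ?thesis unfolding glauber_def using assms(4) by (simp add: nonempty_has_size)
qed

text \<open>All contraction comes from the forgetting half of the step, by
  \<open>up_entropy_le\<close>; the other half averages over the removed player and is covered by
  convexity.\<close>

lemma glauber_entropy_le:
  assumes fin: "finite P" and ne: "P \<noteq> {}" and nd: "neg_dep P w" and h: "\<And>A. 0 < h A"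
    and mean: "msum P (Suc n) (\<lambda>A. w A * h A) = msum P (Suc n) w"
  shows "msum P (Suc n) (\<lambda>A. w A * (glauber P w h A * ln (glauber P w h A)))
    \<le> real n / real (Suc n) * msum P (Suc n) (\<lambda>A. w A * (h A * ln (h A)))"
proof -
  have w: "0 < w A" for A using nd by (rule neg_dep_pos)
  let ?u = "up P w h"
  have u: "0 < ?u C" for C using up_pos[of P w h] fin ne w h by blast
  have "msum P (Suc n) (\<lambda>A. w A * (glauber P w h A * ln (glauber P w h A)))
    \<le> msum P (Suc n) (\<lambda>A. (w A / real (Suc n)) * (\<Sum>x\<in>#A. ?u (A - {#x#}) * ln (?u (A - {#x#}))))"
  proof (rule msum_mono)
    fix A :: "'a multiset" assume A: "size A = Suc n"
    define z where "z = glauber P w h A"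
    have z: "0 < z" unfolding z_def using glauber_pos[of P w h A] fin ne w h A by auto
    have S: "(\<Sum>x\<in>#A. ?u (A - {#x#})) = real (Suc n) * z" using A by (auto simp: z_def glauber_def)
    \<comment> \<open>Jensen's inequality for \<open>y * ln y\<close>, as a sum of tangent-line inequalities at \<open>z\<close>\<close>
    have "(\<Sum>x\<in>#M. ?u (A - {#x#}) * ln z + ?u (A - {#x#}) - z) \<le> (\<Sum>x\<in>#M. ?u (A - {#x#}) * ln (?u (A - {#x#})))" for M
      by (intro sum_mset_mono gibbs_variational u z)
    from this[of A] have "(\<Sum>x\<in>#A. ?u (A - {#x#})) * ln z + (\<Sum>x\<in>#A. ?u (A - {#x#})) - real (size A) * z
       \<le> (\<Sum>x\<in>#A. ?u (A - {#x#}) * ln (?u (A - {#x#})))"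
    proof -
      have "(\<Sum>x\<in>#M. ?u (A - {#x#}) * ln z + ?u (A - {#x#}) - z) =
        (\<Sum>x\<in>#M. ?u (A - {#x#})) * ln z + (\<Sum>x\<in>#M. ?u (A - {#x#})) - real (size M) * z" for M
        by (induction M) (auto simp: algebra_simps)
      then show ?thesis using \<open>(\<Sum>x\<in>#A. ?u (A - {#x#}) * ln z + ?u (A - {#x#}) - z) \<le> _\<close> by simp
    qed
    then have "real (Suc n) * (z * ln z) \<le> (\<Sum>x\<in>#A. ?u (A - {#x#}) * ln (?u (A - {#x#})))"
      unfolding S A by (simp add: algebra_simps)
    then have "z * ln z \<le> (\<Sum>x\<in>#A. ?u (A - {#x#}) * ln (?u (A - {#x#}))) / real (Suc n)"
      by (simp add: pos_le_divide_eq mult.commute)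
    then have "w A * (z * ln z) \<le> w A * ((\<Sum>x\<in>#A. ?u (A - {#x#}) * ln (?u (A - {#x#}))) / real (Suc n))"
      using w[of A] by (intro mult_left_mono) auto
    then show "w A * (glauber P w h A * ln (glauber P w h A))
      \<le> (w A / real (Suc n)) * (\<Sum>x\<in>#A. ?u (A - {#x#}) * ln (?u (A - {#x#})))"
      by (simp add: z_def)
  qed
  also have "\<dots> = real (Suc n) * msum P n (\<lambda>C. (\<Sum>p\<in>P. w (add_mset p C) / real (Suc n)) * (?u C * ln (?u C)))"
    by (rule msum_down)
  also have "\<dots> = msum P n (\<lambda>C. tot P w C * (?u C * ln (?u C)))"
    unfolding msum_cmult[symmetric] by (rule msum_cong) (simp add: tot_def sum_divide_distrib[symmetric])
  finally have 1: "msum P (Suc n) (\<lambda>A. w A * (glauber P w h A * ln (glauber P w h A)))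
    \<le> msum P n (\<lambda>C. tot P w C * (?u C * ln (?u C)))" .
  have Z: "msum P (Suc n) w \<noteq> 0" using msum_pos[OF fin ne, of "Suc n" w] w by (simp del: msum.simps)
  have "real (Suc n) * msum P n (\<lambda>C. tot P w C * (?u C * ln (?u C)))
    \<le> real n * msum P (Suc n) (\<lambda>A. w A * (h A * ln (h A)))"
    using up_entropy_le[where h = h and n = n, OF fin ne nd h] Z unfolding mean by (simp del: msum.simps)
  then have "msum P n (\<lambda>C. tot P w C * (?u C * ln (?u C))) \<le> real n / real (Suc n) * msum P (Suc n) (\<lambda>A. w A * (h A * ln (h A)))"
    by (simp add: pos_le_divide_eq mult.commute del: msum.simps)
  with 1 show ?thesis by linarith
qed


section \<open>From relative entropy to total variation\<close>

text \<open>A pointwise Pinsker inequality through the Hellinger distance: with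
  \<open>r = sqrt y\<close> one has \<open>(r - 1)\<^sup>2 \<le> y * ln y - y + 1\<close> and
  \<open>y - 1 = (r - 1) * (r + 1)\<close>. The free weight \<open>s\<close> in the
  arithmetic-geometric mean replaces a Cauchy-Schwarz inequality after summation.\<close>

lemma abs_diff_one_le:
  fixes y s :: real assumes y: "0 < y" and s: "0 < s"
  shows "\<bar>y - 1\<bar> \<le> (s * (y * ln y - y + 1) + (2 * y + 2) / s) / 2"
proof -
  define r where "r = sqrt y"
  have r: "0 < r" "y = r * r" using y by (auto simp: r_def)
  have "ln (1 / r) \<le> 1 / r - 1" using r by (intro ln_le_minus_one) auto
  then have "1 - 1 / r \<le> ln r" using r by (simp add: ln_divide_pos)
  then have "2 * y * (1 - 1 / r) \<le> 2 * y * ln r" using y by (intro mult_left_mono) auto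
  moreover have "2 * y * (1 - 1 / r) = 2 * y - 2 * r" using r by (simp add: field_simps)
  moreover have "y * ln y = 2 * y * ln r" using r by (simp add: ln_mult_pos)
  moreover have "(r - 1)\<^sup>2 = y - 2 * r + 1" using r(2) by (simp add: power2_eq_square algebra_simps)
  ultimately have "(r - 1)\<^sup>2 \<le> y * ln y - y + 1" by argo
  then have 1: "s * (r - 1)\<^sup>2 \<le> s * (y * ln y - y + 1)" using s by (intro mult_left_mono) auto
  have "(r + 1)\<^sup>2 \<le> 2 * y + 2" using sum_squares_bound[of r 1] r(2) by (simp add: power2_eq_square algebra_simps)
  then have 2: "(r + 1)\<^sup>2 / s \<le> (2 * y + 2) / s" using s by (intro divide_right_mono) auto
  have "\<bar>y - 1\<bar> = \<bar>r - 1\<bar> * (r + 1)"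
  proof -
    have "y - 1 = (r - 1) * (r + 1)" using r(2) by (simp add: algebra_simps)
    then show ?thesis using r(1) by (simp add: abs_mult)
  qed
  moreover have "2 * (\<bar>r - 1\<bar> * (r + 1)) \<le> s * (r - 1)\<^sup>2 + (r + 1)\<^sup>2 / s"
  proof -
    have "0 \<le> (s * \<bar>r - 1\<bar> - (r + 1))\<^sup>2 / s" using s by simp
    also have "\<dots> = s * (r - 1)\<^sup>2 + (r + 1)\<^sup>2 / s - 2 * (\<bar>r - 1\<bar> * (r + 1))"
      using s by (simp add: power2_diff power_mult_distrib power2_eq_square[of s] add_divide_distrib diff_divide_distrib)
    finally show ?thesis by simp
  qed
  ultimately show ?thesis using 1 2 by argo
qed

lemma msum_abs_diff_one_le:
  assumes w: "\<And>A. 0 < w A" and h: "\<And>A. 0 < h A" and \<delta>: "0 < \<delta>"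
    and mean: "msum P n (\<lambda>A. w A * h A) = msum P n w"
    and ent: "msum P n (\<lambda>A. w A * (h A * ln (h A))) \<le> \<delta>\<^sup>2 * msum P n w"
  shows "msum P n (\<lambda>A. w A * \<bar>h A - 1\<bar>) \<le> 2 * \<delta> * msum P n w"
proof -
  \<comment> \<open>This choice balances the two contributions
    \<open>(s / 2) * \<delta>\<^sup>2\<close> and \<open>2 / s\<close>, which are
    \<open>\<delta>\<close> each.\<close>
  define s where "s = 2 / \<delta>"
  have s: "0 < s" using \<delta> by (simp add: s_def)
  have "msum P n (\<lambda>A. w A * \<bar>h A - 1\<bar>)
    \<le> msum P n (\<lambda>A. (s / 2) * (w A * (h A * ln (h A))) - (s / 2) * (w A * h A) + (s / 2) * w A + (1 / s) * (w A * h A) + (1 / s) * w A)"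
  proof (rule msum_mono)
    fix A
    have "w A * \<bar>h A - 1\<bar> \<le> w A * ((s * (h A * ln (h A) - h A + 1) + (2 * h A + 2) / s) / 2)"
      using w[of A] by (intro mult_left_mono abs_diff_one_le h s) auto
    also have "\<dots> = (s / 2) * (w A * (h A * ln (h A))) - (s / 2) * (w A * h A) + (s / 2) * w A + (1 / s) * (w A * h A) + (1 / s) * w A"
      using s by (simp add: field_simps)
    finally show "w A * \<bar>h A - 1\<bar> \<le> (s / 2) * (w A * (h A * ln (h A))) - (s / 2) * (w A * h A) + (s / 2) * w A + (1 / s) * (w A * h A) + (1 / s) * w A" .
  qed
  also have "\<dots> = (s / 2) * msum P n (\<lambda>A. w A * (h A * ln (h A))) + (2 / s) * msum P n w"
    unfolding msum_add msum_diff msum_cmult mean by (simp add: algebra_simps)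
  also have "\<dots> \<le> (s / 2) * (\<delta>\<^sup>2 * msum P n w) + (2 / s) * msum P n w"
    using ent s by (intro add_mono mult_left_mono) auto
  also have "\<dots> = 2 * \<delta> * msum P n w"
    using \<delta> by (simp add: s_def power2_eq_square field_simps)
  finally show ?thesis .
qed

lemma glauber_mean:
  assumes "finite P" "P \<noteq> {}" "\<And>A. 0 < w A"
  shows "msum P (Suc n) (\<lambda>A. w A * glauber P w h A) = msum P (Suc n) (\<lambda>A. w A * h A)"
  using glauber_adjoint[of P w n "\<lambda>_. 1" h] glauber_const[of P w 1] assms by (simp del: msum.simps)

text \<open>A normalised density bounded by \<open>B\<close> has entropy at most \<open>ln B\<close>
  times the total weight. Normalisation survives each step, so the contraction can be
  iterated.\<close>

lemma glauber_iterate_close: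
  assumes fin: "finite P" and ne: "P \<noteq> {}" and nd: "neg_dep P w" and h: "\<And>A. 0 < h A"
    and mean: "msum P (Suc n) (\<lambda>A. w A * h A) = msum P (Suc n) w"
    and B: "\<And>A. set_mset A \<subseteq> P \<Longrightarrow> size A = Suc n \<Longrightarrow> h A \<le> B"
    and \<delta>: "0 < \<delta>" "(real n / real (Suc n)) ^ t * ln B \<le> \<delta>\<^sup>2"
  shows "msum P (Suc n) (\<lambda>A. w A * \<bar>(glauber P w ^^ t) h A - 1\<bar>) \<le> 2 * \<delta> * msum P (Suc n) w"
proof -
  have w: "0 < w A" for A using nd by (rule neg_dep_pos)
  let ?Z = "msum P (Suc n) w"
  let ?r = "real n / real (Suc n)"
  have Z: "0 < ?Z" by (rule msum_pos[OF fin ne w])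
  have pos: "0 < (glauber P w ^^ s) h A" for s A
  proof (induction s arbitrary: A)
    case (Suc s)
    then show ?case using glauber_pos[OF fin ne w] by simp
  qed (simp add: h)
  have mean': "msum P (Suc n) (\<lambda>A. w A * (glauber P w ^^ s) h A) = ?Z" for s
    by (induction s) (simp_all add: mean glauber_mean[OF fin ne w] del: msum.simps)
  have ent: "msum P (Suc n) (\<lambda>A. w A * ((glauber P w ^^ s) h A * ln ((glauber P w ^^ s) h A)))
      \<le> ?r ^ s * (ln B * ?Z)" for s
  proof (induction s)
    case 0
    have "msum P (Suc n) (\<lambda>A. w A * (h A * ln (h A))) \<le> msum P (Suc n) (\<lambda>A. ln B * (w A * h A))"
    proof (rule msum_mono)
      fix A assume "set_mset A \<subseteq> P" "size A = Suc n"
      then have "ln (h A) \<le> ln B" using B[of A] h[of A] by (intro ln_mono) auto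
      then have "(w A * h A) * ln (h A) \<le> (w A * h A) * ln B" using w[of A] h[of A] by (intro mult_left_mono) auto
      then show "w A * (h A * ln (h A)) \<le> ln B * (w A * h A)" by (simp add: mult_ac)
    qed
    then show ?case unfolding msum_cmult mean by (simp del: msum.simps)
  next
    case (Suc s)
    have "msum P (Suc n) (\<lambda>A. w A * ((glauber P w ^^ Suc s) h A * ln ((glauber P w ^^ Suc s) h A)))
      \<le> ?r * msum P (Suc n) (\<lambda>A. w A * ((glauber P w ^^ s) h A * ln ((glauber P w ^^ s) h A)))"
      using glauber_entropy_le[where h = "(glauber P w ^^ s) h" and n = n, OF fin ne nd pos mean'] by simp
    also have "\<dots> \<le> ?r * (?r ^ s * (ln B * ?Z))"
      by (intro mult_left_mono Suc.IH) simp
    finally show ?case by (simp only: power_Suc mult.assoc)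
  qed
  show ?thesis
  proof (rule msum_abs_diff_one_le[OF w pos \<delta>(1) mean'])
    have "?r ^ t * (ln B * ?Z) \<le> \<delta>\<^sup>2 * ?Z"
      using mult_right_mono[OF \<delta>(2), of ?Z] Z by (simp add: mult.assoc)
    then show "msum P (Suc n) (\<lambda>A. w A * ((glauber P w ^^ t) h A * ln ((glauber P w ^^ t) h A))) \<le> \<delta>\<^sup>2 * ?Z"
      using ent[of t] by simp
  qed
qed

subsection \<open>Convex costs on extension parallel networks\<close>

definition mload :: "'e \<Rightarrow> 'e set multiset \<Rightarrow> nat" where
  "mload e X = size (filter_mset (\<lambda>p. e \<in> p) X)"

definition conv_cost :: "'e ep \<Rightarrow> ('e \<Rightarrow> nat \<Rightarrow> real) \<Rightarrow> 'e set multiset \<Rightarrow> real" where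
  "conv_cost G C X = (\<Sum>e\<in>arcs G. C e (mload e X))"

lemma mload_add_mset: "mload e (add_mset p X) = mload e X + (if e \<in> p then 1 else 0)"
  by (simp add: mload_def)

lemma mload_union: "mload e (X + Y) = mload e X + mload e Y"
  by (simp add: mload_def)

lemma finite_arcs [simp]: "finite (arcs G)"
  by (induction G) auto

lemma finite_paths: "finite (paths G)"
  by (induction G) auto

lemma paths_nonempty: "paths G \<noteq> {}"
  by (induction G) auto

lemma paths_subset_arcs: "p \<in> paths G \<Longrightarrow> p \<subseteq> arcs G \<and> p \<noteq> {}"
  by (induction G arbitrary: p) auto

definition meeting :: "'e ep \<Rightarrow> 'e set multiset \<Rightarrow> nat" where
  "meeting G X = size (filter_mset (\<lambda>p. p \<inter> arcs G \<noteq> {}) X)"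

text \<open>Induction over the network keeps one and the same multiset of paths and looks at it only
  through the arcs of the current subnetwork; a path may bypass that subnetwork altogether.\<close>

definition traverses :: "'e ep \<Rightarrow> 'e set \<Rightarrow> bool" where
  "traverses G p \<longleftrightarrow> p \<inter> arcs G = {} \<or> p \<inter> arcs G \<in> paths G"

lemma conv_cost_cong:
  "(\<And>e. e \<in> arcs G \<Longrightarrow> mload e X = mload e Y) \<Longrightarrow> conv_cost G C X = conv_cost G C Y"
  by (simp add: conv_cost_def)

lemma conv_cost_add_disjoint: "p \<inter> arcs G = {} \<Longrightarrow> conv_cost G C (add_mset p X) = conv_cost G C X"
  by (rule conv_cost_cong) (auto simp: mload_add_mset)

lemma convex_step:
  fixes f :: "nat \<Rightarrow> real"
  assumes "\<And>k. f (Suc k) - f k \<le> f (Suc (Suc k)) - f (Suc k)" "a \<le> b"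
  shows "f (Suc a) + f b \<le> f a + f (Suc b)"
proof -
  have "f (Suc a) - f a \<le> f (Suc b) - f b"
    using assms(2) by (induction b rule: dec_induct) (use assms(1) order_trans in blast)+
  then show ?thesis by simp
qed

lemma filter_size_pos_obtain:
  assumes "0 < size (filter_mset Q Y)" obtains y Y' where "Y = add_mset y Y'" "Q y"
proof -
  obtain y where "y \<in># filter_mset Q Y" using assms by (metis multiset_nonemptyE size_empty less_irrefl)
  then show ?thesis using that by (metis filter_mset_eq_conv insert_DiffM set_mset_filter mem_Collect_eq)
qed

text \<open>This is M\<open>\<natural>\<close>-convexity of the potential. The two halves need each other in the induction:
  a path leaving one branch of a parallel composition may have to be replaced by a path of the other branch.\<close>

lemma conv_cost_exchange:
  fixes G :: "'e ep"
  assumes conv: "\<And>e k. C e (Suc k) - C e k \<le> C e (Suc (Suc k)) - C e (Suc k)"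
  shows "wf_ep G \<Longrightarrow> (\<And>p. p \<in># X + Y \<Longrightarrow> traverses G p) \<Longrightarrow> meeting G X < meeting G Y \<Longrightarrow>
     \<exists>y Y'. Y = add_mset y Y' \<and> y \<inter> arcs G \<noteq> {} \<and>
       conv_cost G C (add_mset y X) + conv_cost G C Y' \<le> conv_cost G C X + conv_cost G C Y"
    and "wf_ep G \<Longrightarrow> (\<And>p. p \<in># add_mset x X + Y \<Longrightarrow> traverses G p) \<Longrightarrow> x \<inter> arcs G \<noteq> {} \<Longrightarrow>
     (\<exists>y Y'. Y = add_mset y Y' \<and> y \<inter> arcs G \<noteq> {} \<and>
       conv_cost G C (add_mset y X) + conv_cost G C (add_mset x Y') \<le> conv_cost G C (add_mset x X) + conv_cost G C Y)
     \<or> (meeting G Y < meeting G (add_mset x X) \<and>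
       conv_cost G C X + conv_cost G C (add_mset x Y) \<le> conv_cost G C (add_mset x X) + conv_cost G C Y)"
proof (induction G arbitrary: X Y x)
  case (Arc a)
  have m: "meeting (Arc a) Z = mload a Z" for Z
    by (simp add: meeting_def mload_def)
  {
    case 1
    then have lt: "mload a X < mload a Y" by (simp add: m)
    then have "0 < size (filter_mset (\<lambda>p. a \<in> p) Y)" by (simp add: mload_def)
    then obtain y Y' where y: "Y = add_mset y Y'" "a \<in> y" by (rule filter_size_pos_obtain)
    have "C a (Suc (mload a X)) + C a (mload a Y') \<le> C a (mload a X) + C a (Suc (mload a Y'))"
      using lt y by (intro convex_step conv) (simp add: mload_add_mset)
    then show ?case using y by (intro exI[of _ y] exI[of _ Y']) (simp add: conv_cost_def mload_add_mset)
  next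
    case 2
    then have x: "a \<in> x" by simp
    show ?case
    proof (cases "mload a Y = 0")
      case True
      have "C a (Suc 0) + C a (mload a X) \<le> C a 0 + C a (Suc (mload a X))"
        by (intro convex_step conv) simp
      then show ?thesis using True x by (simp add: conv_cost_def mload_add_mset m add.commute)
    next
      case False
      then have "0 < size (filter_mset (\<lambda>p. a \<in> p) Y)" unfolding mload_def by (rule neq0_conv[THEN iffD1])
      then obtain y Y' where y: "Y = add_mset y Y'" "a \<in> y" by (rule filter_size_pos_obtain)
      then show ?thesis using x by (intro disjI1 exI[of _ y] exI[of _ Y']) (simp add: conv_cost_def mload_add_mset)
    qed
  }
next
  case (Ser a A)
  have cost: "conv_cost (Ser a A) C Z = C a (mload a Z) + conv_cost A C Z" if "wf_ep (Ser a A)" for Z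
    using that by (simp add: conv_cost_def)
  \<comment> \<open>The series arc is used exactly by the paths meeting \<open>A\<close>, so its
    load is the number counted by \<open>meeting\<close>. Comparing these counts in the statement is
    what tells in which direction convexity of \<open>C a\<close> may be used.\<close>
  have tr: "traverses A p \<and> (a \<in> p \<longleftrightarrow> p \<inter> arcs A \<noteq> {}) \<and> (p \<inter> arcs (Ser a A) \<noteq> {} \<longleftrightarrow> a \<in> p)"
    if wf: "wf_ep (Ser a A)" and trp: "traverses (Ser a A) p" for p
  proof (cases "p \<inter> arcs (Ser a A) = {}")
    case True then show ?thesis by (auto simp: traverses_def)
  next
    case False
    then obtain q where q: "q \<in> paths A" "p \<inter> insert a (arcs A) = insert a q"
      using trp by (auto simp: traverses_def)
    then have "p \<inter> arcs A = q" "a \<in> p" using paths_subset_arcs[of q A] wf by auto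
    then show ?thesis using q paths_subset_arcs[of q A] by (auto simp: traverses_def)
  qed
  have ml: "meeting A Z = mload a Z \<and> meeting (Ser a A) Z = mload a Z"
    if "wf_ep (Ser a A)" "\<And>p. p \<in># Z \<Longrightarrow> traverses (Ser a A) p" for Z
  proof -
    have "filter_mset (\<lambda>p. p \<inter> arcs A \<noteq> {}) Z = filter_mset (\<lambda>p. a \<in> p) Z"
      "filter_mset (\<lambda>p. p \<inter> arcs (Ser a A) \<noteq> {}) Z = filter_mset (\<lambda>p. a \<in> p) Z"
      using tr that by (intro filter_mset_cong; blast)+
    then show ?thesis by (simp only: meeting_def mload_def)
  qed
  {
    case 1
    have wA: "wf_ep A" using 1 by simp
    have mX: "meeting A X = mload a X \<and> meeting (Ser a A) X = mload a X" by (rule ml) (use 1 in auto)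
    have mY: "meeting A Y = mload a Y \<and> meeting (Ser a A) Y = mload a Y" by (rule ml) (use 1 in auto)
    have "meeting A X < meeting A Y" using 1 mX mY by simp
    moreover have "traverses A p" if "p \<in># X + Y" for p using tr[OF 1(1) 1(2)[OF that]] by blast
    ultimately obtain y Y' where y: "Y = add_mset y Y'" "y \<inter> arcs A \<noteq> {}"
      "conv_cost A C (add_mset y X) + conv_cost A C Y' \<le> conv_cost A C X + conv_cost A C Y"
      using Ser.IH(1)[OF wA, of X Y] by blast
    have ay: "a \<in> y" using tr[OF 1(1) 1(2), of y] y by simp
    have "C a (Suc (mload a X)) + C a (mload a Y') \<le> C a (mload a X) + C a (Suc (mload a Y'))"
      using 1(3) mX mY y ay by (intro convex_step conv) (simp add: mload_add_mset)
    then show ?case using y ay unfolding cost[OF 1(1)]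
      by (intro exI[of _ y] exI[of _ Y']) (simp add: mload_add_mset)
  next
    case 2
    have wA: "wf_ep A" using 2 by simp
    have mX: "meeting A (add_mset x X) = mload a (add_mset x X) \<and> meeting (Ser a A) (add_mset x X) = mload a (add_mset x X)"
      by (rule ml) (use 2 in auto)
    have mY: "meeting A Y = mload a Y \<and> meeting (Ser a A) Y = mload a Y" by (rule ml) (use 2 in auto)
    have trA: "traverses A p" if "p \<in># add_mset x X + Y" for p using tr[OF 2(1) 2(2)[OF that]] by blast
    have "traverses (Ser a A) x" by (rule 2(2)) simp
    then have x: "a \<in> x" "x \<inter> arcs A \<noteq> {}" using tr[OF 2(1)] 2(3) by blast+
    have "(\<exists>y Y'. Y = add_mset y Y' \<and> y \<inter> arcs A \<noteq> {} \<and>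
        conv_cost A C (add_mset y X) + conv_cost A C (add_mset x Y') \<le> conv_cost A C (add_mset x X) + conv_cost A C Y)
      \<or> (meeting A Y < meeting A (add_mset x X) \<and>
        conv_cost A C X + conv_cost A C (add_mset x Y) \<le> conv_cost A C (add_mset x X) + conv_cost A C Y)"
      by (rule Ser.IH(2)[OF wA trA x(2)])
    then show ?case
    proof (elim disjE exE conjE, goal_cases ex mv)
      case (ex y Y')
      have "traverses (Ser a A) y" by (rule 2(2)) (simp add: ex(1))
      then have "a \<in> y" using tr[OF 2(1)] ex(2) by blast
      then show ?thesis using ex x unfolding cost[OF 2(1)]
        by (intro disjI1 exI[of _ y] exI[of _ Y']) (simp add: mload_add_mset)
    next
      case mv
      have "C a (Suc (mload a Y)) + C a (mload a X) \<le> C a (mload a Y) + C a (Suc (mload a X))"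
        using mv(1) mX mY x by (intro convex_step conv) (simp add: mload_add_mset)
      then show ?thesis using mv mX mY x unfolding cost[OF 2(1)]
        by (intro disjI2) (simp add: mload_add_mset)
    qed
  }
next
  case (Par A B)
  have cost: "conv_cost (Par A B) C Z = conv_cost A C Z + conv_cost B C Z" if "wf_ep (Par A B)" for Z
    using that by (simp add: conv_cost_def sum.union_disjoint)
  have tr: "traverses A p \<and> traverses B p \<and> (p \<inter> arcs A = {} \<or> p \<inter> arcs B = {})"
    if "wf_ep (Par A B)" "traverses (Par A B) p" for p
  proof (cases "p \<inter> arcs (Par A B) = {}")
    case True then show ?thesis by (auto simp: traverses_def)
  next
    case False
    then have "p \<inter> (arcs A \<union> arcs B) \<in> paths A \<union> paths B" using that(2) by (simp add: traverses_def)
    then consider "p \<inter> (arcs A \<union> arcs B) \<in> paths A" | "p \<inter> (arcs A \<union> arcs B) \<in> paths B" by blast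
    then show ?thesis
    proof cases
      case 1
      then have "p \<inter> (arcs A \<union> arcs B) \<subseteq> arcs A" using paths_subset_arcs by blast
      then have "p \<inter> arcs B = {}" "p \<inter> (arcs A \<union> arcs B) = p \<inter> arcs A" using that(1) by auto
      then show ?thesis using 1 by (simp add: traverses_def)
    next
      case 2
      then have "p \<inter> (arcs A \<union> arcs B) \<subseteq> arcs B" using paths_subset_arcs by blast
      then have "p \<inter> arcs A = {}" "p \<inter> (arcs A \<union> arcs B) = p \<inter> arcs B" using that(1) by auto
      then show ?thesis using 2 by (simp add: traverses_def)
    qed
  qed
  have mt: "meeting (Par A B) Z = meeting A Z + meeting B Z"
    if "wf_ep (Par A B)" "\<And>p. p \<in># Z \<Longrightarrow> traverses (Par A B) p" for Z
    using that(2)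
  proof (induction Z)
    case (add p Z)
    then show ?case using tr[OF that(1), of p] by (auto simp: meeting_def Int_Un_distrib)
  qed (simp add: meeting_def)
  have IH1: "\<exists>y Y'. Y = add_mset y Y' \<and> y \<inter> arcs W \<noteq> {} \<and>
       conv_cost W C (add_mset y X) + conv_cost W C Y' \<le> conv_cost W C X + conv_cost W C Y"
    if "W = A \<or> W = B" "wf_ep W" "\<And>p. p \<in># X + Y \<Longrightarrow> traverses W p" "meeting W X < meeting W Y" for W X Y
    using that(1)
  proof
    assume W: "W = A"
    show ?thesis unfolding W by (rule Par.IH(1)[OF that(2-4)[unfolded W]])
  next
    assume W: "W = B"
    show ?thesis unfolding W by (rule Par.IH(3)[OF that(2-4)[unfolded W]])
  qed
  have IH2: "(\<exists>y Y'. Y = add_mset y Y' \<and> y \<inter> arcs W \<noteq> {} \<and>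
       conv_cost W C (add_mset y X) + conv_cost W C (add_mset x Y') \<le> conv_cost W C (add_mset x X) + conv_cost W C Y)
     \<or> (meeting W Y < meeting W (add_mset x X) \<and>
       conv_cost W C X + conv_cost W C (add_mset x Y) \<le> conv_cost W C (add_mset x X) + conv_cost W C Y)"
    if "W = A \<or> W = B" "wf_ep W" "\<And>p. p \<in># add_mset x X + Y \<Longrightarrow> traverses W p" "x \<inter> arcs W \<noteq> {}" for W x X Y
    using that(1)
  proof
    assume W: "W = A"
    show ?thesis unfolding W by (rule Par.IH(2)[OF that(2-4)[unfolded W]])
  next
    assume W: "W = B"
    show ?thesis unfolding W by (rule Par.IH(4)[OF that(2-4)[unfolded W]])
  qed
  have half1: "\<exists>y Y'. Y = add_mset y Y' \<and> y \<inter> arcs (Par A B) \<noteq> {} \<and>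
       conv_cost (Par A B) C (add_mset y X) + conv_cost (Par A B) C Y' \<le> conv_cost (Par A B) C X + conv_cost (Par A B) C Y"
    if UV: "U = A \<and> V = B \<or> U = B \<and> V = A" and wf: "wf_ep (Par A B)"
      and trv: "\<And>p. p \<in># X + Y \<Longrightarrow> traverses (Par A B) p" and lt: "meeting U X < meeting U Y" for U V X Y
  proof -
    have wU: "wf_ep U" using UV wf by auto
    have trU: "traverses U p" if "p \<in># X + Y" for p using tr[OF wf trv[OF that]] UV by blast
    have "\<exists>y Y'. Y = add_mset y Y' \<and> y \<inter> arcs U \<noteq> {} \<and>
       conv_cost U C (add_mset y X) + conv_cost U C Y' \<le> conv_cost U C X + conv_cost U C Y"
      by (rule IH1[OF _ wU trU lt]) (use UV in auto)
    then obtain y Y' where y: "Y = add_mset y Y'" "y \<inter> arcs U \<noteq> {}"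
      "conv_cost U C (add_mset y X) + conv_cost U C Y' \<le> conv_cost U C X + conv_cost U C Y" by blast
    have "traverses (Par A B) y" by (rule trv) (simp add: y(1))
    then have "y \<inter> arcs V = {}" using tr[OF wf, of y] y(2) UV by blast
    moreover have "conv_cost (Par A B) C Z = conv_cost U C Z + conv_cost V C Z" for Z
      using cost[OF wf] UV by auto
    moreover have "y \<inter> arcs (Par A B) \<noteq> {}" using y UV by auto
    ultimately show ?thesis using y
      by (intro exI[of _ y] exI[of _ Y']) (simp add: conv_cost_add_disjoint)
  qed
  have half2: "(\<exists>y Y'. Y = add_mset y Y' \<and> y \<inter> arcs (Par A B) \<noteq> {} \<and>
       conv_cost (Par A B) C (add_mset y X) + conv_cost (Par A B) C (add_mset x Y') \<le> conv_cost (Par A B) C (add_mset x X) + conv_cost (Par A B) C Y)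
     \<or> (meeting (Par A B) Y < meeting (Par A B) (add_mset x X) \<and>
       conv_cost (Par A B) C X + conv_cost (Par A B) C (add_mset x Y) \<le> conv_cost (Par A B) C (add_mset x X) + conv_cost (Par A B) C Y)"
    if UV: "U = A \<and> V = B \<or> U = B \<and> V = A" and wf: "wf_ep (Par A B)"
      and trv: "\<And>p. p \<in># add_mset x X + Y \<Longrightarrow> traverses (Par A B) p" and x: "x \<inter> arcs U \<noteq> {}" for U V x X Y
  proof -
    have wU: "wf_ep U" "wf_ep V" using UV wf by auto
    have trU: "traverses U p" "traverses V p" if "p \<in># add_mset x X + Y" for p using tr[OF wf trv[OF that]] UV by blast+
    have c: "conv_cost (Par A B) C Z = conv_cost U C Z + conv_cost V C Z" for Z
      using cost[OF wf] UV by auto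
    have dj: "p \<inter> arcs U = {} \<or> p \<inter> arcs V = {}" if "p \<in># add_mset x X + Y" for p
      using tr[OF wf trv[OF that]] UV by blast
    have xV: "x \<inter> arcs V = {}" using dj[of x] x by simp
    have yV: "y \<inter> arcs V = {}" if "y \<in># Y" "y \<inter> arcs U \<noteq> {}" for y using dj[of y] that by simp
    have yU: "y \<inter> arcs U = {}" if "y \<in># Y" "y \<inter> arcs V \<noteq> {}" for y using dj[of y] that by simp
    have "(\<exists>y Y'. Y = add_mset y Y' \<and> y \<inter> arcs U \<noteq> {} \<and>
       conv_cost U C (add_mset y X) + conv_cost U C (add_mset x Y') \<le> conv_cost U C (add_mset x X) + conv_cost U C Y)
     \<or> (meeting U Y < meeting U (add_mset x X) \<and>
       conv_cost U C X + conv_cost U C (add_mset x Y) \<le> conv_cost U C (add_mset x X) + conv_cost U C Y)"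
      by (rule IH2[OF _ wU(1) trU(1) x]) (use UV in auto)
    then show ?thesis
    proof (elim disjE exE conjE, goal_cases ex mv)
      case (ex y Y')
      then have "y \<inter> arcs (Par A B) \<noteq> {}" using UV by auto
      then show ?thesis using ex xV yV[of y] unfolding c
        by (intro disjI1 exI[of _ y] exI[of _ Y']) (simp add: conv_cost_add_disjoint)
    next
      \<comment> \<open>Here \<open>x\<close> leaves \<open>U\<close> without replacement. If
        \<open>X\<close> meets \<open>V\<close> less often than \<open>Y\<close> does, a path of
        \<open>Y\<close> through \<open>V\<close> crosses over in return. Otherwise the surplus in
        \<open>U\<close> survives in the total count, and the move without replacement is the second
        alternative for \<open>Par A B\<close>.\<close>
      case mv
      show ?thesis
      proof (cases "meeting V X < meeting V Y")
        case True
        have "\<exists>y Y'. Y = add_mset y Y' \<and> y \<inter> arcs V \<noteq> {} \<and>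
          conv_cost V C (add_mset y X) + conv_cost V C Y' \<le> conv_cost V C X + conv_cost V C Y"
          by (rule IH1[OF _ wU(2) _ True]) (use UV trU in auto)
        then obtain y Y' where y: "Y = add_mset y Y'" "y \<inter> arcs V \<noteq> {}"
          "conv_cost V C (add_mset y X) + conv_cost V C Y' \<le> conv_cost V C X + conv_cost V C Y" by blast
        then have "y \<inter> arcs (Par A B) \<noteq> {}" using UV by auto
        moreover have "y \<inter> arcs U = {}" using y yU by simp
        moreover have "conv_cost U C (add_mset x Y) = conv_cost U C (add_mset x Y')"
          unfolding y(1) by (subst add_mset_commute) (rule conv_cost_add_disjoint, fact)
        ultimately show ?thesis using y mv(2) xV unfolding c
          by (intro disjI1 exI[of _ y] exI[of _ Y']) (simp add: conv_cost_add_disjoint)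
      next
        case False
        have "meeting (Par A B) (add_mset x X) = meeting A (add_mset x X) + meeting B (add_mset x X)"
          "meeting (Par A B) Y = meeting A Y + meeting B Y"
          by (rule mt[OF wf], rule trv, force)+
        then have "meeting (Par A B) (add_mset x X) = meeting U (add_mset x X) + meeting V (add_mset x X)"
          "meeting (Par A B) Y = meeting U Y + meeting V Y" using UV by auto
        moreover have "meeting V (add_mset x X) = meeting V X" using xV by (simp add: meeting_def)
        ultimately show ?thesis using False mv xV unfolding c
          by (intro disjI2) (simp add: conv_cost_add_disjoint)
      qed
    qed
  qed
  {
    case 1
    have "meeting (Par A B) X = meeting A X + meeting B X" "meeting (Par A B) Y = meeting A Y + meeting B Y"
      using mt[OF 1(1)] 1(2) by auto
    then consider "meeting A X < meeting A Y" | "meeting B X < meeting B Y" using 1(3) by linarith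
    then show ?case
    proof cases
      case p: 1
      show ?thesis by (rule half1[of A B, OF _ 1(1,2) p]) auto
    next
      case p: 2
      show ?thesis by (rule half1[of B A, OF _ 1(1,2) p]) auto
    qed
  next
    case 2
    consider "x \<inter> arcs A \<noteq> {}" | "x \<inter> arcs B \<noteq> {}" using 2(3) by auto
    then show ?case
    proof cases
      case p: 1
      show ?thesis by (rule half2[of A B, OF _ 2(1,2) p]) auto
    next
      case p: 2
      show ?thesis by (rule half2[of B A, OF _ 2(1,2) p]) auto
    qed
  }
qed

section \<open>Gibbs weights: negative dependence and exchangeability\<close>

definition ep_weight :: "'e ep \<Rightarrow> ('e \<Rightarrow> nat \<Rightarrow> real) \<Rightarrow> 'e set multiset \<Rightarrow> real" where
  "ep_weight G C X = exp (- conv_cost G C X)"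

text \<open>Paths in different branches of a parallel composition share no arc, so the kernel is 1
  there and the cross terms agree with those of the square. A series arc multiplies the whole form
  by \<open>r a\<close>, which is at most 1.\<close>

lemma path_kernel_le:
  fixes h :: "'e set \<Rightarrow> real"
  assumes "wf_ep G" "\<And>e. 0 \<le> r e" "\<And>e. r e \<le> 1"
  shows "(\<Sum>p\<in>paths G. \<Sum>q\<in>paths G. h p * h q * (\<Prod>e\<in>p \<inter> q. r e)) \<le> (\<Sum>p\<in>paths G. h p)\<^sup>2"
  using assms(1)
proof (induction G arbitrary: h)
  case (Arc a)
  have "h {a} * h {a} * r a \<le> h {a} * h {a} * 1"
    by (intro mult_left_mono assms) simp
  then show ?case by (simp add: power2_eq_square)
next
  case (Par A B)
  let ?k = "\<lambda>p q. h p * h q * (\<Prod>e\<in>p \<inter> q. r e)"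
  have dj: "p \<inter> q = {}" if "p \<in> paths A" "q \<in> paths B" for p q
    using that Par.prems paths_subset_arcs[of p A] paths_subset_arcs[of q B] by auto
  have jd: "q \<inter> p = {}" if "p \<in> paths A" "q \<in> paths B" for p q
    using dj[OF that] by (simp add: Int_commute)
  from dj have "paths A \<inter> paths B = {}" using paths_subset_arcs[of _ A] by (metis Int_absorb disjoint_iff)
  then have S: "(\<Sum>p\<in>paths (Par A B). F p) = (\<Sum>p\<in>paths A. F p) + (\<Sum>p\<in>paths B. F p)" for F :: "'e set \<Rightarrow> real"
    by (simp add: sum.union_disjoint finite_paths)
  have AB: "(\<Sum>p\<in>paths A. \<Sum>q\<in>paths B. ?k p q) = (\<Sum>p\<in>paths A. h p) * (\<Sum>q\<in>paths B. h q)"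
    unfolding sum_product by (intro sum.cong refl) (simp add: dj)
  have BA: "(\<Sum>p\<in>paths B. \<Sum>q\<in>paths A. ?k p q) = (\<Sum>p\<in>paths B. h p) * (\<Sum>q\<in>paths A. h q)"
    unfolding sum_product by (intro sum.cong refl) (simp add: jd)
  have "(\<Sum>p\<in>paths A. \<Sum>q\<in>paths A. ?k p q) \<le> (\<Sum>p\<in>paths A. h p)\<^sup>2"
    "(\<Sum>p\<in>paths B. \<Sum>q\<in>paths B. ?k p q) \<le> (\<Sum>p\<in>paths B. h p)\<^sup>2"
    using Par by auto
  then show ?case unfolding S sum.distrib AB BA by (simp add: power2_eq_square algebra_simps)
next
  case (Ser a A)
  have na: "a \<notin> p" if "p \<in> paths A" for p using that Ser.prems paths_subset_arcs[of p A] by auto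
  have inj: "inj_on (insert a) (paths A)"
    by (rule inj_onI) (metis na insert_ident)
  let ?X = "\<Sum>p\<in>paths A. \<Sum>q\<in>paths A. h (insert a p) * h (insert a q) * (\<Prod>e\<in>p \<inter> q. r e)"
  have X: "?X \<le> (\<Sum>p\<in>paths A. h (insert a p))\<^sup>2" using Ser by auto
  have "(\<Sum>p\<in>paths (Ser a A). \<Sum>q\<in>paths (Ser a A). h p * h q * (\<Prod>e\<in>p \<inter> q. r e)) = r a * ?X"
  proof -
    have *: "h (insert a p) * h (insert a q) * (\<Prod>e\<in>insert a p \<inter> insert a q. r e)
      = r a * (h (insert a p) * h (insert a q) * (\<Prod>e\<in>p \<inter> q. r e))"
      if "p \<in> paths A" "q \<in> paths A" for p q
    proof -
      have "finite p" using that paths_subset_arcs[of p A] finite_subset[OF _ finite_arcs] by blast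
      then have "(\<Prod>e\<in>insert a (p \<inter> q). r e) = r a * (\<Prod>e\<in>p \<inter> q. r e)" using na that by simp
      moreover have "insert a p \<inter> insert a q = insert a (p \<inter> q)" by auto
      ultimately show ?thesis by simp
    qed
    show ?thesis
      unfolding paths.simps sum.reindex[OF inj] comp_def sum_distrib_left
      by (intro sum.cong refl *)
  qed
  also have "\<dots> \<le> (\<Sum>p\<in>paths A. h (insert a p))\<^sup>2"
  \<comment> \<open>\<open>h\<close> has arbitrary sign; a negative \<open>?X\<close> is disposed of
    by the nonnegative square.\<close>
  proof (cases "0 \<le> ?X")
    case True
    then have "r a * ?X \<le> 1 * ?X" by (intro mult_right_mono assms)
    then show ?thesis using X by simp
  next
    case False
    then have "r a * ?X \<le> 0" using assms(2)[of a] by (intro mult_nonneg_nonpos) auto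
    also have "0 \<le> (\<Sum>p\<in>paths A. h (insert a p))\<^sup>2" by simp
    finally show ?thesis .
  qed
  finally show ?case by (simp add: sum.reindex[OF inj])
qed

text \<open>When two paths are added, only the arcs they share see a second difference
  \<open>d e\<close> of the cost. Convexity gives \<open>exp (- d e) \<le> 1\<close>, and
  \<open>path_kernel_le\<close> applies to \<open>h p = u p * w (C + p)\<close>.\<close>

lemma neg_dep_ep_weight:
  assumes wf: "wf_ep G" and conv: "\<And>e k. C e (Suc k) - C e k \<le> C e (Suc (Suc k)) - C e (Suc k)"
  shows "neg_dep (paths G) (ep_weight G C)"
  unfolding neg_dep_def
proof (intro conjI allI)
  fix X and u :: "'a set \<Rightarrow> real"
  let ?w = "ep_weight G C"
  define d where "d e = C e (Suc (Suc (mload e X))) + C e (mload e X) - 2 * C e (Suc (mload e X))" for e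
  define h where "h p = u p * ?w (add_mset p X)" for p
  have key: "?w X * (u p * u q * ?w (add_mset p (add_mset q X))) = h p * h q * (\<Prod>e\<in>p \<inter> q. exp (- d e))"
    if "p \<in> paths G" "q \<in> paths G" for p q
  proof -
    have "(\<Sum>e\<in>p \<inter> q. d e) = (\<Sum>e\<in>arcs G. if e \<in> p \<inter> q then d e else 0)"
      using paths_subset_arcs[OF that(1)] by (subst sum.inter_restrict[symmetric]) (auto intro!: sum.cong)
    then have "conv_cost G C X + conv_cost G C (add_mset p (add_mset q X))
       = conv_cost G C (add_mset p X) + conv_cost G C (add_mset q X) + (\<Sum>e\<in>p \<inter> q. d e)"
      unfolding conv_cost_def by (simp add: sum.distrib[symmetric]) (intro sum.cong refl, auto simp: mload_add_mset d_def)
    then have "?w X * ?w (add_mset p (add_mset q X)) = ?w (add_mset p X) * ?w (add_mset q X) * exp (- (\<Sum>e\<in>p \<inter> q. d e))"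
      unfolding ep_weight_def exp_add[symmetric] by simp
    moreover have "exp (- (\<Sum>e\<in>p \<inter> q. d e)) = (\<Prod>e\<in>p \<inter> q. exp (- d e))"
    proof -
      have "finite (p \<inter> q)" using paths_subset_arcs[OF that(1)] finite_subset[OF _ finite_arcs] by blast
      then show ?thesis by (simp add: exp_sum sum_negf[symmetric])
    qed
    ultimately show ?thesis by (simp add: h_def mult_ac)
  qed
  have "?w X * (\<Sum>p\<in>paths G. \<Sum>q\<in>paths G. u p * u q * ?w (add_mset p (add_mset q X)))
      = (\<Sum>p\<in>paths G. \<Sum>q\<in>paths G. h p * h q * (\<Prod>e\<in>p \<inter> q. exp (- d e)))"
    by (simp add: sum_distrib_left key)
  also have "\<dots> \<le> (\<Sum>p\<in>paths G. h p)\<^sup>2"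
  proof (rule path_kernel_le[OF wf])
    show "exp (- d e) \<le> 1" for e using conv[of e "mload e X"] by (simp add: d_def)
  qed simp
  finally show "?w X * (\<Sum>p\<in>paths G. \<Sum>q\<in>paths G. u p * u q * ?w (add_mset p (add_mset q X)))
    \<le> (\<Sum>p\<in>paths G. u p * ?w (add_mset p X))\<^sup>2" unfolding h_def .
qed (simp add: ep_weight_def)

text \<open>The exchange axiom in multiplicative form, between the equally large multisets
  \<open>add_mset x X\<close> and \<open>Y\<close>. The common part \<open>R\<close> takes no part
  in the exchange; later it holds the players whose values are already final.\<close>

definition exchangeable :: "'p set \<Rightarrow> ('p multiset \<Rightarrow> real) \<Rightarrow> bool" where
  "exchangeable P w \<longleftrightarrow> (\<forall>R x X Y. insert x (set_mset X) \<subseteq> P \<longrightarrow> set_mset Y \<subseteq> P \<longrightarrow> size Y = Suc (size X) \<longrightarrow>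
     (\<exists>y Y'. Y = add_mset y Y' \<and> w (R + add_mset x X) * w (R + Y) \<le> w (R + add_mset y X) * w (R + add_mset x Y')))"

lemma exchangeable_ep_weight:
  assumes wf: "wf_ep G" and conv: "\<And>e k. C e (Suc k) - C e k \<le> C e (Suc (Suc k)) - C e (Suc k)"
  shows "exchangeable (paths G) (ep_weight G C)"
  unfolding exchangeable_def
proof (intro allI impI)
  fix R X Y :: "'a set multiset" and x
  assume X: "insert x (set_mset X) \<subseteq> paths G" and Y: "set_mset Y \<subseteq> paths G" and sz: "size Y = Suc (size X)"
  \<comment> \<open>Shifting each cost by the load of \<open>R\<close> preserves convexity and
    absorbs \<open>R\<close>.\<close>
  define D where "D e k = C e (mload e R + k)" for e k
  have D: "conv_cost G C (R + Z) = conv_cost G D Z" for Z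
    by (simp add: conv_cost_def D_def mload_union)
  have full: "p \<inter> arcs G = p" if "p \<in> paths G" for p using paths_subset_arcs[OF that] by auto
  have tr: "traverses G p" if "p \<in># add_mset x X + Y" for p
    using that X Y full[of p] by (auto simp: traverses_def)
  have meet: "meeting G Z = size Z" if "set_mset Z \<subseteq> paths G" for Z
  proof -
    have "filter_mset (\<lambda>p. p \<inter> arcs G \<noteq> {}) Z = Z"
      using that full paths_subset_arcs by (subst filter_mset_eq_conv) fastforce
    then show ?thesis by (simp add: meeting_def)
  qed
  have xG: "x \<inter> arcs G \<noteq> {}" using X full[of x] paths_subset_arcs[of x G] by auto
  have "(\<exists>y Y'. Y = add_mset y Y' \<and> y \<inter> arcs G \<noteq> {} \<and>
       conv_cost G D (add_mset y X) + conv_cost G D (add_mset x Y') \<le> conv_cost G D (add_mset x X) + conv_cost G D Y)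
     \<or> (meeting G Y < meeting G (add_mset x X) \<and>
       conv_cost G D X + conv_cost G D (add_mset x Y) \<le> conv_cost G D (add_mset x X) + conv_cost G D Y)"
    by (rule conv_cost_exchange(2)[OF _ wf tr xG]) (simp add: D_def conv)
  \<comment> \<open>Every path of \<open>G\<close> meets \<open>G\<close>, so the counts are sizes;
    as these agree, a move without replacement is excluded.\<close>
  moreover have "\<not> meeting G Y < meeting G (add_mset x X)" using meet[of Y] meet[of "add_mset x X"] X Y sz by simp
  ultimately obtain y Y' where "Y = add_mset y Y'"
    "conv_cost G D (add_mset y X) + conv_cost G D (add_mset x Y') \<le> conv_cost G D (add_mset x X) + conv_cost G D Y"
    by blast
  then show "\<exists>y Y'. Y = add_mset y Y' \<and>
      ep_weight G C (R + add_mset x X) * ep_weight G C (R + Y) \<le> ep_weight G C (R + add_mset y X) * ep_weight G C (R + add_mset x Y')"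
    unfolding ep_weight_def D exp_add[symmetric] by (intro exI[of _ y] exI[of _ Y']) simp
qed

text \<open>The law of one player given \<open>R + Z\<close> against its marginal given
  \<open>R\<close> alone. The exchange property supplies one \<open>y\<close> for each
  \<open>A\<close>; bounding by the sum over all \<open>y\<close> in \<open>A\<close> makes
  \<open>msum_pull\<close> applicable, which separates the two factors on the right and contributes
  \<open>Suc (size Z)\<close>.\<close>

lemma conditional_le_marginal:
  assumes ex: "exchangeable P w" and w: "\<And>A. 0 < w A" and fin: "finite P"
    and x: "x \<in> P" and Z: "set_mset Z \<subseteq> P"
  shows "w (R + add_mset x Z) * msum P (Suc (size Z)) (\<lambda>A. w (R + A))
    \<le> real (Suc (size Z)) * (tot P w (R + Z) * msum P (size Z) (\<lambda>A. w (R + add_mset x A)))"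
proof -
  have "w (R + add_mset x Z) * msum P (Suc (size Z)) (\<lambda>A. w (R + A))
    \<le> msum P (Suc (size Z)) (\<lambda>A. \<Sum>y\<in>#A. w (R + add_mset y Z) * w (R + add_mset x (A - {#y#})))"
    unfolding msum_cmult[symmetric]
  proof (rule msum_mono)
    fix A assume A: "set_mset A \<subseteq> P" "size A = Suc (size Z)"
    then obtain y A' where y: "A = add_mset y A'"
      "w (R + add_mset x Z) * w (R + A) \<le> w (R + add_mset y Z) * w (R + add_mset x A')"
      using ex x Z unfolding exchangeable_def by (metis insert_subset)
    have "0 \<le> (\<Sum>y\<in>#M. w (R + add_mset y Z) * w (R + add_mset x (A - {#y#})))" for M
      by (induction M) (simp_all add: w less_imp_le)
    from this[of A'] show "w (R + add_mset x Z) * w (R + A) \<le> (\<Sum>y\<in>#A. w (R + add_mset y Z) * w (R + add_mset x (A - {#y#})))"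
      using y by simp
  qed
  also have "\<dots> = real (Suc (size Z)) * (\<Sum>y\<in>P. msum P (size Z) (\<lambda>A. w (R + add_mset y Z) * w (R + add_mset x A)))"
    by (rule msum_pull)
  also have "\<dots> = real (Suc (size Z)) * (tot P w (R + Z) * msum P (size Z) (\<lambda>A. w (R + add_mset x A)))"
    unfolding msum_cmult tot_def sum_distrib_right by simp
  finally show ?thesis .
qed

subsection \<open>Warm start\<close>

text \<open>Players are labelled here because the set of updated players must be tracked;
  \<open>conf\<close> forgets the labels.\<close>

definition conf :: "(nat \<Rightarrow> 'p) \<Rightarrow> nat set \<Rightarrow> 'p multiset" where
  "conf y V = image_mset y (mset_set V)"

text \<open>In \<open>n\<close>-player single-site dynamics on labelled states, \<open>kap n t V\<close> is the probability that \<open>V\<close> is exactly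
  the set of players updated during \<open>t\<close> steps, and \<open>cover P w n h t V y\<close> is the expectation of \<open>h\<close> at time \<open>t\<close>
  on this event, for the chain started in \<open>y\<close>. In the recursion \<open>j\<close> is the first player to be updated;
  the two summands say whether it will be updated again.\<close>

primrec kap :: "nat \<Rightarrow> nat \<Rightarrow> nat set \<Rightarrow> real" where
  "kap n 0 V = (if V = {} then 1 else 0)"
| "kap n (Suc t) V = (\<Sum>j\<in>V. kap n t V + kap n t (V - {j})) / real n"

primrec cover :: "'p set \<Rightarrow> ('p multiset \<Rightarrow> real) \<Rightarrow> nat \<Rightarrow> ('p multiset \<Rightarrow> real) \<Rightarrow> nat \<Rightarrow> nat set \<Rightarrow> (nat \<Rightarrow> 'p) \<Rightarrow> real" where
  "cover P w n h 0 V y = (if V = {} then h (conf y {..<n}) else 0)"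
| "cover P w n h (Suc t) V y =
    (\<Sum>j\<in>V. (\<Sum>p\<in>P. w (add_mset p (conf y ({..<n} - {j}))) / tot P w (conf y ({..<n} - {j})) * cover P w n h t V (y(j := p)))
      + (\<Sum>p\<in>P. w (add_mset p (conf y ({..<n} - {j}))) / tot P w (conf y ({..<n} - {j})) * cover P w n h t (V - {j}) (y(j := p)))) / real n"

lemma conf_remove: "finite V \<Longrightarrow> j \<in> V \<Longrightarrow> conf y V = add_mset (y j) (conf y (V - {j}))"
  by (simp add: conf_def mset_set.remove)

lemma conf_upd: "j \<notin> V \<Longrightarrow> conf (y(j := p)) V = conf y V"
  unfolding conf_def by (intro image_mset_cong) (metis elem_mset_set fun_upd_other mset_set.infinite empty_iff set_mset_empty)

lemma conf_insert_upd: "finite V \<Longrightarrow> j \<in> V \<Longrightarrow> conf (y(j := p)) V = add_mset p (conf y (V - {j}))"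
  by (simp add: conf_remove[of V j] conf_upd)

lemma size_conf [simp]: "size (conf y V) = card V"
  by (simp add: conf_def)

lemma set_conf: "finite V \<Longrightarrow> set_mset (conf y V) = y ` V"
  by (simp add: conf_def)

lemma conf_union: "finite V \<Longrightarrow> finite U \<Longrightarrow> V \<inter> U = {} \<Longrightarrow> conf y (V \<union> U) = conf y V + conf y U"
  by (simp add: conf_def mset_set_Union)

lemma sum_conf: "finite V \<Longrightarrow> (\<Sum>x\<in>#conf y V. f x) = (\<Sum>j\<in>V. f (y j))"
  by (simp add: conf_def sum_unfold_sum_mset multiset.map_comp comp_def)

text \<open>For fixed \<open>j\<close>, the sets containing \<open>j\<close> and the same sets with
  \<open>j\<close> deleted together list every subset of \<open>S\<close> once. It recombines the
  case distinction whether \<open>j\<close> is updated again.\<close>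

lemma sum_Pow_pairs:
  fixes c :: "'i \<Rightarrow> 'i set \<Rightarrow> real"
  assumes S: "finite S"
  shows "(\<Sum>V\<in>Pow S. \<Sum>j\<in>V. c j V + c j (V - {j})) = (\<Sum>j\<in>S. \<Sum>V\<in>Pow S. c j V)"
proof -
  have split: "(\<Sum>V\<in>{V\<in>Pow S. j \<in> V}. c j V + c j (V - {j})) = (\<Sum>V\<in>Pow S. c j V)" if j: "j \<in> S" for j
  proof -
    have "(\<Sum>V\<in>{V\<in>Pow S. j \<in> V}. c j (V - {j})) = (\<Sum>V\<in>{V\<in>Pow S. j \<notin> V}. c j V)"
      by (rule sum.reindex_bij_witness[of _ "insert j" "\<lambda>V. V - {j}"]) (use j in auto)
    moreover have "(\<Sum>V\<in>Pow S. c j V) = sum (c j) ({V\<in>Pow S. j \<in> V} \<union> {V\<in>Pow S. j \<notin> V})"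
      by (rule arg_cong[of _ _ "sum (c j)"]) auto
    moreover have "sum (c j) ({V\<in>Pow S. j \<in> V} \<union> {V\<in>Pow S. j \<notin> V})
      = (\<Sum>V\<in>{V\<in>Pow S. j \<in> V}. c j V) + (\<Sum>V\<in>{V\<in>Pow S. j \<notin> V}. c j V)"
      using S by (intro sum.union_disjoint) auto
    ultimately show ?thesis unfolding sum.distrib by (simp only:)
  qed
  have "(\<Sum>V\<in>Pow S. \<Sum>j\<in>V. c j V + c j (V - {j})) = (\<Sum>V\<in>Pow S. \<Sum>j\<in>{j\<in>S. j \<in> V}. c j V + c j (V - {j}))"
    by (intro sum.cong refl) auto
  also have "\<dots> = (\<Sum>j\<in>S. \<Sum>V\<in>{V\<in>Pow S. j \<in> V}. c j V + c j (V - {j}))"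
    using S by (intro sum.swap_restrict) auto
  also have "\<dots> = (\<Sum>j\<in>S. \<Sum>V\<in>Pow S. c j V)"
    by (intro sum.cong refl split)
  finally show ?thesis .
qed

lemma kap_nonneg: "0 \<le> kap n t V"
  by (induction t arbitrary: V) (auto intro!: divide_nonneg_nonneg sum_nonneg add_nonneg_nonneg)

text \<open>For a set \<open>S\<close> of players both sides are the probability that all
  \<open>t\<close> updates fall into \<open>S\<close>; for the set of all players this is total mass
  one.\<close>

lemma sum_kap: "finite S \<Longrightarrow> (\<Sum>V\<in>Pow S. kap n t V) = (real (card S) / real n) ^ t"
proof (induction t)
  case 0
  then have "(\<Sum>V\<in>Pow S. kap n 0 V) = (\<Sum>V\<in>{{}}. kap n 0 V)"
    by (intro sum.mono_neutral_right) auto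
  then show ?case by simp
next
  case (Suc t)
  then show ?case
    using sum_Pow_pairs[of S "\<lambda>_. kap n t"] by (simp add: sum_divide_distrib[symmetric])
qed

lemma kap_le_one:
  assumes "0 < n" shows "kap n t {..<n} \<le> 1"
proof -
  have "(\<Sum>V\<in>{{..<n}}. kap n t V) \<le> (\<Sum>V\<in>Pow {..<n}. kap n t V)"
    by (intro sum_mono2) (auto simp: kap_nonneg)
  then show ?thesis using assms sum_kap[of "{..<n}" n t] by simp
qed

text \<open>The coupon collector estimate: a union bound over a player that is never
  updated.\<close>

lemma kap_full_ge:
  assumes n: "0 < n" shows "1 - real n * (real (n - 1) / real n) ^ t \<le> kap n t {..<n}"
proof -
  let ?S = "{..<n}"
  have "(\<Sum>V\<in>Pow ?S - {?S}. kap n t V) \<le> (\<Sum>V\<in>(\<Union>j\<in>?S. Pow (?S - {j})). kap n t V)"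
    by (intro sum_mono2) (auto simp: kap_nonneg)
  also have "\<dots> \<le> (\<Sum>j\<in>?S. \<Sum>V\<in>Pow (?S - {j}). kap n t V)"
  proof -
    have "(\<Sum>V\<in>(\<Union>j\<in>J. Pow (?S - {j})). kap n t V) \<le> (\<Sum>j\<in>J. \<Sum>V\<in>Pow (?S - {j}). kap n t V)" if "finite J" for J
      using that
    proof (induction J)
      case (insert j J)
      have "(\<Sum>V\<in>Pow (?S - {j}) \<union> (\<Union>j\<in>J. Pow (?S - {j})). kap n t V)
        \<le> (\<Sum>V\<in>Pow (?S - {j}). kap n t V) + (\<Sum>V\<in>(\<Union>j\<in>J. Pow (?S - {j})). kap n t V)"
        using insert by (subst sum_Un) (auto intro!: sum_nonneg simp: kap_nonneg)
      then show ?case using insert by simp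
    qed simp
    then show ?thesis by simp
  qed
  also have "\<dots> = (\<Sum>j\<in>?S. (real (n - 1) / real n) ^ t)"
  proof (intro sum.cong refl)
    fix j assume "j \<in> ?S"
    then have "card (?S - {j}) = n - 1" by simp
    then show "(\<Sum>V\<in>Pow (?S - {j}). kap n t V) = (real (n - 1) / real n) ^ t"
      using sum_kap[of "?S - {j}" n t] by (simp only: finite_Diff finite_lessThan)
  qed
  also have "\<dots> = real n * (real (n - 1) / real n) ^ t" by (simp only: sum_constant card_lessThan)
  finally have "(\<Sum>V\<in>Pow ?S - {?S}. kap n t V) \<le> real n * (real (n - 1) / real n) ^ t" .
  moreover have "(\<Sum>V\<in>Pow ?S. kap n t V) = kap n t ?S + (\<Sum>V\<in>Pow ?S - {?S}. kap n t V)"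
    by (intro sum.remove) auto
  moreover have "(\<Sum>V\<in>Pow ?S. kap n t V) = 1" using n sum_kap[of ?S n t] by simp
  ultimately show ?thesis by linarith
qed

context
  fixes P :: "'p set" and w :: "'p multiset \<Rightarrow> real"
  assumes fin: "finite P" and ne: "P \<noteq> {}" and w: "\<And>A. 0 < w A"
begin

lemma tot_pos': "0 < tot P w C" by (rule tot_pos[OF fin ne w])

lemma sum_w_tot: "(\<Sum>p\<in>P. w (add_mset p C) / tot P w C) = 1"
  using tot_pos'[of C] by (simp add: sum_divide_distrib[symmetric] tot_def[symmetric])

lemma cover_one: "cover P w n (\<lambda>_. 1) t V y = kap n t V"
proof (induction t arbitrary: V y)
  case (Suc t)
  show ?case unfolding cover.simps Suc.IH sum_distrib_right[symmetric] sum_w_tot by simp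
qed simp

lemma cover_nonneg: "(\<And>A. 0 \<le> h A) \<Longrightarrow> 0 \<le> cover P w n h t V y"
  by (induction t arbitrary: V y)
    (auto intro!: divide_nonneg_nonneg sum_nonneg add_nonneg_nonneg mult_nonneg_nonneg simp: w tot_pos' less_imp_le)

lemma cover_lin: "cover P w n (\<lambda>A. a * h A + b * k A) t V y = a * cover P w n h t V y + b * cover P w n k t V y"
proof (induction t arbitrary: V y)
  case (Suc t)
  show ?case
    unfolding cover.simps Suc
    by (simp add: distrib_left sum.distrib sum_distrib_left add_divide_distrib sum_divide_distrib mult_ac)
qed simp

lemma cover_zero: "cover P w n (\<lambda>A. 0) t V y = 0"
  using cover_lin[of n 0 "\<lambda>_. 0" 0 "\<lambda>_. 0" t V y] by simp

lemma cover_sum: "finite I \<Longrightarrow> cover P w n (\<lambda>A. \<Sum>i\<in>I. c i * k i A) t V y = (\<Sum>i\<in>I. c i * cover P w n (k i) t V y)"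
proof (induction I rule: finite_induct)
  case (insert i I)
  then show ?case using cover_lin[of n "c i" "k i" 1 "\<lambda>A. \<Sum>i\<in>I. c i * k i A" t V y] by simp
qed (simp add: cover_zero)

lemma cover_le_kap:
  assumes "\<And>A. h A \<le> 1" shows "cover P w n h t V y \<le> kap n t V"
proof -
  have "0 \<le> cover P w n (\<lambda>A. 1 * 1 + (-1) * h A) t V y" by (rule cover_nonneg) (use assms in simp)
  then show ?thesis unfolding cover_lin cover_one by simp
qed

lemma cover_cong:
  assumes "\<And>A. set_mset A \<subseteq> P \<Longrightarrow> size A = n \<Longrightarrow> h A = k A"
  shows "y ` {..<n} \<subseteq> P \<Longrightarrow> V \<subseteq> {..<n} \<Longrightarrow> cover P w n h t V y = cover P w n k t V y"
proof (induction t arbitrary: V y)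
  case 0
  then show ?case using assms[of "conf y {..<n}"] by (simp add: set_conf)
next
  case (Suc t)
  have y': "(y(j := p)) ` {..<n} \<subseteq> P" if "p \<in> P" for p j using Suc.prems(1) that by auto
  have V': "V - {j} \<subseteq> {..<n}" for j using Suc.prems(2) by auto
  have "cover P w n h t V (y(j := p)) = cover P w n k t V (y(j := p))"
    "cover P w n h t (V - {j}) (y(j := p)) = cover P w n k t (V - {j}) (y(j := p))" if "p \<in> P" for j p
    by (rule Suc.IH[OF y'[OF that] Suc.prems(2)], rule Suc.IH[OF y'[OF that] V'])
  then show ?case unfolding cover.simps
    by (intro arg_cong2[of _ _ _ _ "(/)"] arg_cong2[of _ _ _ _ "(+)"] arg_cong2[of _ _ _ _ "(*)"] sum.cong refl) auto
qed

text \<open>The law of total probability over the exact set of updated players, which connects the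
  labelled recursion with the Glauber operator on multisets.\<close>

lemma sum_cover:
  assumes "0 < n"
  shows "(\<Sum>V\<in>Pow {..<n}. cover P w n h t V y) = (glauber P w ^^ t) h (conf y {..<n})"
proof (induction t arbitrary: y)
  case 0
  have "(\<Sum>V\<in>Pow {..<n}. cover P w n h 0 V y) = (\<Sum>V\<in>{{}}. cover P w n h 0 V y)"
    by (intro sum.mono_neutral_right) auto
  then show ?case by simp
next
  case (Suc t)
  let ?S = "{..<n}"
  define q where "q j p = w (add_mset p (conf y (?S - {j}))) / tot P w (conf y (?S - {j}))" for j p
  define c where "c j V = (\<Sum>p\<in>P. q j p * cover P w n h t V (y(j := p)))" for j V
  have "(\<Sum>V\<in>Pow ?S. cover P w n h (Suc t) V y) = (\<Sum>V\<in>Pow ?S. \<Sum>j\<in>V. c j V + c j (V - {j})) / real n"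
    unfolding cover.simps c_def q_def by (simp add: sum_divide_distrib)
  also have "\<dots> = (\<Sum>j\<in>?S. \<Sum>V\<in>Pow ?S. c j V) / real n"
    by (simp add: sum_Pow_pairs)
  also have "(\<Sum>j\<in>?S. \<Sum>V\<in>Pow ?S. c j V) = (\<Sum>j\<in>?S. up P w ((glauber P w ^^ t) h) (conf y ?S - {#y j#}))"
  proof (intro sum.cong refl)
    fix j assume j: "j \<in> ?S"
    have "(\<Sum>V\<in>Pow ?S. c j V) = (\<Sum>p\<in>P. q j p * (\<Sum>V\<in>Pow ?S. cover P w n h t V (y(j := p))))"
      unfolding c_def by (subst sum.swap) (simp add: sum_distrib_left)
    also have "\<dots> = (\<Sum>p\<in>P. q j p * (glauber P w ^^ t) h (add_mset p (conf y (?S - {j}))))"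
      unfolding Suc.IH using j by (simp add: conf_insert_upd)
    also have "\<dots> = up P w ((glauber P w ^^ t) h) (conf y (?S - {j}))"
      unfolding q_def up_def by (simp add: sum_divide_distrib)
    finally show "(\<Sum>V\<in>Pow ?S. c j V) = up P w ((glauber P w ^^ t) h) (conf y ?S - {#y j#})"
      using j by (simp add: conf_remove[of ?S j])
  qed
  also have "\<dots> = (\<Sum>x\<in>#conf y ?S. up P w ((glauber P w ^^ t) h) (conf y ?S - {#x#}))"
    by (simp add: sum_conf)
  also have "\<dots> / real n = glauber P w ((glauber P w ^^ t) h) (conf y ?S)"
  proof -
    have "conf y ?S \<noteq> {#}" using assms size_conf[of y ?S] by (metis card_lessThan less_irrefl size_empty)
    then show ?thesis unfolding glauber_def[of P w "(glauber P w ^^ t) h"] by simp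
  qed
  finally show ?case by simp
qed

text \<open>Split at the first update, of \<open>j\<close>. If \<open>j\<close> is updated again,
  its present value is forgotten and the bound persists. If not, its value \<open>p\<close> becomes
  final and joins the pinned part \<open>R\<close>; by \<open>conditional_le_marginal\<close> its
  law is at most \<open>card V\<close> times the marginal given \<open>R\<close>, whatever the
  present values on \<open>V - {j}\<close>, and averaging over that marginal restores the
  expectation given \<open>R\<close>. The factors multiply to \<open>fact (card V)\<close>.\<close>

lemma cover_le:
  assumes ex: "exchangeable P w" and h: "\<And>A. 0 \<le> h A" and n: "0 < n"
  shows "y ` {..<n} \<subseteq> P \<Longrightarrow> V \<subseteq> {..<n} \<Longrightarrow> cover P w n h t V y
    \<le> kap n t V * (fact (card V) * (msum P (card V) (\<lambda>A. w (conf y ({..<n} - V) + A) * h (conf y ({..<n} - V) + A))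
        / msum P (card V) (\<lambda>A. w (conf y ({..<n} - V) + A))))"
proof (induction t arbitrary: V y)
  case 0
  show ?case using w[of "conf y {..<n}"] by auto
next
  case (Suc t)
  let ?S = "{..<n}"
  have finV: "finite V" using Suc.prems(2) finite_subset by blast
  define R where "R = conf y (?S - V)"
  define k where "k = card V"
  define N where "N R k = msum P k (\<lambda>A. w (R + A))" for R k
  define H where "H R k = msum P k (\<lambda>A. w (R + A) * h (R + A))" for R k
  have Npos: "0 < N R k" for R k unfolding N_def by (rule msum_pos[OF fin ne w])
  have Hnn: "0 \<le> H R k" for R k unfolding H_def by (rule msum_nonneg) (use w h in \<open>simp add: less_imp_le\<close>)
  define q where "q j p = w (add_mset p (conf y (?S - {j}))) / tot P w (conf y (?S - {j}))" for j p
  have qnn: "0 \<le> q j p" for j p unfolding q_def using w tot_pos' by (simp add: less_imp_le)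
  have y': "(y(j := p)) ` ?S \<subseteq> P" if "p \<in> P" for j p using Suc.prems(1) that by auto
  have 1: "(\<Sum>p\<in>P. q j p * cover P w n h t V (y(j := p))) \<le> kap n t V * (fact k * (H R k / N R k))" if j: "j \<in> V" for j
  proof -
    have R': "conf (y(j := p)) (?S - V) = R" for p unfolding R_def using j by (intro conf_upd) auto
    have "(\<Sum>p\<in>P. q j p * cover P w n h t V (y(j := p))) \<le> (\<Sum>p\<in>P. q j p * (kap n t V * (fact k * (H R k / N R k))))"
    proof (intro sum_mono mult_left_mono qnn)
      fix p assume "p \<in> P"
      from Suc.IH[OF y'[OF this, of j] Suc.prems(2)]
      show "cover P w n h t V (y(j := p)) \<le> kap n t V * (fact k * (H R k / N R k))"
        unfolding R' H_def N_def k_def .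
    qed
    also have "\<dots> = kap n t V * (fact k * (H R k / N R k))"
      unfolding sum_distrib_right[symmetric] q_def sum_w_tot by simp
    finally show ?thesis .
  qed
  have 2: "(\<Sum>p\<in>P. q j p * cover P w n h t (V - {j}) (y(j := p))) \<le> kap n t (V - {j}) * (fact k * (H R k / N R k))" if j: "j \<in> V" for j
  proof -
    obtain k' where k': "k = Suc k'" "card (V - {j}) = k'"
      using j finV unfolding k_def by (metis card_Suc_Diff1)
    have R': "conf (y(j := p)) (?S - (V - {j})) = add_mset p R" for p
    proof -
      have "?S - (V - {j}) - {j} = ?S - V" using j by auto
      then show ?thesis unfolding R_def using j Suc.prems(2) by (subst conf_insert_upd) auto
    qed
    define Z where "Z = conf y (V - {j})"
    have C: "conf y (?S - {j}) = R + Z"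
    proof -
      have "?S - {j} = (?S - V) \<union> (V - {j})" using j Suc.prems(2) by auto
      then show ?thesis unfolding R_def Z_def using finV by (subst conf_union[symmetric]) auto
    qed
    have Zs: "set_mset Z \<subseteq> P" "size Z = k'"
      unfolding Z_def using finV Suc.prems k' by (auto simp: set_conf)
    have qp: "q j p * (H (add_mset p R) k' / N (add_mset p R) k') \<le> real k * (H (add_mset p R) k' / N R k)" if "p \<in> P" for p
    proof -
      have "w (R + add_mset p Z) * N R k \<le> real k * (tot P w (R + Z) * N (add_mset p R) k')"
        using conditional_le_marginal[OF ex w fin that Zs(1), of R] unfolding Zs(2) N_def k'(1) by simp
      then have "q j p \<le> real k * N (add_mset p R) k' / N R k"
        unfolding q_def C using Npos[of R k] tot_pos'[of "R + Z"] by (simp add: field_simps)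
      then have "q j p * (H (add_mset p R) k' / N (add_mset p R) k')
          \<le> real k * N (add_mset p R) k' / N R k * (H (add_mset p R) k' / N (add_mset p R) k')"
        using Hnn Npos by (intro mult_right_mono divide_nonneg_nonneg) (auto simp: less_imp_le)
      then show ?thesis using Npos[of "add_mset p R" k'] by simp
    qed
    have "(\<Sum>p\<in>P. q j p * cover P w n h t (V - {j}) (y(j := p)))
      \<le> (\<Sum>p\<in>P. q j p * (kap n t (V - {j}) * (fact k' * (H (add_mset p R) k' / N (add_mset p R) k'))))"
    proof (intro sum_mono mult_left_mono qnn)
      fix p assume "p \<in> P"
      have V': "V - {j} \<subseteq> ?S" using Suc.prems(2) by auto
      from Suc.IH[OF y'[OF \<open>p \<in> P\<close>, of j] V']
      show "cover P w n h t (V - {j}) (y(j := p)) \<le> kap n t (V - {j}) * (fact k' * (H (add_mset p R) k' / N (add_mset p R) k'))"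
        unfolding R' H_def N_def k'(2) .
    qed
    also have "\<dots> = kap n t (V - {j}) * (fact k' * (\<Sum>p\<in>P. q j p * (H (add_mset p R) k' / N (add_mset p R) k')))"
      by (simp add: sum_distrib_left mult_ac)
    also have "\<dots> \<le> kap n t (V - {j}) * (fact k' * (\<Sum>p\<in>P. real k * (H (add_mset p R) k' / N R k)))"
      by (intro mult_left_mono sum_mono qp kap_nonneg) auto
    also have "(\<Sum>p\<in>P. real k * (H (add_mset p R) k' / N R k)) = real k * (H R k / N R k)"
      unfolding sum_distrib_left[symmetric] sum_divide_distrib[symmetric] by (simp add: H_def k'(1))
    also have "kap n t (V - {j}) * (fact k' * (real k * (H R k / N R k))) = kap n t (V - {j}) * (fact k * (H R k / N R k))"
      by (simp add: k'(1) algebra_simps)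
    finally show ?thesis .
  qed
  have "cover P w n h (Suc t) V y \<le> (\<Sum>j\<in>V. kap n t V * (fact k * (H R k / N R k)) + kap n t (V - {j}) * (fact k * (H R k / N R k))) / real n"
    unfolding cover.simps using 1 2 unfolding q_def by (intro divide_right_mono sum_mono add_mono) auto
  also have "\<dots> = kap n (Suc t) V * (fact k * (H R k / N R k))"
    unfolding kap.simps distrib_right[symmetric] sum_distrib_right[symmetric] by simp
  finally show ?case unfolding R_def H_def N_def k_def .
qed

end

subsection \<open>Mixing of the chain on multisets\<close>

lemma finite_multisets_of_size: "finite P \<Longrightarrow> finite {A. set_mset A \<subseteq> P \<and> size A = n}"
proof -
  assume "finite P"
  have "{A. set_mset A \<subseteq> P \<and> size A = n} \<subseteq> mset ` {xs. set xs \<subseteq> P \<and> length xs = n}"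
  proof
    fix A assume A: "A \<in> {A. set_mset A \<subseteq> P \<and> size A = n}"
    obtain xs where "mset xs = A" using ex_mset by blast
    then show "A \<in> mset ` {xs. set xs \<subseteq> P \<and> length xs = n}" using A by force
  qed
  then show ?thesis using finite_lists_length_eq[OF \<open>finite P\<close>, of n] finite_surj by blast
qed

text \<open>Tuples are collected by their multiset; the \<open>msum\<close> of an indicator is the
  number of orderings, a multinomial coefficient.\<close>

lemma msum_eq_sum:
  assumes "finite P"
  shows "msum P n F = (\<Sum>A | set_mset A \<subseteq> P \<and> size A = n. F A * msum P n (\<lambda>B. if B = A then 1 else 0))"
proof -
  have "msum P n F = msum P n (\<lambda>B. \<Sum>A | set_mset A \<subseteq> P \<and> size A = n. F A * (if B = A then 1 else 0))"
    by (rule msum_cong) (simp add: if_distrib[of "\<lambda>x. _ * x"] sum.delta finite_multisets_of_size[OF assms] cong: if_cong)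
  then show ?thesis by (simp add: msum_sum msum_cmult)
qed

context
  fixes P :: "'p set" and w :: "'p multiset \<Rightarrow> real"
  assumes fin: "finite P" and ne: "P \<noteq> {}" and w: "\<And>A. 0 < w A"
begin

lemma glauber_iterate_linear:
  "(glauber P w ^^ t) (\<lambda>A. a * h A + b * k A) = (\<lambda>A. a * (glauber P w ^^ t) h A + b * (glauber P w ^^ t) k A)"
  by (induction t) (auto simp: glauber_linear)

lemma glauber_iterate_const: "(glauber P w ^^ t) (\<lambda>_. c) = (\<lambda>_. c)"
proof (induction t)
  case (Suc t)
  have "glauber P w (\<lambda>_. c) A = c" for A by (rule glauber_const[where w = w, OF fin ne w])
  then show ?case by (simp add: Suc fun_eq_iff)
qed simp

lemma glauber_iterate_nonneg: "(\<And>A. 0 \<le> h A) \<Longrightarrow> 0 \<le> (glauber P w ^^ t) h A"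
proof (induction t arbitrary: A)
  case (Suc t)
  have "0 \<le> glauber P w ((glauber P w ^^ t) h) A" by (rule glauber_nonneg[OF w Suc.IH[OF Suc.prems]])
  then show ?case by simp
qed simp

lemma glauber_iterate_le_one:
  assumes "\<And>A. h A \<le> 1" shows "(glauber P w ^^ t) h A \<le> 1"
proof -
  have "0 \<le> (glauber P w ^^ t) (\<lambda>A. 1 * 1 + (-1) * h A) A"
    by (rule glauber_iterate_nonneg) (use assms in simp)
  then show ?thesis unfolding glauber_iterate_linear glauber_iterate_const by simp
qed

lemma glauber_iterate_adjoint:
  "msum P (Suc m) (\<lambda>A. w A * (k A * (glauber P w ^^ t) h A)) = msum P (Suc m) (\<lambda>A. w A * ((glauber P w ^^ t) k A * h A))"
proof (induction t arbitrary: k)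
  case (Suc t)
  have "msum P (Suc m) (\<lambda>A. w A * (k A * (glauber P w ^^ Suc t) h A))
    = msum P (Suc m) (\<lambda>A. w A * (glauber P w k A * (glauber P w ^^ t) h A))"
    using glauber_adjoint[where w = w and n = m and k = k and h = "(glauber P w ^^ t) h", OF fin ne w] by (simp del: msum.simps)
  then show ?case unfolding Suc.IH by (simp add: funpow_swap1 del: msum.simps)
qed simp

text \<open>On the event that all players are updated within \<open>t0\<close> steps, the law has a
  density \<open>g\<close> with respect to the Gibbs distribution. Self-adjointness moves the
  remaining \<open>t1\<close> steps from the observable onto \<open>g\<close>, where entropy
  contraction applies. The complementary event has mass \<open>1 - \<alpha>\<close>, estimated by
  \<open>kap_full_ge\<close>.\<close>

theorem glauber_mixing:
  fixes m :: nat
  defines "n \<equiv> Suc m"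
  assumes nd: "neg_dep P w" and ex: "exchangeable P w"
    and y: "y ` {..<n} \<subseteq> P" and h: "\<And>A. 0 \<le> h A" "\<And>A. h A \<le> 1"
    and \<delta>: "0 < \<delta>" "(real m / real n) ^ t1 * ln (fact n + 1) \<le> \<delta>\<^sup>2"
  shows "\<bar>(glauber P w ^^ (t0 + t1)) h (conf y {..<n}) - msum P n (\<lambda>A. w A * h A) / msum P n w\<bar>
    \<le> real n * (real m / real n) ^ t0 + 4 * \<delta>"
proof -
  let ?S = "{..<n}"
  let ?M = "{A. set_mset A \<subseteq> P \<and> size A = n}"
  define Z where "Z = msum P n w"
  define E where "E f = msum P n (\<lambda>A. w A * f A) / Z" for f
  define c where "c A = msum P n (\<lambda>B. if B = A then 1 else 0)" for A
  define G where "G f = cover P w n f t0 ?S y" for f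
  define \<alpha> where "\<alpha> = kap n t0 ?S"
  define k where "k = (glauber P w ^^ t1) h"
  have n: "0 < n" by (simp add: n_def)
  have Z: "0 < Z" unfolding Z_def by (rule msum_pos[OF fin ne w])
  have finM: "finite ?M" by (rule finite_multisets_of_size[OF fin])
  have c0: "0 \<le> c A" for A unfolding c_def by (rule msum_nonneg) simp
  have rep: "msum P n F = (\<Sum>A\<in>?M. F A * c A)" for F
    unfolding c_def by (rule msum_eq_sum[OF fin])
  have a: "0 \<le> \<alpha>" "\<alpha> \<le> 1" "1 - real n * (real m / real n) ^ t0 \<le> \<alpha>"
    using kap_nonneg kap_le_one[OF n] kap_full_ge[OF n, of t0] by (auto simp: \<alpha>_def n_def)
  have Gnn: "0 \<le> G f" if "\<And>A. 0 \<le> f A" for f unfolding G_def by (rule cover_nonneg[where w = w, OF fin ne w that])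
  have G_le: "G f \<le> fact n * E f" if f: "\<And>A. 0 \<le> f A" for f
  proof -
    have "G f \<le> \<alpha> * (fact n * E f)"
      using cover_le[where w = w and t = t0, OF fin ne w ex f n y subset_refl] unfolding G_def \<alpha>_def E_def Z_def by (simp add: conf_def)
    also have "\<dots> \<le> 1 * (fact n * E f)"
      using a f w Z unfolding E_def
      by (intro mult_right_mono mult_nonneg_nonneg divide_nonneg_nonneg msum_nonneg) (auto simp: less_imp_le)
    finally show ?thesis by simp
  qed
  \<comment> \<open>The density is read off from indicator functions. Where \<open>c A = 0\<close>,
    that is where \<open>A\<close> has no ordering over \<open>P\<close>, division by zero gives the
    value 0.\<close>
  define g where "g A = G (\<lambda>B. if B = A then 1 else 0) * Z / (w A * c A)" for A
  have E1: "E (\<lambda>B. if B = A then 1 else 0) = w A * c A / Z" for A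
  proof -
    have "msum P n (\<lambda>B. w B * (if B = A then 1 else 0)) = msum P n (\<lambda>B. w A * (if B = A then 1 else 0))"
      by (rule msum_cong) simp
    then show ?thesis unfolding E_def c_def by (simp add: msum_cmult)
  qed
  have G1: "G (\<lambda>B. if B = A then 1 else 0) \<le> fact n * (w A * c A / Z)" "0 \<le> G (\<lambda>B. if B = A then 1 else 0)" for A
    unfolding E1[symmetric] by (rule G_le, simp) (rule Gnn, simp)
  have g0: "0 \<le> g A" for A
    unfolding g_def using G1(2) c0 w Z by (intro divide_nonneg_nonneg mult_nonneg_nonneg) (auto simp: less_imp_le)
  have g_le: "g A \<le> fact n" for A
  proof (cases "c A = 0")
    case False
    then have "0 < c A" using c0[of A] by simp
    then show ?thesis
      using G1[of A] Z w[of A] unfolding g_def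
      by (simp add: field_simps)
  qed (simp add: g_def)
  have g_c: "w A * g A * c A = G (\<lambda>B. if B = A then 1 else 0) * Z" for A
  proof (cases "c A = 0")
    case True
    then have "G (\<lambda>B. if B = A then 1 else 0) = 0"
      using G1[of A] by simp
    then show ?thesis using True by simp
  qed (use w[of A] in \<open>simp add: g_def\<close>)
  have G_density: "G f = msum P n (\<lambda>A. w A * (g A * f A)) / Z" for f
  proof -
    have "G f = G (\<lambda>B. \<Sum>A\<in>?M. f A * (if B = A then 1 else 0))"
      unfolding G_def
      by (rule cover_cong[where w = w, OF fin ne w _ y subset_refl])
        (simp add: if_distrib[of "\<lambda>x. _ * x"] sum.delta finM cong: if_cong)
    also have "\<dots> = (\<Sum>A\<in>?M. f A * G (\<lambda>B. if B = A then 1 else 0))"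
      unfolding G_def by (rule cover_sum[where w = w, OF fin ne w finM])
    also have "\<dots> = (\<Sum>A\<in>?M. f A * (w A * g A * c A / Z))"
      unfolding g_c using Z by simp
    also have "\<dots> = msum P n (\<lambda>A. w A * (g A * f A)) / Z"
      unfolding rep by (simp add: sum_divide_distrib mult_ac)
    finally show ?thesis .
  qed
  have g_mean: "msum P n (\<lambda>A. w A * g A) = \<alpha> * Z"
    using G_density[of "\<lambda>_. 1"] Z cover_one[where w = w and n = n and t = t0 and V = ?S and y = y, OF fin ne w] unfolding G_def \<alpha>_def by simp
  \<comment> \<open>\<open>g\<close> has mean \<open>\<alpha>\<close> rather than 1 and may vanish,
    while the entropy bounds need a normalised positive density. Mixing with a constant repairs both
    and doubles the final error, from \<open>2 * \<delta>\<close> to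
    \<open>4 * \<delta>\<close>.\<close>
  define g' where "g' = (\<lambda>A. (1/2) * g A + ((2 - \<alpha>) / 2) * 1)"
  have g'_pos: "0 < g' A" for A unfolding g'_def using g0[of A] a(2) by argo
  have g'_le: "g' A \<le> fact n + 1" for A
  proof -
    have "(1::real) \<le> fact n" by simp
    then show ?thesis unfolding g'_def using g_le[of A] a(1) by argo
  qed
  have g'_mean: "msum P n (\<lambda>A. w A * g' A) = msum P n w"
  proof -
    have "msum P n (\<lambda>A. w A * g' A) = msum P n (\<lambda>A. (1/2) * (w A * g A) + ((2 - \<alpha>) / 2) * w A)"
      unfolding g'_def by (simp add: algebra_simps)
    also have "\<dots> = (1/2) * (\<alpha> * Z) + ((2 - \<alpha>) / 2) * Z"
      unfolding msum_add msum_cmult g_mean Z_def ..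
    also have "\<dots> = Z" by (simp add: field_simps)
    finally show ?thesis by (simp add: Z_def)
  qed
  have close: "msum P n (\<lambda>A. w A * \<bar>(glauber P w ^^ t1) g' A - 1\<bar>) \<le> 2 * \<delta> * Z"
    unfolding n_def Z_def
  proof (rule glauber_iterate_close[OF fin ne nd g'_pos])
    show "msum P (Suc m) (\<lambda>A. w A * g' A) = msum P (Suc m) w" using g'_mean by (simp only: n_def)
    show "g' A \<le> fact n + 1" for A by (rule g'_le)
    show "0 < \<delta>" "(real m / real (Suc m)) ^ t1 * ln (fact n + 1) \<le> \<delta>\<^sup>2" using \<delta> by (simp_all only: n_def)
  qed
  have gl_g: "(glauber P w ^^ t1) g A = 2 * (glauber P w ^^ t1) g' A - (2 - \<alpha>)" for A
    unfolding g'_def glauber_iterate_linear glauber_iterate_const by (simp add: field_simps)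
  have main: "\<bar>G k - \<alpha> * E h\<bar> \<le> 4 * \<delta>"
  proof -
    have "G k = msum P n (\<lambda>A. w A * ((glauber P w ^^ t1) g A * h A)) / Z"
      unfolding G_density k_def n_def glauber_iterate_adjoint ..
    then have "G k - \<alpha> * E h = (msum P n (\<lambda>A. w A * ((glauber P w ^^ t1) g A * h A)) - \<alpha> * msum P n (\<lambda>A. w A * h A)) / Z"
      by (simp add: E_def diff_divide_distrib)
    also have "\<dots> = msum P n (\<lambda>A. 2 * (w A * (((glauber P w ^^ t1) g' A - 1) * h A))) / Z"
      unfolding msum_cmult[symmetric] msum_diff[symmetric] gl_g by (simp add: algebra_simps)
    finally have eq: "G k - \<alpha> * E h = 2 * msum P n (\<lambda>A. w A * (((glauber P w ^^ t1) g' A - 1) * h A)) / Z"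
      unfolding msum_cmult .
    let ?d = "\<lambda>A. (glauber P w ^^ t1) g' A - 1"
    have b: "\<bar>w A * (?d A * h A)\<bar> \<le> w A * \<bar>?d A\<bar>" for A
      using h[of A] w[of A] by (simp add: abs_mult mult_left_le)
    have "msum P n (\<lambda>A. w A * (?d A * h A)) \<le> msum P n (\<lambda>A. w A * \<bar>?d A\<bar>)"
      by (rule msum_mono) (use b in \<open>blast intro: abs_le_D1\<close>)
    moreover have "msum P n (\<lambda>A. (-1) * (w A * (?d A * h A))) \<le> msum P n (\<lambda>A. w A * \<bar>?d A\<bar>)"
      by (rule msum_mono) (use b in \<open>force intro: abs_le_D2\<close>)
    ultimately have "\<bar>msum P n (\<lambda>A. w A * (?d A * h A))\<bar> \<le> 2 * \<delta> * Z"
      using close unfolding msum_cmult by linarith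
    then show ?thesis unfolding eq using Z by (simp add: field_simps abs_mult)
  qed
  have tot: "(glauber P w ^^ (t0 + t1)) h (conf y ?S) = G k + (\<Sum>V\<in>Pow ?S - {?S}. cover P w n k t0 V y)"
  proof -
    have "(glauber P w ^^ (t0 + t1)) h (conf y ?S) = (\<Sum>V\<in>Pow ?S. cover P w n k t0 V y)"
      unfolding sum_cover[where w = w, OF fin ne w n] k_def by (simp add: funpow_add)
    also have "\<dots> = G k + (\<Sum>V\<in>Pow ?S - {?S}. cover P w n k t0 V y)"
      unfolding G_def by (intro sum.remove) auto
    finally show ?thesis .
  qed
  define J where "J = (\<Sum>V\<in>Pow ?S - {?S}. cover P w n k t0 V y)"
  have k: "0 \<le> k A" "k A \<le> 1" for A
    unfolding k_def using glauber_iterate_nonneg[of h] glauber_iterate_le_one[of h] h by auto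
  have J0: "0 \<le> J" unfolding J_def by (intro sum_nonneg cover_nonneg[where w = w, OF fin ne w] k)
  have J1: "J \<le> 1 - \<alpha>"
  proof -
    have "J \<le> (\<Sum>V\<in>Pow ?S - {?S}. kap n t0 V)"
      unfolding J_def by (intro sum_mono cover_le_kap[where w = w, OF fin ne w] k)
    moreover have "(\<Sum>V\<in>Pow ?S. kap n t0 V) = \<alpha> + (\<Sum>V\<in>Pow ?S - {?S}. kap n t0 V)"
      unfolding \<alpha>_def by (intro sum.remove) auto
    moreover have "(\<Sum>V\<in>Pow ?S. kap n t0 V) = 1" using n sum_kap[of ?S n t0] by simp
    ultimately show ?thesis by linarith
  qed
  have Eh: "0 \<le> E h" "E h \<le> 1"
  proof -
    show "0 \<le> E h" unfolding E_def using h w Z by (intro divide_nonneg_nonneg msum_nonneg) (auto simp: less_imp_le)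
    have "msum P n (\<lambda>A. w A * h A) \<le> Z" unfolding Z_def
      by (rule msum_mono) (use h w in \<open>simp add: mult_left_le less_imp_le\<close>)
    then show "E h \<le> 1" unfolding E_def using Z by simp
  qed
  have "(1 - \<alpha>) * E h \<le> (1 - \<alpha>) * 1" "0 \<le> (1 - \<alpha>) * E h"
    using a Eh by (intro mult_left_mono, auto)
  moreover have "E h = \<alpha> * E h + (1 - \<alpha>) * E h" by (simp add: algebra_simps)
  ultimately have "\<bar>G k + J - E h\<bar> \<le> real n * (real m / real n) ^ t0 + 4 * \<delta>"
    using main J0 J1 a(3) by argo
  then show ?thesis unfolding tot J_def[symmetric] E_def Z_def .
qed

end

subsection \<open>The base-exchange chain\<close>

text \<open>Set to zero off the network because monotonicity is assumed on its arcs only, whereas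
  the lemmas on convex costs ask for convexity at every \<open>e\<close>.\<close>

definition cumcost :: "'e ep \<Rightarrow> ('e \<Rightarrow> nat \<Rightarrow> rat) \<Rightarrow> real \<Rightarrow> 'e \<Rightarrow> nat \<Rightarrow> real" where
  "cumcost G c T e k = (if e \<in> arcs G then T * (\<Sum>i=1..k. real_of_rat (c e i)) else 0)"

definition game_weight :: "'e ep \<Rightarrow> ('e \<Rightarrow> nat \<Rightarrow> rat) \<Rightarrow> real \<Rightarrow> 'e set multiset \<Rightarrow> real" where
  "game_weight G c T = ep_weight G (cumcost G c T)"

lemma game_weight_pos: "0 < game_weight G c T A"
  by (simp add: game_weight_def ep_weight_def)

lemma cumcost_convex:
  assumes "\<forall>e\<in>arcs G. mono (c e)" "0 \<le> T"
  shows "cumcost G c T e (Suc k) - cumcost G c T e k \<le> cumcost G c T e (Suc (Suc k)) - cumcost G c T e (Suc k)"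
proof (cases "e \<in> arcs G")
  case True
  then have "c e (Suc k) \<le> c e (Suc (Suc k))" using assms(1) by (auto simp: mono_def)
  then have "T * real_of_rat (c e (Suc k)) \<le> T * real_of_rat (c e (Suc (Suc k)))"
    using assms(2) by (intro mult_left_mono) (auto simp: of_rat_less_eq)
  then show ?thesis using True by (simp add: cumcost_def algebra_simps)
qed (simp add: cumcost_def)

lemma load_eq_mload: "load n s e = mload e (conf s {..<n})"
proof -
  have "{i. i < n \<and> e \<in> s i} = {i \<in> {..<n}. e \<in> s i}" by auto
  then show ?thesis
    by (simp add: load_def mload_def conf_def filter_mset_image_mset filter_mset_mset_set)
qed

lemma zload_eq_count: "zload n s p = count (conf s {..<n}) p"
proof -
  have "{i. i < n \<and> s i = p} = {i \<in> {..<n}. s i = p}" by auto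
  then show ?thesis
    by (simp add: zload_def conf_def count_image_mset vimage_def Int_def conj_commute)
qed

lemma exp_potential: "exp (- T * potential G n c s) = game_weight G c T (conf s {..<n})"
proof -
  have "T * potential G n c s = conv_cost G (cumcost G c T) (conf s {..<n})"
    unfolding potential_def conv_cost_def load_eq_mload sum_distrib_left
    by (intro sum.cong refl) (simp add: cumcost_def sum_distrib_left)
  then show ?thesis by (simp add: game_weight_def ep_weight_def)
qed

lemma sum_profiles:
  "(\<Sum>s\<in>profiles G n. F (conf s {..<n})) = msum (paths G) n F"
proof (induction n arbitrary: F)
  case 0
  show ?case by (simp add: profiles_def conf_def)
next
  case (Suc n)
  have eq: "profiles G (Suc n) = (\<lambda>(p, s). s(n := p)) ` (paths G \<times> profiles G n)"
    unfolding profiles_def lessThan_Suc by (rule PiE_insert_eq)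
  have inj: "inj_on (\<lambda>(p, s). s(n := p)) (paths G \<times> profiles G n)"
    unfolding profiles_def by (rule inj_combinator) simp
  have cf: "conf (s(n := p)) {..<Suc n} = add_mset p (conf s {..<n})" for s p
  proof -
    have "{..<Suc n} - {n} = {..<n}" by auto
    then show ?thesis by (subst conf_insert_upd) auto
  qed
  have "(\<Sum>s\<in>profiles G (Suc n). F (conf s {..<Suc n})) = (\<Sum>(p, s)\<in>paths G \<times> profiles G n. F (add_mset p (conf s {..<n})))"
    unfolding eq sum.reindex[OF inj] by (intro sum.cong refl) (auto simp: cf)
  also have "\<dots> = (\<Sum>p\<in>paths G. \<Sum>s\<in>profiles G n. F (add_mset p (conf s {..<n})))"
    by (rule sum.cartesian_product[symmetric])
  also have "\<dots> = msum (paths G) (Suc n) F"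
    unfolding msum.simps by (intro sum.cong refl Suc.IH)
  finally show ?case .
qed

lemma finite_profiles: "finite (profiles G n)"
  unfolding profiles_def by (intro finite_PiE finite_paths) simp

lemma conf_profile: "s \<in> profiles G n \<Longrightarrow> set_mset (conf s {..<n}) \<subseteq> paths G"
  by (auto simp: profiles_def set_conf)

lemma ex_conf:
  assumes "set_mset A \<subseteq> P" "size A = n"
  shows "\<exists>y. y ` {..<n} \<subseteq> P \<and> conf y {..<n} = A"
proof -
  obtain xs where xs: "mset xs = A" using ex_mset by blast
  then have len: "length xs = n" using assms(2) by auto
  have "A = mset (map ((!) xs) [0..<n])" using xs len map_nth by metis
  then have "conf ((!) xs) {..<n} = A" by (simp add: conf_def lessThan_atLeast0)
  moreover from this have "(!) xs ` {..<n} \<subseteq> P" using assms(1) set_conf[of "{..<n}" "(!) xs"] by simp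
  ultimately show ?thesis by blast
qed

lemma ex_profile_conf:
  assumes "set_mset A \<subseteq> paths G" "size A = n"
  shows "\<exists>s\<in>profiles G n. conf s {..<n} = A"
proof -
  obtain y where y: "y ` {..<n} \<subseteq> paths G" "conf y {..<n} = A" using ex_conf[OF assms] by blast
  have "restrict y {..<n} \<in> profiles G n" using y(1) by (auto simp: profiles_def)
  moreover have "conf (restrict y {..<n}) {..<n} = conf y {..<n}"
    unfolding conf_def by (intro image_mset_cong) simp
  ultimately show ?thesis using y(2) by auto
qed

section \<open>Bases and their multisets of paths\<close>

definition path_mset :: "('e set \<times> nat) set \<Rightarrow> 'e set multiset" where
  "path_mset B = image_mset fst (mset_set B)"

lemma finite_Eprime: "finite (Eprime G n)"
  by (simp add: Eprime_def finite_paths)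

lemma finite_bases: "finite (bases G n)"
  unfolding bases_def using finite_Eprime[of G n] by simp

lemma count_path_mset: "finite B \<Longrightarrow> count (path_mset B) p = alphaB B p"
proof -
  assume "finite B"
  have "{x \<in> B. fst x = p} = Pair p ` {j. (p, j) \<in> B}" by force
  then have "card {x \<in> B. fst x = p} = alphaB B p"
    unfolding alphaB_def by (simp add: card_image inj_on_def)
  then show ?thesis using \<open>finite B\<close>
    by (simp add: path_mset_def count_image_mset vimage_def Int_def conj_commute)
qed

lemma path_mset_base:
  assumes "B \<subseteq> Eprime G n" shows "set_mset (path_mset B) \<subseteq> paths G" "size (path_mset B) = card B"
  using assms finite_subset[OF assms finite_Eprime] by (auto simp: path_mset_def Eprime_def)

lemma Sprof_alphaB:
  assumes "B \<subseteq> Eprime G n"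
  shows "Sprof G n (alphaB B) = {s \<in> profiles G n. conf s {..<n} = path_mset B}"
proof -
  have fB: "finite B" using assms finite_Eprime finite_subset by blast
  have "(\<forall>p\<in>paths G. zload n s p = alphaB B p) \<longleftrightarrow> conf s {..<n} = path_mset B" if "s \<in> profiles G n" for s
  proof
    assume L: "\<forall>p\<in>paths G. zload n s p = alphaB B p"
    show "conf s {..<n} = path_mset B"
    proof (rule multiset_eqI)
      fix p
      show "count (conf s {..<n}) p = count (path_mset B) p"
      proof (cases "p \<in> paths G")
        case True
        then show ?thesis using L fB by (simp add: zload_eq_count count_path_mset)
      next
        case False
        then have "p \<notin># conf s {..<n}" "p \<notin># path_mset B"
          using conf_profile[OF that] path_mset_base(1)[OF assms] by auto
        then show ?thesis by (simp add: not_in_iff)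
      qed
    qed
  next
    assume "conf s {..<n} = path_mset B"
    then show "\<forall>p\<in>paths G. zload n s p = alphaB B p"
      using fB by (simp add: zload_eq_count count_path_mset)
  qed
  then show ?thesis unfolding Sprof_def by blast
qed

definition base_factor :: "'e ep \<Rightarrow> nat \<Rightarrow> 'e set multiset \<Rightarrow> real" where
  "base_factor G n A = fact n * (\<Prod>p\<in>paths G. inverse (real (n choose count A p)) / fact (count A p))"

text \<open>The profile chosen in \<open>potential_lp\<close> is arbitrary, but its multiset is
  forced by the load profile and determines the potential; such a profile exists because a base has
  exactly \<open>n\<close> elements.\<close>

lemma weight_eq:
  assumes "B \<in> bases G n"
  shows "weight G n c T B = base_factor G n (path_mset B) * game_weight G c T (path_mset B)"
proof -
  have B: "B \<subseteq> Eprime G n" "card B = n" using assms by (auto simp: bases_def)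
  then have fB: "finite B" using finite_Eprime finite_subset by blast
  have "Sprof G n (alphaB B) \<noteq> {}"
    using ex_profile_conf[of "path_mset B" G n] path_mset_base[OF B(1)] B(2) unfolding Sprof_alphaB[OF B(1)] by blast
  then have "(SOME s. s \<in> Sprof G n (alphaB B)) \<in> Sprof G n (alphaB B)" by (rule some_in_eq[THEN iffD2])
  then have "conf (SOME s. s \<in> Sprof G n (alphaB B)) {..<n} = path_mset B"
    unfolding Sprof_alphaB[OF B(1)] by blast
  then have "exp (- T * potential_lp G n c (alphaB B)) = game_weight G c T (path_mset B)"
    unfolding potential_lp_def exp_potential by simp
  then show ?thesis
    unfolding weight_def base_factor_def
    by (simp add: count_path_mset[OF fB] prod.distrib prod_inversef[symmetric] divide_inverse mult_ac)
qed

lemma base_factor_pos: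
  assumes "size A \<le> n" shows "0 < base_factor G n A"
proof -
  have "count A p \<le> n" for p using assms count_le_size[of A p] by linarith
  then show ?thesis unfolding base_factor_def
    by (intro mult_pos_pos prod_pos divide_pos_pos) (auto simp: zero_less_binomial)
qed

text \<open>Since \<open>inverse (n choose b) / fact b\<close> equals
  \<open>fact (n - b) / fact n\<close>, adding a path divides the factor by the number of its free
  copies.\<close>

lemma base_factor_add_mset:
  assumes "size K < n" "p \<in> paths G"
  shows "real (n - count K p) * base_factor G n (add_mset p K) = base_factor G n K"
proof -
  define \<phi> where "\<phi> b = inverse (real (n choose b)) / fact b" for b
  have phi: "\<phi> b = fact (n - b) / fact n" if "b \<le> n" for b
    unfolding \<phi>_def using binomial_fact[OF that, where 'a = real] by simp
  define b where "b = count K p"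
  have b: "b < n" unfolding b_def using assms(1) count_le_size[of K p] by linarith
  then obtain d where d: "n - b = Suc d" "n - Suc b = d" by (metis Suc_diff_Suc)
  have step: "real (n - b) * \<phi> (Suc b) = \<phi> b"
    using b phi[of b] phi[of "Suc b"] d by (simp del: of_nat_diff)
  have "(\<Prod>q\<in>paths G - {p}. \<phi> (count (add_mset p K) q)) = (\<Prod>q\<in>paths G - {p}. \<phi> (count K q))"
    by (intro prod.cong refl) auto
  then have "(\<Prod>q\<in>paths G. \<phi> (count (add_mset p K) q)) = \<phi> (Suc b) * (\<Prod>q\<in>paths G - {p}. \<phi> (count K q))"
    using assms(2) by (subst prod.remove[OF finite_paths]) (auto simp: b_def)
  moreover have "(\<Prod>q\<in>paths G. \<phi> (count K q)) = \<phi> b * (\<Prod>q\<in>paths G - {p}. \<phi> (count K q))"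
    using assms(2) by (subst prod.remove[OF finite_paths]) (auto simp: b_def)
  ultimately show ?thesis
    unfolding base_factor_def \<phi>_def[symmetric] b_def[symmetric] step[symmetric] by (simp add: mult_ac del: of_nat_diff)
qed

text \<open>A base above \<open>K\<close> adds one free copy \<open>(p, j)\<close>, and the number
  of these for given \<open>p\<close> is absorbed by \<open>base_factor_add_mset\<close>. The factor
  left over depends on \<open>K\<close> only and cancels in the transition probabilities.\<close>

lemma sum_bases_above:
  assumes K: "K \<subseteq> Eprime G n" and card: "Suc (card K) = n"
  shows "(\<Sum>B\<in>{B\<in>bases G n. K \<subseteq> B}. weight G n c T B * H (path_mset B))
    = base_factor G n (path_mset K) * (\<Sum>p\<in>paths G. game_weight G c T (add_mset p (path_mset K)) * H (add_mset p (path_mset K)))"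
proof -
  have fK: "finite K" using K finite_Eprime finite_subset by blast
  define F where "F A = base_factor G n A * game_weight G c T A * H A" for A
  have eq: "{B\<in>bases G n. K \<subseteq> B} = (\<lambda>x. insert x K) ` (Eprime G n - K)"
  proof
    show "{B\<in>bases G n. K \<subseteq> B} \<subseteq> (\<lambda>x. insert x K) ` (Eprime G n - K)"
    proof
      fix B assume "B \<in> {B\<in>bases G n. K \<subseteq> B}"
      then have B: "B \<subseteq> Eprime G n" "card B = n" "K \<subseteq> B" by (auto simp: bases_def)
      then have "finite B" using finite_Eprime finite_subset by blast
      then have "card (B - K) = 1" using B card fK by (simp add: card_Diff_subset)
      then obtain x where "B - K = {x}" by (rule card_1_singletonE)
      then have "B = insert x K" "x \<in> Eprime G n - K" using B by auto
      then show "B \<in> (\<lambda>x. insert x K) ` (Eprime G n - K)" by blast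
    qed
    show "(\<lambda>x. insert x K) ` (Eprime G n - K) \<subseteq> {B\<in>bases G n. K \<subseteq> B}"
      using K card fK by (auto simp: bases_def)
  qed
  have inj: "inj_on (\<lambda>x. insert x K) (Eprime G n - K)"
    by (rule inj_onI) (metis DiffD2 insertE insertI1)
  have pm: "path_mset (insert x K) = add_mset (fst x) (path_mset K)" if "x \<notin> K" for x
    using that fK by (simp add: path_mset_def)
  have "(\<Sum>B\<in>{B\<in>bases G n. K \<subseteq> B}. weight G n c T B * H (path_mset B)) = (\<Sum>B\<in>{B\<in>bases G n. K \<subseteq> B}. F (path_mset B))"
    by (intro sum.cong refl) (simp add: weight_eq F_def)
  also have "\<dots> = (\<Sum>x\<in>Eprime G n - K. F (add_mset (fst x) (path_mset K)))"
    unfolding eq sum.reindex[OF inj] by (intro sum.cong refl) (simp add: pm)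
  also have "Eprime G n - K = Sigma (paths G) (\<lambda>p. {1..n} - {j. (p, j) \<in> K})"
    by (auto simp: Eprime_def)
  also have "(\<Sum>x\<in>Sigma (paths G) (\<lambda>p. {1..n} - {j. (p, j) \<in> K}). F (add_mset (fst x) (path_mset K)))
     = (\<Sum>p\<in>paths G. \<Sum>j\<in>{1..n} - {j. (p, j) \<in> K}. F (add_mset p (path_mset K)))"
    by (subst sum.Sigma) (auto simp: finite_paths split_def)
  also have "\<dots> = (\<Sum>p\<in>paths G. real (n - count (path_mset K) p) * F (add_mset p (path_mset K)))"
  proof (intro sum.cong refl)
    fix p
    have "{j. (p, j) \<in> K} \<subseteq> {1..n}" using K by (auto simp: Eprime_def)
    then have "card ({1..n} - {j. (p, j) \<in> K}) = n - alphaB K p"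
      unfolding alphaB_def by (subst card_Diff_subset) (auto intro: finite_subset)
    then show "(\<Sum>j\<in>{1..n} - {j. (p, j) \<in> K}. F (add_mset p (path_mset K))) = real (n - count (path_mset K) p) * F (add_mset p (path_mset K))"
      by (simp add: count_path_mset[OF fK] del: of_nat_diff)
  qed
  also have "\<dots> = (\<Sum>p\<in>paths G. base_factor G n (path_mset K) * (game_weight G c T (add_mset p (path_mset K)) * H (add_mset p (path_mset K))))"
  proof (intro sum.cong refl)
    fix p assume p: "p \<in> paths G"
    have "size (path_mset K) < n" using path_mset_base(2)[OF K] card by simp
    from base_factor_add_mset[OF this p]
    show "real (n - count (path_mset K) p) * F (add_mset p (path_mset K))
       = base_factor G n (path_mset K) * (game_weight G c T (add_mset p (path_mset K)) * H (add_mset p (path_mset K)))"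
      unfolding F_def by (metis mult.assoc)
  qed
  finally show ?thesis by (simp add: sum_distrib_left)
qed

text \<open>The chain on bases lumps: applied to a function of the multiset of paths, it gives such
  a function again, with Glauber dynamics as the quotient chain.\<close>

lemma sum_trans:
  assumes B: "B \<in> bases G n" and n: "1 \<le> n"
  shows "(\<Sum>B'\<in>bases G n. trans G n c T B B' * H (path_mset B')) = glauber (paths G) (game_weight G c T) H (path_mset B)"
proof -
  let ?w = "game_weight G c T"
  have BE: "B \<subseteq> Eprime G n" "card B = n" using B by (auto simp: bases_def)
  then have fB: "finite B" using finite_Eprime finite_subset by blast
  have step: "(\<Sum>B'\<in>bases G n. (if B' \<in> bases G n \<and> B - {e} \<subseteq> B'
         then weight G n c T B' / (\<Sum>B''\<in>{B''\<in>bases G n. B - {e} \<subseteq> B''}. weight G n c T B'') else 0) * H (path_mset B'))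
     = up (paths G) ?w H (path_mset B - {#fst e#})" if e: "e \<in> B" for e
  proof -
    let ?K = "B - {e}"
    have K: "?K \<subseteq> Eprime G n" "Suc (card ?K) = n" using BE fB e n by (auto simp: card_Suc_Diff1)
    have pm: "path_mset ?K = path_mset B - {#fst e#}"
      using fB e by (simp add: path_mset_def mset_set_Diff image_mset_Diff)
    have "0 < base_factor G n (path_mset ?K)"
      by (rule base_factor_pos) (use path_mset_base(2)[OF K(1)] K(2) in simp)
    moreover have "(\<Sum>B''\<in>{B''\<in>bases G n. ?K \<subseteq> B''}. weight G n c T B'')
        = base_factor G n (path_mset ?K) * tot (paths G) ?w (path_mset ?K)"
      using sum_bases_above[OF K, where H = "\<lambda>_. 1" and c = c and T = T] by (simp add: tot_def)
    moreover have "(\<Sum>B'\<in>bases G n. (if B' \<in> bases G n \<and> ?K \<subseteq> B'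
         then weight G n c T B' / (\<Sum>B''\<in>{B''\<in>bases G n. ?K \<subseteq> B''}. weight G n c T B'') else 0) * H (path_mset B'))
      = (\<Sum>B'\<in>{B'\<in>bases G n. ?K \<subseteq> B'}. weight G n c T B' * H (path_mset B')) / (\<Sum>B''\<in>{B''\<in>bases G n. ?K \<subseteq> B''}. weight G n c T B'')"
      unfolding sum_divide_distrib sum.inter_filter[OF finite_bases] by (intro sum.cong refl) auto
    ultimately show ?thesis
      unfolding sum_bases_above[OF K] pm[symmetric] up_def by simp
  qed
  have "(\<Sum>B'\<in>bases G n. trans G n c T B B' * H (path_mset B'))
    = (\<Sum>e\<in>B. \<Sum>B'\<in>bases G n. (1 / real n) * ((if B' \<in> bases G n \<and> B - {e} \<subseteq> B'
         then weight G n c T B' / (\<Sum>B''\<in>{B''\<in>bases G n. B - {e} \<subseteq> B''}. weight G n c T B'') else 0) * H (path_mset B')))"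
    unfolding trans_def BE(2) sum_distrib_right mult.assoc by (rule sum.swap)
  also have "\<dots> = (\<Sum>e\<in>B. up (paths G) ?w H (path_mset B - {#fst e#})) / real n"
    unfolding sum_distrib_left[symmetric] by (subst sum.cong[OF refl step]) auto
  also have "(\<Sum>e\<in>B. up (paths G) ?w H (path_mset B - {#fst e#})) = (\<Sum>x\<in>#path_mset B. up (paths G) ?w H (path_mset B - {#x#}))"
    by (simp add: path_mset_def sum_unfold_sum_mset multiset.map_comp comp_def)
  also have "\<dots> / real n = glauber (paths G) ?w H (path_mset B)"
  proof -
    have "size (path_mset B) = n" using path_mset_base(2)[OF BE(1)] BE(2) by simp
    then show ?thesis using n by (auto simp: glauber_def)
  qed
  finally show ?thesis .
qed

lemma sum_chain_dist:
  assumes B0: "B0 \<in> bases G n" and n: "1 \<le> n"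
  shows "(\<Sum>B\<in>bases G n. chain_dist G n c T B0 t B * H (path_mset B))
    = (glauber (paths G) (game_weight G c T) ^^ t) H (path_mset B0)"
proof (induction t arbitrary: H)
  case 0
  have "(\<Sum>B\<in>bases G n. chain_dist G n c T B0 0 B * H (path_mset B)) = (\<Sum>B\<in>{B0}. chain_dist G n c T B0 0 B * H (path_mset B))"
    using B0 finite_bases by (intro sum.mono_neutral_right) auto
  then show ?case by simp
next
  case (Suc t)
  have "(\<Sum>B'\<in>bases G n. chain_dist G n c T B0 (Suc t) B' * H (path_mset B'))
    = (\<Sum>B\<in>bases G n. chain_dist G n c T B0 t B * (\<Sum>B'\<in>bases G n. trans G n c T B B' * H (path_mset B')))"
    unfolding chain_dist.simps sum_distrib_right sum_distrib_left by (subst sum.swap) (simp add: mult.assoc)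
  also have "\<dots> = (\<Sum>B\<in>bases G n. chain_dist G n c T B0 t B * glauber (paths G) (game_weight G c T) H (path_mset B))"
    by (intro sum.cong refl arg_cong2[of _ _ _ _ "(*)"] sum_trans n)
  finally show ?case unfolding Suc.IH by (simp add: funpow_swap1)
qed

text \<open>Both laws depend on a profile only through its multiset and have equal mass, so the
  distance is attained at the indicator \<open>k\<close> of the multisets on which the output law is
  at least the Gibbs law. It is thus enough to bound expectations of test functions with values
  between 0 and 1.\<close>

lemma dTV_le:
  assumes B0: "B0 \<in> bases G n" and n: "1 \<le> n"
    and bound: "\<And>h. (\<And>A. 0 \<le> h A) \<Longrightarrow> (\<And>A. h A \<le> 1) \<Longrightarrow>
      \<bar>(glauber (paths G) (game_weight G c T) ^^ t) h (path_mset B0)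
        - msum (paths G) n (\<lambda>A. game_weight G c T A * h A) / msum (paths G) n (game_weight G c T)\<bar> \<le> b"
  shows "dTV (profiles G n) (output_dist G n c T B0 t) (gibbs G n c T) \<le> b"
proof -
  let ?w = "game_weight G c T"
  let ?X = "profiles G n"
  let ?A = "\<lambda>s. conf s {..<n}"
  define N where "N A = real (card {s \<in> ?X. ?A s = A})" for A
  define out where "out A = (\<Sum>B\<in>bases G n. chain_dist G n c T B0 t B * (if A = path_mset B then 1 / N (path_mset B) else 0))" for A
  define gb where "gb A = ?w A / msum (paths G) n ?w" for A
  have out: "output_dist G n c T B0 t s = out (?A s)" if "s \<in> ?X" for s
    unfolding output_dist_def out_def N_def
    by (intro sum.cong refl) (auto simp: bases_def Sprof_alphaB that)
  have gb: "gibbs G n c T s = gb (?A s)" for s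
    unfolding gibbs_def gb_def exp_potential sum_profiles ..
  have Npos: "0 < N (path_mset B)" if "B \<in> bases G n" for B
  proof -
    have "{s \<in> ?X. ?A s = path_mset B} \<noteq> {}"
      using ex_profile_conf[of "path_mset B" G n] path_mset_base[of B G n] that by (auto simp: bases_def)
    then show ?thesis unfolding N_def using finite_profiles[of G n] by (simp add: card_gt_0_iff)
  qed
  have sum_out: "(\<Sum>s\<in>?X. k (?A s) * out (?A s)) = (glauber (paths G) ?w ^^ t) k (path_mset B0)" for k
  proof -
    have "(\<Sum>s\<in>?X. k (?A s) * out (?A s))
      = (\<Sum>B\<in>bases G n. chain_dist G n c T B0 t B * (\<Sum>s\<in>?X. if ?A s = path_mset B then k (path_mset B) / N (path_mset B) else 0))"
      unfolding out_def sum_distrib_left by (subst sum.swap) (auto intro!: sum.cong)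
    also have "\<dots> = (\<Sum>B\<in>bases G n. chain_dist G n c T B0 t B * k (path_mset B))"
    proof (intro sum.cong refl arg_cong2[of _ _ _ _ "(*)"])
      fix B assume "B \<in> bases G n"
      have "(\<Sum>s\<in>?X. if ?A s = path_mset B then k (path_mset B) / N (path_mset B) else 0)
        = N (path_mset B) * (k (path_mset B) / N (path_mset B))"
        unfolding sum.inter_filter[OF finite_profiles, symmetric] N_def by simp
      then show "(\<Sum>s\<in>?X. if ?A s = path_mset B then k (path_mset B) / N (path_mset B) else 0) = k (path_mset B)"
        using Npos[OF \<open>B \<in> bases G n\<close>] by simp
    qed
    also have "\<dots> = (glauber (paths G) ?w ^^ t) k (path_mset B0)"
      by (rule sum_chain_dist[OF B0 n])
    finally show ?thesis .
  qed
  have sum_gb: "(\<Sum>s\<in>?X. k (?A s) * gb (?A s)) = msum (paths G) n (\<lambda>A. ?w A * k A) / msum (paths G) n ?w" for k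
  proof -
    have "(\<Sum>s\<in>?X. k (?A s) * gb (?A s)) = msum (paths G) n (\<lambda>A. k A * gb A)"
      by (rule sum_profiles[where F = "\<lambda>A. k A * gb A"])
    also have "\<dots> = msum (paths G) n (\<lambda>A. ?w A * k A * (1 / msum (paths G) n ?w))"
      by (rule msum_cong) (simp add: gb_def)
    finally show ?thesis unfolding msum_cmult_right by simp
  qed
  define d where "d A = out A - gb A" for A
  define k :: "'a set multiset \<Rightarrow> real" where "k A = (if 0 \<le> d A then 1 else 0)" for A
  have Z: "0 < msum (paths G) n ?w"
    by (rule msum_pos[OF finite_paths paths_nonempty game_weight_pos])
  have one: "(\<Sum>s\<in>?X. d (?A s)) = 0"
  proof -
    have "(glauber (paths G) ?w ^^ t) (\<lambda>_. 1) (path_mset B0) = 1"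
      using glauber_iterate_const[where w = ?w and t = t and c = 1, OF finite_paths paths_nonempty game_weight_pos] by simp
    then show ?thesis
      using sum_out[of "\<lambda>_. 1"] sum_gb[of "\<lambda>_. 1"] Z by (simp add: d_def sum_subtractf)
  qed
  have "dTV ?X (output_dist G n c T B0 t) (gibbs G n c T) = (1/2) * (\<Sum>s\<in>?X. \<bar>d (?A s)\<bar>)"
    unfolding dTV_def d_def gb by (simp add: out)
  also have "(\<Sum>s\<in>?X. \<bar>d (?A s)\<bar>) = (\<Sum>s\<in>?X. 2 * (k (?A s) * d (?A s)) - d (?A s))"
    by (intro sum.cong refl) (simp add: k_def)
  also have "\<dots> = 2 * (\<Sum>s\<in>?X. k (?A s) * d (?A s))"
    using one by (simp add: sum_subtractf sum_distrib_left)
  also have "(\<Sum>s\<in>?X. k (?A s) * d (?A s)) = (glauber (paths G) ?w ^^ t) k (path_mset B0)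
      - msum (paths G) n (\<lambda>A. ?w A * k A) / msum (paths G) n ?w"
    unfolding d_def right_diff_distrib sum_subtractf sum_out sum_gb ..
  also have "\<dots> \<le> b"
    by (rule order_trans[OF abs_ge_self bound]) (simp_all add: k_def)
  finally show ?thesis by simp
qed

section \<open>Numerical bounds and the choice of the constant\<close>

text \<open>With \<open>L = ln (n / \<epsilon>)\<close>, halving with rounding leaves at least
  \<open>t / 4\<close> steps once \<open>t\<close> is at least 2, hence \<open>10 * n * L\<close> of
  them, and \<open>(1 - 1 / n) ^ t'\<close> is at most \<open>exp (- 10 * L)\<close>. The condition
  \<open>2 \<le> n\<close> keeps \<open>L\<close> away from 0.\<close>

lemma half_time_bound:
  fixes n t t' :: nat and \<epsilon> :: real
  assumes n: "2 \<le> n" and e: "0 < \<epsilon>" "\<epsilon> < 1"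
    and t: "40 * real n * ln (real n / \<epsilon>) \<le> real t" and t': "t div 2 \<le> t'"
  shows "(real (n - 1) / real n) ^ t' \<le> (\<epsilon> / real n) ^ 10"
proof -
  define x where "x = \<epsilon> / real n"
  define L where "L = ln (real n / \<epsilon>)"
  have x: "0 < x" unfolding x_def using n e by simp
  have "ln 2 \<le> L" unfolding L_def using n e by (intro ln_mono) (auto simp: pos_le_divide_eq)
  moreover have "ln (1 / 2) \<le> (1 / 2 - 1 :: real)" by (rule ln_le_minus_one) simp
  ultimately have L: "1 / 2 \<le> L" by (simp add: ln_divide_pos)
  have "40 * (2 * (1 / 2)) \<le> 40 * (real n * L)" using n L by (intro mult_left_mono mult_mono) auto
  then have "2 \<le> t" using t unfolding L_def[symmetric] by (simp add: mult.assoc)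
  then have "t \<le> 4 * (t div 2)" by presburger
  then have "real t \<le> 4 * real t'" using t' by linarith
  then have tn: "10 * L \<le> real t' / real n" using t n unfolding L_def[symmetric] by (simp add: field_simps)
  have lnx: "ln x = - L" unfolding x_def L_def using e n by (simp add: ln_divide_pos)
  have "1 + (- (1 / real n)) \<le> exp (- (1 / real n))" by (rule exp_ge_add_one_self)
  then have "real (n - 1) / real n \<le> exp (- (1 / real n))" using n by (simp add: field_simps)
  then have "(real (n - 1) / real n) ^ t' \<le> exp (- (1 / real n)) ^ t'" by (intro power_mono) auto
  also have "\<dots> = exp (- (real t' / real n))" by (simp add: exp_of_nat_mult[symmetric])
  also have "\<dots> \<le> exp (real 10 * ln x)" using tn lnx by simp
  also have "\<dots> = x ^ 10" unfolding exp_of_nat_mult using x by simp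
  finally show ?thesis by (simp add: x_def)
qed

text \<open>Crude on purpose: the time bound sees only the logarithm of this quantity.\<close>

lemma ln_fact_bound:
  assumes "2 \<le> n" shows "ln (fact n + 1) \<le> 2 * (real n)\<^sup>2"
proof -
  have "(fact n :: real) \<le> real n ^ n" using fact_le_power[of n, where 'a = real] by simp
  moreover have "(1::real) \<le> fact n" by simp
  ultimately have "fact n + 1 \<le> 2 * real n ^ n" by linarith
  also have "\<dots> \<le> real n * real n ^ n" using assms by (intro mult_right_mono) auto
  finally have "fact n + 1 \<le> real n ^ Suc n" by simp
  then have "ln (fact n + 1) \<le> ln (real n ^ Suc n)" by (rule ln_mono) (simp add: add_pos_pos)
  also have "\<dots> = real (Suc n) * ln (real n)" by (rule ln_realpow)
  also have "\<dots> \<le> (2 * real n) * real n"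
    using assms ln_le_minus_one[of "real n"] by (intro mult_mono) auto
  finally show ?thesis by (simp add: power2_eq_square)
qed

theorem mainTheorem4:
  "\<exists>C::real. C > 0 \<and>
     (\<forall>(G :: nat ep) (n::nat) (c :: nat \<Rightarrow> nat \<Rightarrow> rat) (T::real) (\<epsilon>::real) B0 (t::nat).
        wf_ep G \<longrightarrow> n \<ge> 1 \<longrightarrow>
        (\<forall>e\<in>arcs G. \<forall>k. c e k \<ge> 0) \<longrightarrow>
        (\<forall>e\<in>arcs G. mono (c e)) \<longrightarrow>
        T \<ge> 0 \<longrightarrow> 0 < \<epsilon> \<longrightarrow> \<epsilon> < 1 \<longrightarrow>
        B0 \<in> bases G n \<longrightarrow>
        real t \<ge> C * real n * ln (real n / \<epsilon>) \<longrightarrow>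
        dTV (profiles G n) (output_dist G n c T B0 t) (gibbs G n c T) \<le> \<epsilon>)"
proof (intro exI[of _ 40] conjI allI impI)
  fix G :: "nat ep" and n :: nat and c :: "nat \<Rightarrow> nat \<Rightarrow> rat" and T \<epsilon> :: real and B0 and t :: nat
  assume wf: "wf_ep G" and n: "n \<ge> 1" and mon: "\<forall>e\<in>arcs G. mono (c e)" and T: "T \<ge> 0"
    and e: "0 < \<epsilon>" "\<epsilon> < 1" and B0: "B0 \<in> bases G n" and t: "real t \<ge> 40 * real n * ln (real n / \<epsilon>)"
  let ?P = "paths G"
  let ?w = "game_weight G c T"
  have nd: "neg_dep ?P ?w" and ex: "exchangeable ?P ?w"
    unfolding game_weight_def
    by (rule neg_dep_ep_weight[OF wf], rule cumcost_convex[OF mon T])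
      (rule exchangeable_ep_weight[OF wf], rule cumcost_convex[OF mon T])
  have "set_mset (path_mset B0) \<subseteq> ?P" "size (path_mset B0) = n"
    using B0 path_mset_base[of B0 G n] by (auto simp: bases_def)
  then obtain y where y: "y ` {..<n} \<subseteq> ?P" "conf y {..<n} = path_mset B0" using ex_conf by blast
  have bound: "\<bar>(glauber ?P ?w ^^ t) h (path_mset B0) - msum ?P n (\<lambda>A. ?w A * h A) / msum ?P n ?w\<bar> \<le> \<epsilon>"
    if h: "\<And>A. 0 \<le> h A" "\<And>A. h A \<le> 1" for h
  proof (cases "n = 1")
    case True
    \<comment> \<open>A single resampling step is exact here, but the time bound of the general case degenerates as \<open>\<epsilon>\<close> tends to 1.\<close>
    then have "0 < real t" using t e by (smt (verit) ln_gt_zero less_divide_eq_1 mult_1 of_nat_1 mult_pos_pos)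
    then obtain s where s: "t = Suc s" by (cases t) auto
    obtain a where a: "path_mset B0 = {#a#}" using \<open>size (path_mset B0) = n\<close> True size_1_singleton_mset by auto
    have "(glauber ?P ?w ^^ t) h (path_mset B0) = msum ?P 1 (\<lambda>A. ?w A * (glauber ?P ?w ^^ s) h A) / msum ?P 1 ?w"
      by (simp add: s a glauber_def[of _ _ "(glauber ?P ?w ^^ s) h"] up_def tot_def)
    also have "msum ?P 1 (\<lambda>A. ?w A * (glauber ?P ?w ^^ s) h A) = msum ?P 1 (\<lambda>A. ?w A * h A)"
      using glauber_iterate_adjoint[where w = ?w and m = 0 and k = "\<lambda>_. 1" and t = s and h = h, OF finite_paths paths_nonempty game_weight_pos]
        glauber_iterate_const[where w = ?w and t = s and c = 1, OF finite_paths paths_nonempty game_weight_pos]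
      by (simp del: msum.simps)
    finally show ?thesis using True e by simp
  next
    case False
    then have n2: "2 \<le> n" using n by simp
    define m where "m = n - 1"
    have nm: "n = Suc m" using n by (simp add: m_def)
    define t1 where "t1 = t div 2"
    define t0 where "t0 = t - t div 2"
    have tt: "t = t0 + t1" by (simp add: t0_def t1_def)
    \<comment> \<open>Of the ten powers of \<open>x\<close>, two turn \<open>2 * n\<^sup>2\<close>
      into \<open>2 * \<epsilon>\<^sup>2\<close> and the other eight, at most 1/256, reach
      \<open>\<delta>\<^sup>2\<close> for \<open>\<delta> = \<epsilon> / 8\<close>; then
      \<open>4 * \<delta>\<close> is half of \<open>\<epsilon>\<close>. In the coverage term one
      power cancels \<open>n\<close> and the rest is at most 1/2.\<close>
    define x where "x = \<epsilon> / real n"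
    have x: "0 < x" "x \<le> 1 / 2" unfolding x_def using n2 e by (auto simp: field_simps)
    have "t div 2 \<le> t1" "t div 2 \<le> t0" by (auto simp: t1_def t0_def)
    then have r: "(real m / real n) ^ t1 \<le> x ^ 10" "(real m / real n) ^ t0 \<le> x ^ 10"
      unfolding x_def m_def using half_time_bound[OF n2 e t] by blast+
    have xn: "real n * x = \<epsilon>" unfolding x_def using n2 by simp
    have "x ^ 8 \<le> (1/2) ^ 8" "x ^ 9 \<le> (1/2) ^ 9" using x by (intro power_mono; simp)+
    then have p8: "x ^ 8 \<le> 1 / 256" and p9: "x ^ 9 \<le> 1 / 2" by (simp_all add: power_divide)
    have "(real m / real n) ^ t1 * ln (fact n + 1) \<le> x ^ 10 * (2 * (real n)\<^sup>2)"
      by (intro mult_mono r ln_fact_bound n2) auto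
    also have "\<dots> = 2 * (real n * x)\<^sup>2 * x ^ 8" by (simp add: power2_eq_square eval_nat_numeral)
    also have "\<dots> \<le> 2 * \<epsilon>\<^sup>2 * (1 / 256)" unfolding xn using p8 by (intro mult_left_mono) auto
    also have "\<dots> \<le> (\<epsilon> / 8)\<^sup>2" by (simp add: power_divide)
    finally have d: "(real m / real n) ^ t1 * ln (fact n + 1) \<le> (\<epsilon> / 8)\<^sup>2" .
    have "real n * (real m / real n) ^ t0 \<le> real n * x ^ 10" using r by (intro mult_left_mono) auto
    also have "\<dots> = (real n * x) * x ^ 9" by (simp add: eval_nat_numeral)
    also have "\<dots> \<le> \<epsilon> * (1 / 2)" unfolding xn using p9 e by (intro mult_left_mono) auto
    finally have t0: "real n * (real m / real n) ^ t0 \<le> \<epsilon> / 2" by simp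
    have "\<bar>(glauber ?P ?w ^^ (t0 + t1)) h (conf y {..<n}) - msum ?P n (\<lambda>A. ?w A * h A) / msum ?P n ?w\<bar>
      \<le> real n * (real m / real n) ^ t0 + 4 * (\<epsilon> / 8)"
      unfolding nm
    proof (rule glauber_mixing[where w = ?w, OF finite_paths paths_nonempty game_weight_pos nd ex])
      show "y ` {..<Suc m} \<subseteq> ?P" using y(1) unfolding nm .
      show "(real m / real (Suc m)) ^ t1 * ln (fact (Suc m) + 1) \<le> (\<epsilon> / 8)\<^sup>2" using d unfolding nm .
    qed (use h e in auto)
    then show ?thesis unfolding tt y(2) using t0 by linarith
  qed
  show "dTV (profiles G n) (output_dist G n c T B0 t) (gibbs G n c T) \<le> \<epsilon>"
    by (rule dTV_le[OF B0 n bound])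
qed simp

end
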